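(* Let $\Lambda$ be the function defined by $\Lambda(u)=\frac{u^2+u^4}{1-u}$. Let $p_n$ be the number of interval posets with $n$ minimal elements, and let $P(z)=\sum_{n\ge1}p_nz^n$ be the (ordinary) generating function of interval posets. The radius of convergence $\rho$ of $P(z)$ is given by $\rho=\tau-\Lambda(\tau)$, where $\tau$ is the unique solution of $\Lambda'(u)=1$ such that $\tau\in(0,1)$. The behavior of $P(z)$ near $\rho$ is given by \[ P(z)=\tau-\sqrt{\frac{2\rho}{\Lambda''(\tau)}}\sqrt{1-\frac{z}{\rho}}+\mathcal{O}\left(1-\frac{z}{\rho}\right). \] Numerically, $\tau\approx0.2708$, $\rho\approx0.1629$, $\sqrt{\frac{2\rho}{\Lambda''(\tau)}}\approx0.2206$. As a consequence, as $n\to\infty$, \[ p_n\sim\sqrt{\frac{\rho}{2\pi\Lambda''(\tau)}}\,\frac{\rho^{-n}}{n^{3/2}}. \] Numerically, $\sqrt{\frac{\rho}{2\pi\Lambda''(\tau)}}\approx0.0622$ and $\rho^{-1}\approx6.1403$.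
   Context: A permutation $\sigma=\sigma(1)\dots\sigma(n)$ of size $n$ is a word on $\{1,\dots,n\}$ containing each letter exactly once. A non-empty interval of $\sigma$ is a set of values $[j,j+h]=\{j,\dots,j+h\}$ such that $\{\sigma(i),\dots,\sigma(i+h)\}=[j,j+h]$ for some $i$. The interval poset of $\sigma$ is the poset of all non-empty intervals of $\sigma$ (including singletons and $[1,n]$) ordered by inclusion; it has $n$ minimal elements (the singletons) exactly when $\sigma$ has size $n$. An interval poset is a poset arising in this way from some permutation; two interval posets are equal (counted once) when they are equal as sets of intervals ordered by inclusion (not merely isomorphic). *)

theory Defs
  imports
    "HOL-Analysis.Analysis"
    "HOL-Combinatorics.Permutations"
    "HOL-Library.Landau_Symbols"
begin

text \<open>A permutation of size \<open>n\<close> is a function \<open>\<sigma>\<close> with \<open>\<sigma> permutes {1..n}\<close>; positions are the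
  arguments and values the results. An interval is a set of values.\<close>

definition intervals :: "nat \<Rightarrow> (nat \<Rightarrow> nat) \<Rightarrow> nat set set" where
  "intervals n \<sigma> = {{j..j+h} | j h. \<exists>i\<ge>1. i + h \<le> n \<and> \<sigma> ` {i..i+h} = {j..j+h}}"

text \<open>A poset is represented by its order relation, whose field is the carrier. Two interval posets
  are thus equal iff they consist of the same intervals.\<close>

definition interval_poset :: "nat \<Rightarrow> (nat \<Rightarrow> nat) \<Rightarrow> nat set rel" where
  "interval_poset n \<sigma> = relation_of (\<subseteq>) (intervals n \<sigma>)"

definition is_interval_poset :: "nat set rel \<Rightarrow> bool" where
  "is_interval_poset r \<longleftrightarrow> (\<exists>n \<sigma>. \<sigma> permutes {1..n} \<and> r = interval_poset n \<sigma>)"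

definition minimal_elements :: "'a rel \<Rightarrow> 'a set" where
  "minimal_elements r = {a \<in> Field r. \<forall>b. (b, a) \<in> r \<longrightarrow> b = a}"

definition num_interval_posets :: "nat \<Rightarrow> nat" where
  "num_interval_posets n = card {r. is_interval_poset r \<and> card (minimal_elements r) = n}"

text \<open>The generating function starts at \<open>n = 1\<close>: the empty poset of the empty permutation is left
  out.\<close>

definition interval_poset_gf :: "complex fps" where
  "interval_poset_gf = Abs_fps (\<lambda>n. if n \<ge> 1 then of_nat (num_interval_posets n) else 0)"

definition \<Lambda> :: "real \<Rightarrow> real" where
  "\<Lambda> u = (u^2 + u^4) / (1 - u)"

text \<open>A neighbourhood of the singularity \<open>\<rho>\<close> slit along \<open>[\<rho>, \<infinity>)\<close>, together with the disc of
  convergence: the domain on which a generating function with a square-root singularity at \<open>\<rho>\<close> is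
  expanded.\<close>

definition slit_domain :: "real \<Rightarrow> real \<Rightarrow> complex set" where
  "slit_domain \<rho> r = ball 0 \<rho> \<union> (ball (of_real \<rho>) r - of_real ` {\<rho>..})"

end

theory Submission
  imports Defs "HOL-Probability.Probability" "HOL-Complex_Analysis.Complex_Analysis"
    "HOL-Real_Asymp.Real_Asymp"
begin

text \<open>
The intervals of a permutation of size at least 2 are organised by a root node. Either the range of values can be
split into two intervals; then all such splitting points cut it into at least two blocks, and the intervals that lie
in no block are exactly the unions of consecutive blocks (a linear node). Or there is no such point; then the
maximal proper intervals are disjoint, there are at least four of them, and only the whole range lies in no block
(a simple node). Recursively, interval posets of size \<open>n\<close> correspond to plane trees with \<open>n\<close> leaves whose nodes are
linear with at least 2 or simple with at least 4 children. That different trees have different intervals is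
\<open>family_inj\<close>, that every family arises from a tree is \<open>interval_family_imp_tree\<close>, and that every tree is realised by a
permutation is \<open>tree_imp_key\<close>, which rests on the existence of simple permutations of every size at least 4. Hence
\<open>P = z + (P\<^sup>2 + P\<^sup>3 + \<dots>) + (P\<^sup>4 + P\<^sup>5 + \<dots>)\<close>, that is \<open>P = z + \<Lambda>(P)\<close>.

So \<open>P\<close> is inverse to \<open>\<psi>(u) = u - \<Lambda>(u)\<close>, whose derivative first vanishes at \<open>\<tau>\<close>, with value \<open>\<rho> = \<psi>(\<tau>)\<close>. The coefficients
come first. By Lagrange inversion and Cauchy's formula, \<open>n p\<^sub>n\<close> is the mean of \<open>u / \<psi>(u)\<^sup>n\<close> over the circle \<open>|u| = \<tau>\<close>. On this
circle \<open>|\<psi>|\<close> is at least \<open>\<rho>\<close> plus a multiple of the squared angle (\<open>psi_circ_lower\<close>), so \<open>laplace_method\<close> applies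
and \<open>p\<^sub>n\<close> is asymptotic to a constant times \<open>\<rho>\<^sup>-\<^sup>n n\<^sup>-\<^sup>3\<^sup>/\<^sup>2\<close> (\<open>coefficient_asymptotics\<close>). This yields the radius of convergence
and absolute convergence on the boundary circle.

For the behaviour near \<open>\<rho>\<close>, the equation for \<open>P\<close> takes the form
\<open>(\<rho> - z) (1 - P) = (P - \<tau>)\<^sup>2 (P\<^sup>2 + 2 \<tau> P + 2 + 3 \<tau>\<^sup>2)\<close>, because \<open>\<tau>\<close> is a double root. At \<open>z = \<rho>\<close> it gives \<open>P(\<rho>) = \<tau>\<close>. Near \<open>\<tau>\<close>
a holomorphic change of coordinates \<open>h\<close> with \<open>h(P)\<^sup>2 = \<rho> - z\<close> can be inverted, and \<open>P = h\<^sup>-\<^sup>1(- sqrt (\<rho> - z))\<close> both continues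
\<open>P\<close> to the slit neighbourhood and gives its expansion (\<open>square_root_expansion\<close>). The numerical values follow from
locating the root of a quartic polynomial and from bounds for \<open>\<pi>\<close>.
\<close>

section \<open>Intervals as convex ranges of values\<close>

text \<open>A range of values \<open>{x..<y}\<close> is stored as the pair \<open>(x, y)\<close>. The key \<open>f\<close> sends a value to its position; only
the order of the keys matters, so any injective function may serve in place of the inverse of a
permutation. This freedom makes it easy to build permutations with prescribed intervals: keys of
blocks can be combined arithmetically, without renumbering the positions.\<close>

definition key_intervals :: "(nat \<Rightarrow> nat) \<Rightarrow> nat \<Rightarrow> nat \<Rightarrow> (nat \<times> nat) set" where
  "key_intervals f a b = {(x, y). a \<le> x \<and> x < y \<and> y \<le> b \<and>
     (\<forall>u\<in>{x..<y}. \<forall>w\<in>{x..<y}. \<forall>v\<in>{a..<b}. f u < f v \<and> f v < f w \<longrightarrow> v \<in> {x..<y})}"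

lemma key_intervalsI:
  assumes "a \<le> x" "x < y" "y \<le> b"
    and "\<And>u v w. \<lbrakk>x \<le> u; u < y; x \<le> w; w < y; a \<le> v; v < b; f u < f v; f v < f w\<rbrakk> \<Longrightarrow> x \<le> v \<and> v < y"
  shows "(x, y) \<in> key_intervals f a b"
proof -
  have "\<forall>u\<in>{x..<y}. \<forall>w\<in>{x..<y}. \<forall>v\<in>{a..<b}. f u < f v \<and> f v < f w \<longrightarrow> v \<in> {x..<y}"
  proof (intro ballI impI)
    fix u w v assume "u \<in> {x..<y}" "w \<in> {x..<y}" "v \<in> {a..<b}" "f u < f v \<and> f v < f w"
    then show "v \<in> {x..<y}" using assms(4)[of u w v] by simp
  qed
  with assms(1-3) show ?thesis unfolding key_intervals_def by blast
qed

lemma key_intervalsD: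
  assumes "(x, y) \<in> key_intervals f a b"
  shows "a \<le> x" "x < y" "y \<le> b"
    and "\<And>u v w. \<lbrakk>x \<le> u; u < y; x \<le> w; w < y; a \<le> v; v < b; f u < f v; f v < f w\<rbrakk> \<Longrightarrow> x \<le> v \<and> v < y"
proof -
  have *: "a \<le> x \<and> x < y \<and> y \<le> b \<and>
     (\<forall>u\<in>{x..<y}. \<forall>w\<in>{x..<y}. \<forall>v\<in>{a..<b}. f u < f v \<and> f v < f w \<longrightarrow> v \<in> {x..<y})"
    using assms unfolding key_intervals_def by blast
  then show "a \<le> x" "x < y" "y \<le> b" by blast+
  show "x \<le> v \<and> v < y"
    if "x \<le> u" "u < y" "x \<le> w" "w < y" "a \<le> v" "v < b" "f u < f v" "f v < f w" for u v w
  proof -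
    have "v \<in> {x..<y}"
      using * that by (meson atLeastLessThan_iff)
    then show ?thesis by simp
  qed
qed

lemma not_key_intervalE:
  assumes "(x, y) \<notin> key_intervals f a b" "a \<le> x" "x < y" "y \<le> b"
  obtains u v w where "x \<le> u" "u < y" "x \<le> w" "w < y" "a \<le> v" "v < b" "f u < f v" "f v < f w"
    "\<not> (x \<le> v \<and> v < y)"
  using key_intervalsI[of a x y b f] assms by blast

text \<open>The closure properties of the intervals of a permutation. Two overlapping intervals have an
interval as union, intersection and differences. These alone would also admit families that no
permutation realises: three consecutive blocks whose union is the only further interval. The last
axiom excludes this, and reflects that there is no simple permutation of size 3.\<close>

locale interval_family =
  fixes F :: "(nat \<times> nat) set" and a b :: nat
  assumes nonempty: "a < b"
    and bounds: "(x, y) \<in> F \<Longrightarrow> a \<le> x \<and> x < y \<and> y \<le> b"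
    and whole: "(a, b) \<in> F"
    and single: "a \<le> x \<Longrightarrow> x < b \<Longrightarrow> (x, Suc x) \<in> F"
    and overlap_left: "\<lbrakk>(x, y) \<in> F; (x', y') \<in> F; x < x'; x' < y; y < y'\<rbrakk> \<Longrightarrow> (x, x') \<in> F"
    and overlap_inter: "\<lbrakk>(x, y) \<in> F; (x', y') \<in> F; x < x'; x' < y; y < y'\<rbrakk> \<Longrightarrow> (x', y) \<in> F"
    and overlap_right: "\<lbrakk>(x, y) \<in> F; (x', y') \<in> F; x < x'; x' < y; y < y'\<rbrakk> \<Longrightarrow> (y, y') \<in> F"
    and overlap_union: "\<lbrakk>(x, y) \<in> F; (x', y') \<in> F; x < x'; x' < y; y < y'\<rbrakk> \<Longrightarrow> (x, y') \<in> F"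
    and no_simple_triple: "\<lbrakk>(x, y) \<in> F; (y, z) \<in> F; (z, w) \<in> F; (x, w) \<in> F\<rbrakk>
      \<Longrightarrow> (x, z) \<in> F \<or> (y, w) \<in> F"

text \<open>Disjoint intervals occupy disjoint stretches of positions, so one comparison of positions decides
all of them.\<close>

lemma key_intervals_uniform:
  assumes inj: "inj_on f {a..<b}"
    and I: "(x, y) \<in> key_intervals f a b" and J: "(x', y') \<in> key_intervals f a b"
    and disj: "y \<le> x' \<or> y' \<le> x"
    and u: "x \<le> u" "u < y" and v: "x' \<le> v" "v < y'" and lt: "f u < f v"
    and u': "x \<le> u'" "u' < y" and v': "x' \<le> v'" "v' < y'"
  shows "f u' < f v'"
proof -
  note bI = key_intervalsD(1-3)[OF I] and bJ = key_intervalsD(1-3)[OF J]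
  have in_ab: "u \<in> {a..<b}" "u' \<in> {a..<b}" "v \<in> {a..<b}" "v' \<in> {a..<b}"
    using bI bJ u u' v v' by auto
  have "u' \<noteq> v" "u' \<noteq> v'" "u \<noteq> v'"
    using u v u' v' disj by auto
  then have ne: "f u' \<noteq> f v" "f u' \<noteq> f v'" "f u \<noteq> f v'"
    using inj in_ab by (auto simp: inj_on_eq_iff)
  have "f u' < f v"
  proof (rule ccontr)
    assume "\<not> f u' < f v"
    then have "f v < f u'" using ne by simp
    then have "x \<le> v \<and> v < y"
      using key_intervalsD(4)[OF I u u', of v] lt in_ab by auto
    then show False using disj v by auto
  qed
  show ?thesis
  proof (rule ccontr)
    assume "\<not> f u' < f v'"
    then have "f v' < f u'" using ne by simp
    then have "x' \<le> u' \<and> u' < y'"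
      using key_intervalsD(4)[OF J v' v, of u'] \<open>f u' < f v\<close> in_ab by auto
    then show False using disj u' by auto
  qed
qed

text \<open>For the last axiom: if neither \<open>I \<union> J\<close> nor \<open>J \<union> K\<close> is an interval, then \<open>K\<close> lies between \<open>I\<close> and \<open>J\<close> in position,
and \<open>I\<close> lies between \<open>J\<close> and \<open>K\<close>, which is impossible.\<close>

lemma interval_family_key_intervals:
  assumes "a < b" and inj: "inj_on f {a..<b}"
  shows "interval_family (key_intervals f a b) a b"
proof
  let ?F = "key_intervals f a b"
  show "a < b" by fact
  show "a \<le> x \<and> x < y \<and> y \<le> b" if "(x, y) \<in> ?F" for x y
    using key_intervalsD[OF that] by simp
  show "(a, b) \<in> ?F" using \<open>a < b\<close> by (auto simp: key_intervals_def)
  show "(x, Suc x) \<in> ?F" if "a \<le> x" "x < b" for x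
    using that by (intro key_intervalsI) (auto simp: less_Suc_eq_le dest: le_antisym)
next
  let ?F = "key_intervals f a b"
  fix x y x' y'
  assume I: "(x, y) \<in> ?F" and J: "(x', y') \<in> ?F" and o: "x < x'" "x' < y" "y < y'"
  note bI = key_intervalsD(1-3)[OF I] and bJ = key_intervalsD(1-3)[OF J]
  have ne: "f u \<noteq> f v" if "u \<noteq> v" "a \<le> u" "u < b" "a \<le> v" "v < b" for u v
    using that inj by (auto simp: inj_on_eq_iff)
  show "(x, x') \<in> ?F"
  proof (rule key_intervalsI)
    fix u v w assume *: "x \<le> u" "u < x'" "x \<le> w" "w < x'" "a \<le> v" "v < b" "f u < f v" "f v < f w"
    have v: "x \<le> v \<and> v < y" using key_intervalsD(4)[OF I, of u w v] * o by auto
    show "x \<le> v \<and> v < x'"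
    proof (rule ccontr)
      assume "\<not> ?thesis"
      then have v': "x' \<le> v" "v < y'" using v o by auto
      have "\<not> (f u < f y \<and> f y < f w)"
        using key_intervalsD(4)[OF I, of u w y] * o bI bJ by auto
      moreover have "f y \<noteq> f u" "f y \<noteq> f w" using ne[of y u] ne[of y w] * o bI bJ by auto
      ultimately consider "f y < f u" | "f w < f y" by linarith
      then show False
      proof cases
        case 1 then show False
          using key_intervalsD(4)[OF J, of y v u] * o bI bJ v' by auto
      next
        case 2 then show False
          using key_intervalsD(4)[OF J, of v y w] * o bI bJ v' by auto
      qed
    qed
  qed (use bI o in auto)
  show "(y, y') \<in> ?F"
  proof (rule key_intervalsI)
    fix u v w assume *: "y \<le> u" "u < y'" "y \<le> w" "w < y'" "a \<le> v" "v < b" "f u < f v" "f v < f w"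
    have v: "x' \<le> v \<and> v < y'" using key_intervalsD(4)[OF J, of u w v] * o by auto
    show "y \<le> v \<and> v < y'"
    proof (rule ccontr)
      assume "\<not> ?thesis"
      then have v': "x \<le> v" "v < y" using v o by auto
      have "\<not> (f u < f x \<and> f x < f w)"
        using key_intervalsD(4)[OF J, of u w x] * o bI bJ by auto
      moreover have "f x \<noteq> f u" "f x \<noteq> f w" using ne[of x u] ne[of x w] * o bI bJ by auto
      ultimately consider "f x < f u" | "f w < f x" by linarith
      then show False
      proof cases
        case 1 then show False
          using key_intervalsD(4)[OF I, of x v u] * o bI bJ v' by auto
      next
        case 2 then show False
          using key_intervalsD(4)[OF I, of v x w] * o bI bJ v' by auto
      qed
    qed
  qed (use bJ o in auto)
  show "(x', y) \<in> ?F"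
  proof (rule key_intervalsI)
    fix u v w assume *: "x' \<le> u" "u < y" "x' \<le> w" "w < y" "a \<le> v" "v < b" "f u < f v" "f v < f w"
    show "x' \<le> v \<and> v < y"
      using key_intervalsD(4)[OF I, of u w v] key_intervalsD(4)[OF J, of u w v] * o by auto
  qed (use bI bJ o in auto)
  show "(x, y') \<in> ?F"
  proof (rule key_intervalsI)
    fix u v w assume *: "x \<le> u" "u < y'" "x \<le> w" "w < y'" "a \<le> v" "v < b" "f u < f v" "f v < f w"
    \<comment> \<open>The shared point \<open>x'\<close> lies on one side of \<open>v\<close>; connect it to \<open>u\<close> or \<open>w\<close> on the other.\<close>
    consider "v = x'" | "f v < f x'" | "f x' < f v"
      using ne[of v x'] * bJ o by fastforce
    then show "x \<le> v \<and> v < y'"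
    proof cases
      case 2
      then show ?thesis
        using key_intervalsD(4)[OF I, of u x' v] key_intervalsD(4)[OF J, of u x' v] * o
        by (cases "u < y") auto
    next
      case 3
      then show ?thesis
        using key_intervalsD(4)[OF I, of x' w v] key_intervalsD(4)[OF J, of x' w v] * o
        by (cases "w < y") auto
    qed (use o in auto)
  qed (use bI bJ o in auto)
next
  let ?F = "key_intervals f a b"
  fix x y z w
  assume I: "(x, y) \<in> ?F" and J: "(y, z) \<in> ?F" and K: "(z, w) \<in> ?F" and W: "(x, w) \<in> ?F"
  note b = key_intervalsD(1-3)[OF I] key_intervalsD(1-3)[OF J] key_intervalsD(1-3)[OF K]
  show "(x, z) \<in> ?F \<or> (y, w) \<in> ?F"
  proof (rule ccontr)
    assume "\<not> ?thesis"
    then have n1: "(x, z) \<notin> ?F" and n2: "(y, w) \<notin> ?F" by auto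
    \<comment> \<open>A failure of \<open>I \<union> J\<close> places \<open>K\<close> between \<open>I\<close> and \<open>J\<close>.\<close>
    have ab: "a \<le> x" "x < z" "z \<le> b" "a \<le> y" "y < w" "w \<le> b" using b by simp_all
    obtain p q r where pqr: "x \<le> p" "p < z" "x \<le> r" "r < z" "a \<le> q" "q < b"
      "f p < f q" "f q < f r" "\<not> (x \<le> q \<and> q < z)"
      by (rule not_key_intervalE[OF n1 ab(1-3)])
    have q: "z \<le> q" "q < w"
      using key_intervalsD(4)[OF W, of p r q] pqr b by auto
    obtain p' q' r' where pqr': "y \<le> p'" "p' < w" "y \<le> r'" "r' < w" "a \<le> q'" "q' < b"
      "f p' < f q'" "f q' < f r'" "\<not> (y \<le> q' \<and> q' < w)"
      by (rule not_key_intervalE[OF n2 ab(4-6)])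
    have q': "x \<le> q'" "q' < y"
      using key_intervalsD(4)[OF W, of p' r' q'] pqr' b by auto
    have no: "\<not> (p < y \<and> r < y)" "\<not> (y \<le> p \<and> y \<le> r)" "\<not> (p' < z \<and> r' < z)" "\<not> (z \<le> p' \<and> z \<le> r')"
      using key_intervalsD(4)[OF I, of p r q] key_intervalsD(4)[OF J, of p r q]
        key_intervalsD(4)[OF J, of p' r' q'] key_intervalsD(4)[OF K, of p' r' q'] pqr pqr' q q' b
      by auto
    note uIK = key_intervals_uniform[OF inj I K] and uKI = key_intervals_uniform[OF inj K I]
      and uKJ = key_intervals_uniform[OF inj K J] and uJK = key_intervals_uniform[OF inj J K]
    show False
    proof (cases "p < y")
      case True
      then have r: "y \<le> r" using no by auto
      have IK: "f u < f v" if "x \<le> u" "u < y" "z \<le> v" "v < w" for u v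
        using uIK[of p q u v] that True pqr q b by auto
      have KJ: "f u < f v" if "z \<le> u" "u < w" "y \<le> v" "v < z" for u v
        using uKJ[of q r u v] that r pqr q b by auto
      have IJ: "f u < f v" if "x \<le> u" "u < y" "y \<le> v" "v < z" for u v
        using IK[OF that(1,2) q] KJ[OF q that(3,4)] by simp
      show False
      proof (cases "p' < z")
        case True
        then show False using IJ[OF q', of p'] pqr' by auto
      next
        case False
        then show False using IK[OF q', of p'] pqr' by auto
      qed
    next
      case False
      then have r: "x \<le> r" "r < y" using no pqr by auto
      have KI: "f u < f v" if "z \<le> u" "u < w" "x \<le> v" "v < y" for u v
        using uKI[of q r u v] that r pqr q b by auto
      have JK: "f u < f v" if "y \<le> u" "u < z" "z \<le> v" "v < w" for u v
        using uJK[of p q u v] that False pqr q b by auto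
      have JI: "f u < f v" if "y \<le> u" "u < z" "x \<le> v" "v < y" for u v
        using JK[OF that(1,2) q] KI[OF q that(3,4)] by simp
      show False
      proof (cases "r' < z")
        case True
        then show False using JI[OF _ _ q', of r'] pqr' by auto
      next
        case False
        then show False using KI[OF _ _ q', of r'] pqr' by auto
      qed
    qed
  qed
qed

text \<open>Subtraction reverses the arrangement, and betweenness of positions is symmetric.\<close>

lemma key_intervals_reverse:
  assumes M: "\<And>v. a \<le> v \<Longrightarrow> v < b \<Longrightarrow> f v \<le> M"
  shows "key_intervals (\<lambda>v. M - f v) a b = key_intervals f a b"
proof -
  have lt: "M - f u < M - f v \<longleftrightarrow> f v < f u" if "a \<le> u" "u < b" "a \<le> v" "v < b" for u v
    using M[OF that(1,2)] M[OF that(3,4)] by linarith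
  show ?thesis
  proof (intro set_eqI iffI; clarify)
    fix x y assume *: "(x, y) \<in> key_intervals f a b"
    note b = key_intervalsD(1-3)[OF *]
    show "(x, y) \<in> key_intervals (\<lambda>v. M - f v) a b"
    proof (rule key_intervalsI[OF b])
      fix u v w assume h: "x \<le> u" "u < y" "x \<le> w" "w < y" "a \<le> v" "v < b"
        "M - f u < M - f v" "M - f v < M - f w"
      then have "f v < f u" "f w < f v" using lt b by auto
      then show "x \<le> v \<and> v < y" using key_intervalsD(4)[OF *, of w u v] h by auto
    qed
  next
    fix x y assume *: "(x, y) \<in> key_intervals (\<lambda>v. M - f v) a b"
    note b = key_intervalsD(1-3)[OF *]
    show "(x, y) \<in> key_intervals f a b"
    proof (rule key_intervalsI[OF b])
      fix u v w assume h: "x \<le> u" "u < y" "x \<le> w" "w < y" "a \<le> v" "v < b" "f u < f v" "f v < f w"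
      then have "M - f v < M - f u" "M - f w < M - f v" using lt b by auto
      then show "x \<le> v \<and> v < y" using key_intervalsD(4)[OF *, of w u v] h by auto
    qed
  qed
qed

text \<open>A permutation that is a direct sum has its first value before its last one, and after reversal this
pair witnesses that no cut of the values splits the positions. Such keys can be placed next to each
other in increasing order without creating intervals that cross a block; this replaces the usual
alternation between increasing and decreasing nodes of the decomposition tree.\<close>

lemma ex_sum_indecomposable_key:
  assumes inj: "inj_on f {a..<b}"
  shows "\<exists>f'. inj_on f' {a..<b} \<and> key_intervals f' a b = key_intervals f a b \<and>
    (\<forall>x. a < x \<and> x < b \<longrightarrow> (\<exists>u v. a \<le> u \<and> u < x \<and> x \<le> v \<and> v < b \<and> f' v < f' u))"
proof (cases "\<forall>x. a < x \<and> x < b \<longrightarrow> (\<exists>u v. a \<le> u \<and> u < x \<and> x \<le> v \<and> v < b \<and> f v < f u)")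
  case False
  then obtain x where x: "a < x" "x < b" and "\<And>u v. \<lbrakk>a \<le> u; u < x; x \<le> v; v < b\<rbrakk> \<Longrightarrow> f u \<le> f v"
    by (meson not_less)
  then have le: "f a \<le> f (b - 1)" by simp
  have "f a \<noteq> f (b - 1)"
    using inj x by (auto simp: inj_on_eq_iff)
  with le have lt: "f a < f (b - 1)" by simp
  define M where "M = Max (f ` {a..<b})"
  have M: "f v \<le> M" if "a \<le> v" "v < b" for v
    unfolding M_def using that by (intro Max_ge) auto
  have Mb: "f (b - 1) \<le> M" using x by (intro M) auto
  have "inj_on (\<lambda>v. M - f v) {a..<b}"
  proof (rule inj_onI)
    fix u v assume *: "u \<in> {a..<b}" "v \<in> {a..<b}" "M - f u = M - f v"
    then have "f u = f v" using M[of u] M[of v] by auto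
    then show "u = v" using inj * by (auto simp: inj_on_eq_iff)
  qed
  moreover have "key_intervals (\<lambda>v. M - f v) a b = key_intervals f a b"
    by (rule key_intervals_reverse) (rule M)
  moreover have "\<exists>u v. a \<le> u \<and> u < y \<and> y \<le> v \<and> v < b \<and> M - f v < M - f u" if "a < y" "y < b" for y
    using that lt Mb by (intro exI[of _ a] exI[of _ "b-1"]) auto
  ultimately show ?thesis by blast
qed (use inj in blast)

text \<open>The witness is \<open>2 4 6 \<dots> k 1 3 5 \<dots> k-1\<close> for even \<open>k\<close>, with values from 1; for odd \<open>k\<close> the largest value is put
between 1 and 3, so that it is not at an end. With values from 0, odd values come first and \<open>k - 1\<close>, when
even, gets the key between those of 0 and 2. An interval with two consecutive values must then
contain both extreme values, hence everything.\<close>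

lemma ex_simple_key:
  assumes "4 \<le> k"
  shows "\<exists>f. inj_on f {0..<k} \<and> (\<forall>x y. (x, y) \<in> key_intervals f 0 k \<and> x + 2 \<le> y \<longrightarrow> x = 0 \<and> y = k)"
proof -
  define f where "f v = (if odd v then v else if v = k - 1 then k + 1 else k + v)" for v :: nat
  have fodd: "f v = v" if "odd v" for v using that by (simp add: f_def)
  have ftop: "f (k - 1) = k + 1" if "odd k" using that assms by (simp add: f_def)
  have feven: "f v = k + v" if "even v" "v \<noteq> k - 1" for v using that by (simp add: f_def)
  have f0: "f 0 = k" using assms by (simp add: f_def)
  have "inj_on f {0..<k}"
    by (rule inj_onI) (auto simp: f_def split: if_splits)
  moreover have "x = 0 \<and> y = k" if *: "(x, y) \<in> key_intervals f 0 k" and l: "x + 2 \<le> y" for x y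
  proof -
    have yk: "y \<le> k" using key_intervalsD[OF *] by simp
    have between: "x \<le> v \<and> v < y"
      if "f u < f v" "f v < f w" "v < k" "x \<le> u" "u < y" "x \<le> w" "w < y" for u v w
      using key_intervalsD(4)[OF *, of u w v] that by auto
    have "x \<le> 0 \<and> 0 < y \<and> x \<le> k - 1 \<and> k - 1 < y"
    proof (cases "odd k")
      case False
      then have ft: "f (k - 1) = k - 1" using fodd[of "k - 1"] assms by auto
      have k1: "k - 1 \<noteq> 0" using assms by simp
      show ?thesis
      proof (cases "odd x")
        case True
        have "x + 1 \<noteq> k - 1" using True False assms by presburger
        then have "f x = x" "f (x + 1) = k + (x + 1)" using fodd[of x] feven[of "x + 1"] True by auto
        moreover have "x < k - 1" using yk l by simp
        ultimately show ?thesis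
          using between[of x 0 "x + 1"] between[of x "k - 1" "x + 1"] l ft f0 assms by auto
      next
        case False': False
        have "x \<noteq> k - 1" using False False' assms by presburger
        then have fx: "f (x + 1) = x + 1" "f x = k + x" using fodd[of "x + 1"] feven[of x] False' by auto
        have "x \<le> 0 \<and> 0 < y"
          using between[of "x + 1" 0 x] l fx f0 assms yk by (cases "x = 0") auto
        moreover have "x \<le> k - 1 \<and> k - 1 < y"
          using between[of "x + 1" "k - 1" x] l fx ft assms yk by (cases "x + 1 = k - 1") auto
        ultimately show ?thesis by simp
      qed
    next
      case True
      note ft = ftop[OF True]
      have k5: "5 \<le> k" using True assms by presburger
      show ?thesis
      proof (cases "odd x")
        case True': True
        have fx: "f x = x" using fodd True' by simp
        show ?thesis
        proof (cases "x + 1 = k - 1")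
          case top: True
          then have "f (x + 1) = k + 1" using ft by simp
          then have "x \<le> 0 \<and> 0 < y"
            using between[of x 0 "x + 1"] fx f0 l yk assms by auto
          with top l show ?thesis using assms by auto
        next
          case False
          then have "f (x + 1) = k + (x + 1)" using feven[of "x + 1"] True' by auto
          moreover have "x \<noteq> 0" using True' by presburger
          ultimately show ?thesis
            using between[of x 0 "x + 1"] between[of x "k - 1" "x + 1"] fx f0 ft l yk assms by auto
        qed
      next
        case False
        have "x \<noteq> k - 1" using l yk by simp
        then have fx: "f (x + 1) = x + 1" "f x = k + x" using fodd[of "x + 1"] feven[of x] False by auto
        have zero: "x \<le> 0 \<and> 0 < y"
          using between[of "x + 1" 0 x] l fx f0 assms yk by (cases "x = 0") auto
        then have x0: "x = 0" by simp
        have "f (k - 2) = k - 2" using fodd[of "k - 2"] True k5 by auto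
        then have "k - 2 < y"
          using between[of "x + 1" "k - 2" x] fx x0 k5 l by auto
        then have "2 < y" using k5 by simp
        moreover have "f 2 = k + 2" using feven[of 2] k5 by simp
        ultimately show ?thesis
          using between[of 0 "k - 1" 2] x0 f0 ft l k5 by auto
      qed
    qed
    then show ?thesis using yk by auto
  qed
  ultimately show ?thesis by blast
qed

section \<open>Decomposition of an interval family\<close>

definition restrict_family :: "(nat \<times> nat) set \<Rightarrow> nat \<Rightarrow> nat \<Rightarrow> (nat \<times> nat) set" where
  "restrict_family F x y = {(u, v) \<in> F. x \<le> u \<and> v \<le> y}"

text \<open>One node of the decomposition tree: \<open>G i\<close> is the family of the subtree on the block \<open>{c i..<c (i + 1)}\<close>, and the node itself
contributes the unions of blocks that are intervals.\<close>

definition compose_blocks ::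
  "bool \<Rightarrow> nat \<Rightarrow> (nat \<Rightarrow> nat) \<Rightarrow> (nat \<Rightarrow> (nat \<times> nat) set) \<Rightarrow> (nat \<times> nat) set" where
  "compose_blocks simple k c G = (\<Union>i<k. G i) \<union>
     (if simple then {(c 0, c k)} else {(c i, c j) | i j. i < j \<and> j \<le> k})"

lemma strict_mono_enumeration:
  fixes B :: "nat set"
  assumes "finite B" "card B = Suc k"
  obtains c where "strict_mono_on {..k} c" "c ` {..k} = B"
proof -
  let ?l = "sorted_list_of_set B"
  have len: "length ?l = Suc k" using assms by simp
  show ?thesis
  proof
    show "strict_mono_on {..k} ((!) ?l)"
      using len by (intro strict_mono_onI) (auto simp: sorted_wrt_nth_less)
    have "(!) ?l ` {..k} = set ?l"
      using len by (auto simp: set_conv_nth image_def less_Suc_eq_le)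
    then show "(!) ?l ` {..k} = B" using assms by simp
  qed
qed

lemma strict_mono_enumeration_unique:
  fixes c d :: "nat \<Rightarrow> nat"
  assumes c: "strict_mono_on {..k} c" and d: "strict_mono_on {..l} d"
    and eq: "c ` {..k} = d ` {..l}"
  shows "k = l \<and> (\<forall>i\<le>k. c i = d i)"
proof -
  have "card (c ` {..k}) = Suc k" "card (d ` {..l}) = Suc l"
    using c d by (simp_all add: card_image strict_mono_on_imp_inj_on)
  with eq have kl: "k = l" by simp
  have "sorted_wrt (<) (map c [0..<Suc k])" "sorted_wrt (<) (map d [0..<Suc k])"
    using c d kl by (auto simp: sorted_wrt_map sorted_wrt_iff_nth_less strict_mono_on_def simp del: upt_Suc)
  moreover have "set (map c [0..<Suc k]) = set (map d [0..<Suc k])"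
    using eq kl by (simp add: atLeast0LessThan lessThan_Suc_atMost del: upt_Suc)
  ultimately have "map c [0..<Suc k] = map d [0..<Suc k]"
    by (metis strict_sorted_equal)
  with kl show ?thesis by (auto simp del: upt_Suc)
qed

lemma strict_mono_on_leD:
  fixes c :: "nat \<Rightarrow> nat"
  assumes "strict_mono_on {..k} c" "i \<le> k" "j \<le> k"
  shows "c i < c j \<longleftrightarrow> i < j" "c i \<le> c j \<longleftrightarrow> i \<le> j" "c i = c j \<longleftrightarrow> i = j"
  using strict_mono_on_less[OF assms(1)] strict_mono_on_less_eq[OF assms(1)]
    strict_mono_on_eq[OF assms(1)] assms by auto

lemma ex_block:
  fixes c :: "nat \<Rightarrow> nat"
  assumes c: "strict_mono_on {..k} c" and x: "c 0 \<le> x" "x < c k"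
  shows "\<exists>i<k. c i \<le> x \<and> x < c (Suc i)"
proof -
  have "\<exists>n. \<not> x < c n \<and> (\<forall>m\<le>n. \<not> x < c m) \<and> x < c (Suc n) \<and> Suc n \<le> k"
  proof -
    define m where "m = (LEAST m. x < c m)"
    have m: "x < c m" unfolding m_def by (rule LeastI) (rule x(2))
    have le: "m \<le> k" unfolding m_def by (rule Least_le) (rule x(2))
    have least: "\<not> x < c j" if "j < m" for j using that not_less_Least unfolding m_def by blast
    have "m \<noteq> 0" using m x by (metis not_less)
    then obtain n where "m = Suc n" using not0_implies_Suc by blast
    then show ?thesis using m le least by (intro exI[of _ n]) auto
  qed
  then show ?thesis by (meson Suc_le_eq not_less)
qed

context interval_family
begin

lemma interval_family_restrict:
  assumes "(x, y) \<in> F"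
  shows "interval_family (restrict_family F x y) x y"
proof
  show "x < y" using bounds assms by blast
  show "x \<le> u \<and> u < v \<and> v \<le> y" if "(u, v) \<in> restrict_family F x y" for u v
    using that bounds unfolding restrict_family_def by blast
  show "(x, y) \<in> restrict_family F x y" using assms by (auto simp: restrict_family_def)
  show "(u, Suc u) \<in> restrict_family F x y" if "x \<le> u" "u < y" for u
    using that single[of u] bounds[OF assms] by (auto simp: restrict_family_def)
next
  fix u v u' v'
  assume h: "(u, v) \<in> restrict_family F x y" "(u', v') \<in> restrict_family F x y"
    "u < u'" "u' < v" "v < v'"
  then have F: "(u, v) \<in> F" "(u', v') \<in> F" and "x \<le> u" "v' \<le> y"
    by (auto simp: restrict_family_def)
  note o = overlap_left[OF F h(3-5)] overlap_inter[OF F h(3-5)] overlap_right[OF F h(3-5)]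
    overlap_union[OF F h(3-5)]
  show "(u, u') \<in> restrict_family F x y" "(u', v) \<in> restrict_family F x y"
    "(v, v') \<in> restrict_family F x y" "(u, v') \<in> restrict_family F x y"
    using o h(3-5) \<open>x \<le> u\<close> \<open>v' \<le> y\<close> by (auto simp: restrict_family_def)
next
  fix p q r s
  assume h: "(p, q) \<in> restrict_family F x y" "(q, r) \<in> restrict_family F x y"
    "(r, s) \<in> restrict_family F x y" "(p, s) \<in> restrict_family F x y"
  then have "(p, r) \<in> F \<or> (q, s) \<in> F"
    by (intro no_simple_triple) (auto simp: restrict_family_def)
  moreover have "p < q" "r < s" "x \<le> p" "s \<le> y"
    using h bounds by (auto simp: restrict_family_def)
  ultimately show "(p, r) \<in> restrict_family F x y \<or> (q, s) \<in> restrict_family F x y"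
    by (auto simp: restrict_family_def)
qed

text \<open>A cut splits the range into two intervals. The existence of a cut is what distinguishes a linear
from a simple root, and the cuts are the block boundaries of a linear root.\<close>

definition cuts :: "nat set" where
  "cuts = {x. (a, x) \<in> F \<and> (x, b) \<in> F}"

lemma cuts_bounds: "x \<in> cuts \<Longrightarrow> a < x \<and> x < b"
  unfolding cuts_def using bounds by blast

lemma blocks_of_boundaries:
  assumes B: "B \<subseteq> {a..b}" "a \<in> B" "b \<in> B"
  obtains k c where "strict_mono_on {..k} c" "c ` {..k} = B" "c 0 = a" "c k = b" "k \<ge> 1"
    "\<And>i x. i < k \<Longrightarrow> c i < x \<Longrightarrow> x < c (Suc i) \<Longrightarrow> x \<notin> B"
proof -
  have fin: "finite B" using B(1) finite_subset by blast
  have "card B \<ge> card {a, b}" using B fin by (intro card_mono) auto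
  then have "card B \<ge> 2" using nonempty by simp
  then obtain k where k: "card B = Suc k" "k \<ge> 1"
    by (metis One_nat_def Suc_1 Suc_le_D Suc_le_mono)
  obtain c where c: "strict_mono_on {..k} c" "c ` {..k} = B"
    using strict_mono_enumeration[OF fin k(1)] by blast
  note lt = strict_mono_on_leD[OF c(1)]
  show ?thesis
  proof (rule that[OF c _ _ k(2)])
    obtain i where i: "i \<le> k" "c i = a" using B(2) c(2) by auto
    have "c 0 \<in> B" using c(2) by auto
    then have "a \<le> c 0" using B(1) by auto
    then show "c 0 = a" using i lt(2)[of 0 i] by auto
    obtain j where j: "j \<le> k" "c j = b" using B(3) c(2) by auto
    have "c k \<in> B" using c(2) by auto
    then have "c k \<le> b" using B(1) by auto
    then show "c k = b" using j lt(2)[of j k] by auto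
    show "x \<notin> B" if i: "i < k" "c i < x" "x < c (Suc i)" for i x
    proof
      assume "x \<in> B"
      then obtain j where "j \<le> k" "c j = x" using c(2) by auto
      then show False using i lt(1)[of i j] lt(1)[of j "Suc i"] by auto
    qed
  qed
qed

text \<open>Unions of consecutive blocks are intersections of a prefix with a suffix. Conversely, if an interval
crosses a cut, then its union with the suffix and its difference with the prefix show that its own
ends are cuts.\<close>

lemma decompose_linear:
  assumes ne: "cuts \<noteq> {}"
  obtains k c where "strict_mono_on {..k} c" "c 0 = a" "c k = b" "2 \<le> k"
    "\<And>i. i < k \<Longrightarrow> (c i, c (Suc i)) \<in> F"
    "F = compose_blocks False k c (\<lambda>i. restrict_family F (c i) (c (Suc i)))"
proof -
  let ?B = "insert a (insert b cuts)"
  have "?B \<subseteq> {a..b}" using cuts_bounds nonempty by fastforce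
  then obtain k c where c: "strict_mono_on {..k} c" "c ` {..k} = ?B" "c 0 = a" "c k = b"
    and k1: "k \<ge> 1" and gap: "\<And>i x. i < k \<Longrightarrow> c i < x \<Longrightarrow> x < c (Suc i) \<Longrightarrow> x \<notin> ?B"
    using blocks_of_boundaries[of ?B] by blast
  note lt = strict_mono_on_leD[OF c(1)]
  have prefix: "(a, c i) \<in> F" if "0 < i" "i \<le> k" for i
  proof -
    have "c i \<in> ?B" using c(2) that by auto
    moreover have "c i \<noteq> a" using lt(3)[of i 0] that c by auto
    ultimately show ?thesis using whole by (auto simp: cuts_def)
  qed
  have suffix: "(c i, b) \<in> F" if "i < k" for i
  proof -
    have "c i \<in> ?B" using c(2) that by auto
    moreover have "c i \<noteq> b" using lt(3)[of i k] that c by auto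
    ultimately show ?thesis using whole by (auto simp: cuts_def)
  qed
  have join: "(c i, c j) \<in> F" if ij: "i < j" "j \<le> k" for i j
  proof -
    consider "i = 0" | "j = k" | "0 < i" "j < k" using ij by linarith
    then show ?thesis
    proof cases
      case 3
      then have "a < c i" "c i < c j" "c j < b"
        using lt(1)[of 0 i] lt(1)[of i j] lt(1)[of j k] ij c by auto
      then show ?thesis
        using overlap_inter[OF prefix suffix, of j i] 3 ij by auto
    qed (use prefix suffix ij c in auto)
  qed
  have cut_ends: "u \<in> ?B \<and> v \<in> ?B" if uv: "(u, v) \<in> F" and x: "x \<in> cuts" "u < x" "x < v" for u v x
  proof -
    have ax: "(a, x) \<in> F" and xb: "(x, b) \<in> F" using x by (auto simp: cuts_def)
    have b: "a \<le> u" "v \<le> b" using bounds[OF uv] by auto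
    have u: "(a, u) \<in> F \<and> (u, b) \<in> F" if "u \<noteq> a"
    proof
      show "(a, u) \<in> F" using overlap_left[OF ax uv] that b x by simp
      show "(u, b) \<in> F"
        using overlap_union[OF uv xb] uv x b by (cases "v = b") auto
    qed
    have v: "(a, v) \<in> F \<and> (v, b) \<in> F" if "v \<noteq> b"
    proof
      show "(v, b) \<in> F" using overlap_right[OF uv xb] that b x by simp
      show "(a, v) \<in> F"
        using overlap_union[OF ax uv] uv x b by (cases "u = a") auto
    qed
    show ?thesis using u v by (auto simp: cuts_def)
  qed
  have "F = compose_blocks False k c (\<lambda>i. restrict_family F (c i) (c (Suc i)))"
  proof (intro set_eqI iffI; clarify)
    fix u v assume uv: "(u, v) \<in> F"
    note b = bounds[OF uv]
    obtain i where i: "i < k" "c i \<le> u" "u < c (Suc i)"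
      using ex_block[OF c(1), of u] b c by auto
    show "(u, v) \<in> compose_blocks False k c (\<lambda>i. restrict_family F (c i) (c (Suc i)))"
    proof (cases "v \<le> c (Suc i)")
      case True
      then show ?thesis using i uv by (auto simp: compose_blocks_def restrict_family_def)
    next
      case False
      then have "Suc i \<noteq> k" using b c by auto
      then have "c (Suc i) \<noteq> a" "c (Suc i) \<noteq> b"
        using lt(3)[of "Suc i" 0] lt(3)[of "Suc i" k] i c by auto
      moreover have "c (Suc i) \<in> ?B" using c(2) i by auto
      ultimately have "c (Suc i) \<in> cuts" by auto
      then have "u \<in> ?B \<and> v \<in> ?B" using cut_ends[OF uv, of "c (Suc i)"] i False by auto
      then obtain p q where "p \<le> k" "u = c p" "q \<le> k" "v = c q"
        using c(2) by (metis (no_types, lifting) atMost_iff imageE)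
      then show ?thesis using b lt(1)[of p q] by (auto simp: compose_blocks_def)
    qed
  next
    fix u v assume "(u, v) \<in> compose_blocks False k c (\<lambda>i. restrict_family F (c i) (c (Suc i)))"
    then show "(u, v) \<in> F"
      using join by (auto simp: compose_blocks_def restrict_family_def)
  qed
  moreover have "2 \<le> k"
  proof (rule ccontr)
    assume "\<not> 2 \<le> k"
    then have "k = 1" using k1 by simp
    obtain x where x: "x \<in> cuts" using ne by blast
    then show False using gap[of 0 x] cuts_bounds[OF x] c \<open>k = 1\<close> by auto
  qed
  ultimately show ?thesis using that c join by (metis Suc_leI lessI)
qed

text \<open>The boundaries are the points that no proper member crosses. Two overlapping proper members with
union the whole range would produce a cut, so the maximal proper members are disjoint; they are the
blocks. Two blocks would give a cut, and three are excluded by \<open>no_simple_triple\<close>.\<close>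

lemma decompose_prime:
  assumes none: "cuts = {}" and size: "a + 2 \<le> b"
  obtains k c where "strict_mono_on {..k} c" "c 0 = a" "c k = b" "4 \<le> k"
    "\<And>i. i < k \<Longrightarrow> (c i, c (Suc i)) \<in> F"
    "F = compose_blocks True k c (\<lambda>i. restrict_family F (c i) (c (Suc i)))"
proof -
  define B where "B = {x \<in> {a..b}. \<forall>u v. (u, v) \<in> F \<and> u < x \<and> x < v \<longrightarrow> (u, v) = (a, b)}"
  have "\<not> u < a" "\<not> b < v" if "(u, v) \<in> F" for u v
    using bounds[OF that] by auto
  then have "B \<subseteq> {a..b}" "a \<in> B" "b \<in> B" using nonempty by (auto simp: B_def)
  then obtain k c where c: "strict_mono_on {..k} c" "c ` {..k} = B" "c 0 = a" "c k = b"
    and k1: "k \<ge> 1" and gap: "\<And>i x. i < k \<Longrightarrow> c i < x \<Longrightarrow> x < c (Suc i) \<Longrightarrow> x \<notin> B"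
    using blocks_of_boundaries[of B] by blast
  note lt = strict_mono_on_leD[OF c(1)]
  have inB: "c i \<in> B" if "i \<le> k" for i using c(2) that by blast
  have Bcross: "(u, v) = (a, b)" if "i \<le> k" "(u, v) \<in> F" "u < c i" "c i < v" for i u v
    using inB[OF that(1)] that unfolding B_def by blast
  have block: "(c i, c (Suc i)) \<in> F \<and> (c i, c (Suc i)) \<noteq> (a, b)" if i: "i < k" for i
  proof -
    let ?x = "c i"
    \<comment> \<open>The longest proper member starting at a boundary ends at the next boundary.\<close>
    let ?V = "{v. (?x, v) \<in> F \<and> (?x, v) \<noteq> (a, b)}"
    have xb: "a \<le> ?x" "?x < b" using inB[of i] lt(1)[of i k] i c by (auto simp: B_def)
    have "Suc ?x \<in> ?V" using single[of ?x] xb size by auto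
    moreover have fin: "finite ?V"
      by (rule finite_subset[of _ "{..b}"]) (use bounds in auto)
    ultimately have Vne: "?V \<noteq> {}" by blast
    define v where "v = Max ?V"
    have v: "(?x, v) \<in> F" "(?x, v) \<noteq> (a, b)" using Max_in[OF fin Vne] unfolding v_def by auto
    have vmax: "v' \<le> v" if "(?x, v') \<in> F" "(?x, v') \<noteq> (a, b)" for v'
      unfolding v_def using fin that by (intro Max_ge) auto
    have bv: "?x < v" "v \<le> b" using bounds[OF v(1)] by auto
    have "(p, q) = (a, b)" if pq: "(p, q) \<in> F" "p < v" "v < q" for p q
    proof (rule ccontr)
      assume ne: "(p, q) \<noteq> (a, b)"
      consider "p < ?x" | "p = ?x" | "?x < p" by linarith
      then show False
      proof cases
        case 1 then show False using Bcross[of i p q] i pq bv ne by auto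
      next
        case 2 then show False using vmax[of q] pq ne by auto
      next
        case 3
        note o = overlap_left[OF v(1) pq(1) 3 pq(2,3)] overlap_union[OF v(1) pq(1) 3 pq(2,3)]
        have "(?x, q) = (a, b)" using vmax[OF o(2)] pq by auto
        then have "p \<in> cuts" using o(1) pq(1) by (auto simp: cuts_def)
        then show False using none by blast
      qed
    qed
    then have "v \<in> B" using bv xb unfolding B_def by auto
    then have "\<not> v < c (Suc i)" using gap[OF i, of v] bv by auto
    moreover have "\<not> c (Suc i) < v"
      using Bcross[of "Suc i" ?x v] i v lt(1)[of i "Suc i"] by auto
    ultimately have "v = c (Suc i)" by simp
    then show ?thesis using v by simp
  qed
  have eq: "F = compose_blocks True k c (\<lambda>i. restrict_family F (c i) (c (Suc i)))"
  proof (intro set_eqI iffI; clarify)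
    fix u v assume uv: "(u, v) \<in> F"
    note b = bounds[OF uv]
    obtain i where i: "i < k" "c i \<le> u" "u < c (Suc i)"
      using ex_block[OF c(1), of u] b c by auto
    show "(u, v) \<in> compose_blocks True k c (\<lambda>i. restrict_family F (c i) (c (Suc i)))"
    proof (cases "v \<le> c (Suc i)")
      case True
      then show ?thesis using i uv by (auto simp: compose_blocks_def restrict_family_def)
    next
      case False
      then have "(u, v) = (a, b)" using Bcross[of "Suc i" u v] i uv by auto
      then show ?thesis using c by (auto simp: compose_blocks_def)
    qed
  next
    fix u v assume "(u, v) \<in> compose_blocks True k c (\<lambda>i. restrict_family F (c i) (c (Suc i)))"
    then show "(u, v) \<in> F"
      using c whole by (auto simp: compose_blocks_def restrict_family_def)
  qed
  have k4: "4 \<le> k"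
  proof (rule ccontr)
    assume "\<not> 4 \<le> k"
    then consider "k = 1" | "k = 2" | "k = 3" using k1 by linarith
    then show False
    proof cases
      case 1 then show False using block[of 0] c by auto
    next
      case 2
      then have "c 1 \<in> cuts" using block[of 0] block[of 1] c by (auto simp: cuts_def numeral_2_eq_2)
      then show False using none by blast
    next
      case 3
      have m: "a < c 1" "c 1 < c 2" "c 2 < b"
        using lt(1)[of 0 1] lt(1)[of 1 2] lt(1)[of 2 3] c 3 by auto
      have "(c 0, c 1) \<in> F" "(c 1, c 2) \<in> F" "(c 2, c 3) \<in> F"
        using block[of 0] block[of 1] block[of 2] 3 by (auto simp: numeral_2_eq_2 numeral_3_eq_3)
      then have "(a, c 2) \<in> F \<or> (c 1, b) \<in> F"
        using no_simple_triple[of "c 0" "c 1" "c 2" "c 3"] whole c 3 by auto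
      then show False
        using Bcross[of 1 a "c 2"] Bcross[of 2 "c 1" b] m 3 by auto
    qed
  qed
  have blk: "\<And>i. i < k \<Longrightarrow> (c i, c (Suc i)) \<in> F" using block by blast
  show ?thesis by (rule that[OF c(1,3,4) k4 blk eq])
qed

end

text \<open>The decomposition tree is unique because each node can be recovered from its family. The boundaries are the cuts
for a linear node, and the points that no proper member crosses for a simple node, which has no cuts.\<close>

lemma compose_blocks_boundaries:
  assumes c: "strict_mono_on {..k} c" and k: "(if simple then 4 else 2) \<le> k"
    and G: "\<And>i u v. i < k \<Longrightarrow> (u, v) \<in> G i \<Longrightarrow> c i \<le> u \<and> u < v \<and> v \<le> c (Suc i)"
    and full: "\<And>i. i < k \<Longrightarrow> (c i, c (Suc i)) \<in> G i"
  defines "F \<equiv> compose_blocks simple k c G"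
  defines "K \<equiv> {x. (c 0, x) \<in> F \<and> (x, c k) \<in> F}"
  shows "simple \<longleftrightarrow> K = {}"
    and "c ` {..k} = (if simple
      then {x \<in> {c 0..c k}. \<forall>u v. (u, v) \<in> F \<and> u < x \<and> x < v \<longrightarrow> (u, v) = (c 0, c k)}
      else insert (c 0) (insert (c k) K))"
    and "\<And>i. i < k \<Longrightarrow> G i = restrict_family F (c i) (c (Suc i))"
proof -
  note lt = strict_mono_on_leD[OF c]
  have k2: "2 \<le> k" using k by (auto split: if_splits)
  have F: "(u, v) \<in> F \<longleftrightarrow> (\<exists>i<k. (u, v) \<in> G i) \<or>
    (if simple then u = c 0 \<and> v = c k else (\<exists>i j. i < j \<and> j \<le> k \<and> u = c i \<and> v = c j))" for u v
    by (auto simp: F_def compose_blocks_def)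
  have same_block: "i = j" if "i < k" "j < k" "c i \<le> x" "x < c (Suc i)" "c j \<le> x" "x < c (Suc j)" for i j x
    using that lt(1)[of i "Suc j"] lt(1)[of j "Suc i"] by auto
  have first: "x \<le> c 1" if "i < k" "(c 0, x) \<in> G i" for i x
  proof -
    have "c i \<le> c 0" "x \<le> c (Suc i)" using G[OF that] by auto
    then have "i = 0" using lt(2)[of i 0] that by auto
    then show ?thesis using \<open>x \<le> c (Suc i)\<close> by auto
  qed
  have last: "c (k - 1) \<le> x" if "i < k" "(x, c k) \<in> G i" for i x
  proof -
    have "c k \<le> c (Suc i)" "c i \<le> x" using G[OF that] by auto
    then have "i = k - 1" using lt(2)[of k "Suc i"] that by auto
    then show ?thesis using \<open>c i \<le> x\<close> by auto
  qed
  have inner: "c 1 \<le> c (k - 1)" "c 1 < c k" "c 0 < c (k - 1)" "c 0 < c 1" "c (k - 1) < c k"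
    using lt k2 by auto
  have gt0: "c 0 < x" and ltk: "x < c k" if "x \<in> K" for x
  proof -
    have "c 0 < v \<and> u < c k" if uv: "(u, v) \<in> F" for u v
    proof (cases "\<exists>i<k. (u, v) \<in> G i")
      case True
      then obtain i where i: "i < k" "(u, v) \<in> G i" by blast
      have "c 0 \<le> c i" "c (Suc i) \<le> c k" using lt(2) i by auto
      then show ?thesis using G[OF i] by auto
    next
      case False
      show ?thesis
      proof (cases simple)
        case True with False uv F have "u = c 0" "v = c k" by auto
        then show ?thesis using lt(1)[of 0 k] k2 by auto
      next
        case simple: False
        with False uv obtain i j where "i < j" "j \<le> k" "u = c i" "v = c j" using F by auto
        then show ?thesis using lt(1)[of 0 j] lt(1)[of i k] by auto
      qed
    qed
    then show "c 0 < x" "x < c k" using that by (auto simp: K_def)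
  qed
  have K_prime: "K = {}" if simple
  proof (rule equals0I)
    fix x assume x: "x \<in> K"
    have "\<exists>i<k. (c 0, x) \<in> G i" "\<exists>i<k. (x, c k) \<in> G i"
      using x gt0[OF x] ltk[OF x] that F by (auto simp: K_def)
    then have "x \<le> c 1" "c (k - 1) \<le> x" using first last by auto
    moreover have "c 1 < c (k - 1)" using lt(1)[of 1 "k - 1"] k that by auto
    ultimately show False by simp
  qed
  have K_linear: "K = c ` {0<..<k}" if np: "\<not> simple"
  proof (intro set_eqI iffI)
    fix x assume x: "x \<in> K"
    have "(c 0, x) \<in> F" "(x, c k) \<in> F" using x by (auto simp: K_def)
    then consider "\<exists>i\<le>k. x = c i" | "\<exists>i<k. (c 0, x) \<in> G i" "\<exists>i<k. (x, c k) \<in> G i"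
      using np unfolding F by (metis (full_types) less_imp_le_nat order_less_le_trans)
    then have "\<exists>i\<le>k. x = c i"
    proof cases
      case 2
      then have "x = c 1" using first last inner by fastforce
      then show ?thesis using k2 by (intro exI[of _ 1]) auto
    qed auto
    then obtain i where i: "i \<le> k" "x = c i" by blast
    moreover have "i \<noteq> 0" "i \<noteq> k" using gt0[OF x] ltk[OF x] i by (metis less_irrefl)+
    ultimately show "x \<in> c ` {0<..<k}" by auto
  next
    fix x assume "x \<in> c ` {0<..<k}"
    then obtain i where i: "0 < i" "i < k" "x = c i" by auto
    have "\<exists>p q. p < q \<and> q \<le> k \<and> c 0 = c p \<and> x = c q"
      using i by (intro exI[of _ 0] exI[of _ i]) auto
    moreover have "\<exists>p q. p < q \<and> q \<le> k \<and> x = c p \<and> c k = c q"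
      using i by (intro exI[of _ i] exI[of _ k]) auto
    ultimately have "(c 0, x) \<in> F" "(x, c k) \<in> F" using np unfolding F by auto
    then show "x \<in> K" by (simp add: K_def)
  qed
  show "simple \<longleftrightarrow> K = {}"
  proof
    assume "K = {}"
    then have "1 \<notin> {0<..<k} \<or> simple" using K_linear by blast
    then show simple using k2 by auto
  qed (rule K_prime)
  show "c ` {..k} = (if simple
      then {x \<in> {c 0..c k}. \<forall>u v. (u, v) \<in> F \<and> u < x \<and> x < v \<longrightarrow> (u, v) = (c 0, c k)}
      else insert (c 0) (insert (c k) K))"
  proof (cases simple)
    case True
    have "x \<in> c ` {..k} \<longleftrightarrow> x \<in> {c 0..c k} \<and> (\<forall>u v. (u, v) \<in> F \<and> u < x \<and> x < v \<longrightarrow> (u, v) = (c 0, c k))" for x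
    proof
      assume "x \<in> c ` {..k}"
      then obtain j where j: "j \<le> k" "x = c j" by auto
      have "(u, v) = (c 0, c k)" if uv: "(u, v) \<in> F" "u < x" "x < v" for u v
      proof (rule ccontr)
        assume "(u, v) \<noteq> (c 0, c k)"
        then obtain i where i: "i < k" "(u, v) \<in> G i" using uv F True by auto
        then have "c i < c j" "c j < c (Suc i)" using G[OF i] uv j by auto
        then show False using lt(1)[of i j] lt(1)[of j "Suc i"] i j by auto
      qed
      then show "x \<in> {c 0..c k} \<and> (\<forall>u v. (u, v) \<in> F \<and> u < x \<and> x < v \<longrightarrow> (u, v) = (c 0, c k))"
        using j lt(2)[of 0 j] lt(2)[of j k] by auto
    next
      assume x: "x \<in> {c 0..c k} \<and> (\<forall>u v. (u, v) \<in> F \<and> u < x \<and> x < v \<longrightarrow> (u, v) = (c 0, c k))"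
      show "x \<in> c ` {..k}"
      proof (cases "x = c k")
        case False
        then obtain i where i: "i < k" "c i \<le> x" "x < c (Suc i)"
          using ex_block[OF c, of x] x by auto
        have "(c i, c (Suc i)) \<in> F" using F full i by blast
        moreover have "(c i, c (Suc i)) \<noteq> (c 0, c k)"
          using lt(3)[of i 0] lt(3)[of "Suc i" k] i k2 by auto
        ultimately have "\<not> c i < x" using x i by blast
        then show ?thesis using i by auto
      qed auto
    qed
    then show ?thesis using True by auto
  next
    case False
    have "{..k} = insert 0 (insert k {0<..<k})" using k2 by auto
    then show ?thesis using K_linear False by auto
  qed
  fix i assume i: "i < k"
  show "G i = restrict_family F (c i) (c (Suc i))"
  proof (intro set_eqI iffI; clarify)
    fix u v assume "(u, v) \<in> G i"
    then show "(u, v) \<in> restrict_family F (c i) (c (Suc i))"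
      using G[OF i] F i by (auto simp: restrict_family_def)
  next
    fix u v assume "(u, v) \<in> restrict_family F (c i) (c (Suc i))"
    then have uv: "(u, v) \<in> F" "c i \<le> u" "v \<le> c (Suc i)" by (auto simp: restrict_family_def)
    consider j where "j < k" "(u, v) \<in> G j"
      | "\<not> simple" "\<exists>p q. p < q \<and> q \<le> k \<and> u = c p \<and> v = c q" | "simple" "u = c 0" "v = c k"
      using uv(1) F by (auto split: if_splits)
    then show "(u, v) \<in> G i"
    proof cases
      case 1
      then have "j = i" using same_block[of j i u] G[OF 1] i uv by auto
      then show ?thesis using 1 by simp
    next
      case 2
      then obtain p q where pq: "p < q" "q \<le> k" "u = c p" "v = c q" by blast
      then have "i \<le> p" "q \<le> Suc i" using uv lt(2)[of i p] lt(2)[of q "Suc i"] i by auto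
      then have "p = i" "q = Suc i" using pq by auto
      then show ?thesis using full i pq by auto
    next
      case 3
      then have "i \<le> 0" "k \<le> Suc i" using uv lt(2)[of i 0] lt(2)[of k "Suc i"] i by auto
      then show ?thesis using k2 by simp
    qed
  qed
qed

section \<open>Inflation of a permutation by blocks\<close>

text \<open>The arrangement that results from \<open>\<pi>\<close> when its \<open>i\<close>-th value is replaced by a block of values arranged by \<open>g i\<close>. It is
described by its order alone, as the size of the keys does not matter.\<close>

locale inflation =
  fixes k :: nat and c \<pi> :: "nat \<Rightarrow> nat" and g :: "nat \<Rightarrow> nat \<Rightarrow> nat" and f :: "nat \<Rightarrow> nat"
  assumes c: "strict_mono_on {..k} c" and two: "2 \<le> k"
    and inj_pi: "inj_on \<pi> {0..<k}" and inj_f: "inj_on f {c 0..<c k}"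
    and less_iff: "\<lbrakk>i < k; j < k; c i \<le> u; u < c (Suc i); c j \<le> v; v < c (Suc j)\<rbrakk>
      \<Longrightarrow> f u < f v \<longleftrightarrow> \<pi> i < \<pi> j \<or> i = j \<and> g i u < g i v"
begin

lemma c_less: "i \<le> k \<Longrightarrow> j \<le> k \<Longrightarrow> c i < c j \<longleftrightarrow> i < j"
  and c_le: "i \<le> k \<Longrightarrow> j \<le> k \<Longrightarrow> c i \<le> c j \<longleftrightarrow> i \<le> j"
  using strict_mono_on_leD[OF c] by auto

lemma block_of:
  assumes "c 0 \<le> u" "u < c k"
  obtains i where "i < k" "c i \<le> u" "u < c (Suc i)"
  using ex_block[OF c assms] by blast

lemma block_ending_after:
  assumes "c 0 < y" "y \<le> c k"
  obtains i where "i < k" "c i < y" "y \<le> c (Suc i)"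
proof -
  have "c 0 \<le> y - 1" "y - 1 < c k" using assms by linarith+
  then obtain i where "i < k" "c i \<le> y - 1" "y - 1 < c (Suc i)" by (rule block_of)
  moreover have "c i < y" "y \<le> c (Suc i)" using calculation assms by linarith+
  ultimately show ?thesis using that by blast
qed

lemma interval_family_f: "interval_family (key_intervals f (c 0) (c k)) (c 0) (c k)"
  using interval_family_key_intervals inj_f c_less[of 0 k] two by auto

lemma within_block:
  assumes i: "i < k" and "c i \<le> x" "y \<le> c (Suc i)"
  shows "(x, y) \<in> key_intervals f (c 0) (c k) \<longleftrightarrow> (x, y) \<in> key_intervals (g i) (c i) (c (Suc i))"
proof
  have ends: "c 0 \<le> c i" "c (Suc i) \<le> c k" using i c_le by auto
  {
    assume *: "(x, y) \<in> key_intervals f (c 0) (c k)"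
    show "(x, y) \<in> key_intervals (g i) (c i) (c (Suc i))"
    proof (rule key_intervalsI)
      fix u v w assume h: "x \<le> u" "u < y" "x \<le> w" "w < y" "c i \<le> v" "v < c (Suc i)"
        "g i u < g i v" "g i v < g i w"
      then have "f u < f v" "f v < f w"
        using less_iff[of i i u v] less_iff[of i i v w] i assms by auto
      then show "x \<le> v \<and> v < y"
        using key_intervalsD(4)[OF *, of u w v] h ends by auto
    qed (use assms key_intervalsD(2)[OF *] in auto)
  next
    assume *: "(x, y) \<in> key_intervals (g i) (c i) (c (Suc i))"
    show "(x, y) \<in> key_intervals f (c 0) (c k)"
    proof (rule key_intervalsI)
      fix u v w assume h: "x \<le> u" "u < y" "x \<le> w" "w < y" "c 0 \<le> v" "v < c k"
        "f u < f v" "f v < f w"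
      obtain j where j: "j < k" "c j \<le> v" "v < c (Suc j)" using block_of h by blast
      have uv: "\<pi> i < \<pi> j \<or> i = j \<and> g i u < g i v" and vw: "\<pi> j < \<pi> i \<or> j = i \<and> g j v < g j w"
        using less_iff[of i j u v] less_iff[of j i v w] i j h assms by auto
      then have "i = j" "g i u < g i v" "g i v < g i w" by auto
      then show "x \<le> v \<and> v < y"
        using key_intervalsD(4)[OF *, of u w v] h j by auto
    qed (use assms key_intervalsD(2)[OF *] ends in auto)
  }
qed

lemma union_of_blocks:
  assumes ij: "i < j" "j \<le> k"
  shows "(c i, c j) \<in> key_intervals f (c 0) (c k) \<longleftrightarrow> (i, j) \<in> key_intervals \<pi> 0 k"
proof
  have block_range: "i \<le> p \<and> p < j" if "p < k" "c p \<le> u" "u < c (Suc p)" "c i \<le> u" "u < c j" for p u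
    using that c_less[of i "Suc p"] c_less[of p j] ij by auto
  have range_block: "c i \<le> u \<and> u < c j" if "p < k" "c p \<le> u" "u < c (Suc p)" "i \<le> p" "p < j" for p u
    using that c_le[of i p] c_le[of "Suc p" j] ij by auto
  {
    assume *: "(c i, c j) \<in> key_intervals f (c 0) (c k)"
    show "(i, j) \<in> key_intervals \<pi> 0 k"
    proof (rule key_intervalsI)
      fix p q r assume h: "i \<le> p" "p < j" "i \<le> r" "r < j" "0 \<le> q" "q < k" "\<pi> p < \<pi> q" "\<pi> q < \<pi> r"
      have b: "c p < c (Suc p)" "c q < c (Suc q)" "c r < c (Suc r)" "c 0 \<le> c q" "c q < c k"
        using c_less[of p "Suc p"] c_less[of q "Suc q"] c_less[of r "Suc r"] c_le[of 0 q] c_less[of q k] h ij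
        by auto
      have "f (c p) < f (c q)" "f (c q) < f (c r)"
        using less_iff[of p q "c p" "c q"] less_iff[of q r "c q" "c r"] h b ij by auto
      moreover have "c i \<le> c p" "c p < c j" "c i \<le> c r" "c r < c j"
        using c_le c_less h ij by auto
      ultimately have "c i \<le> c q \<and> c q < c j"
        using key_intervalsD(4)[OF *, of "c p" "c r" "c q"] b by auto
      then show "i \<le> q \<and> q < j" using c_le[of i q] c_less[of q j] h ij by auto
    qed (use ij in auto)
  next
    assume *: "(i, j) \<in> key_intervals \<pi> 0 k"
    show "(c i, c j) \<in> key_intervals f (c 0) (c k)"
    proof (rule key_intervalsI)
      fix u v w assume h: "c i \<le> u" "u < c j" "c i \<le> w" "w < c j" "c 0 \<le> v" "v < c k" "f u < f v" "f v < f w"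
      have ends: "c 0 \<le> c i" "c j \<le> c k" using c_le ij by auto
      obtain p where p: "p < k" "c p \<le> u" "u < c (Suc p)" using block_of[of u] h ends by auto
      obtain q where q: "q < k" "c q \<le> v" "v < c (Suc q)" using block_of[of v] h ends by auto
      obtain r where r: "r < k" "c r \<le> w" "w < c (Suc r)" using block_of[of w] h ends by auto
      have pr: "i \<le> p" "p < j" "i \<le> r" "r < j" using block_range p r h by auto
      have le: "\<pi> p < \<pi> q \<or> p = q" "\<pi> q < \<pi> r \<or> q = r"
        using less_iff[of p q u v] less_iff[of q r v w] p q r h by auto
      have "i \<le> q \<and> q < j"
        using le key_intervalsD(4)[OF *, of p r q] pr q by auto
      then show "c i \<le> v \<and> v < c j" using range_block[of q v] q by auto
    qed (use ij c_le c_less in auto)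
  }
qed

text \<open>Suppose an interval starts strictly inside block \<open>i\<close> and reaches the next block. As block \<open>i\<close> is not a direct
sum at that point, some value of the block below the starting point sits between two values of
the interval.\<close>

lemma family_linear:
  assumes incr: "\<And>i j. i < j \<Longrightarrow> j < k \<Longrightarrow> \<pi> i < \<pi> j"
    and indec: "\<And>i x. i < k \<Longrightarrow> c i < x \<Longrightarrow> x < c (Suc i) \<Longrightarrow>
      \<exists>u v. c i \<le> u \<and> u < x \<and> x \<le> v \<and> v < c (Suc i) \<and> g i v < g i u"
  shows "key_intervals f (c 0) (c k)
    = compose_blocks False k c (\<lambda>i. key_intervals (g i) (c i) (c (Suc i)))"
proof (intro set_eqI iffI; clarify)
  fix x y assume xy: "(x, y) \<in> key_intervals f (c 0) (c k)"
  note b = key_intervalsD(1-3)[OF xy]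
  obtain i where i: "i < k" "c i \<le> x" "x < c (Suc i)" using block_of[of x] b by auto
  show "(x, y) \<in> compose_blocks False k c (\<lambda>i. key_intervals (g i) (c i) (c (Suc i)))"
  proof (cases "y \<le> c (Suc i)")
    case True
    then show ?thesis using within_block[of i x y] xy i by (auto simp: compose_blocks_def)
  next
    case False
    have ik: "Suc i < k" using c_le[of k "Suc i"] i b False by (cases "Suc i = k") auto
    have x: "x = c i"
    proof (rule ccontr)
      assume "x \<noteq> c i"
      then obtain u v where uv: "c i \<le> u" "u < x" "x \<le> v" "v < c (Suc i)" "g i v < g i u"
        using indec[of i x] i by auto
      \<comment> \<open>The least value of the next block lies in the interval and after all of block \<open>i\<close>.\<close>
      let ?w = "c (Suc i)"
      have "?w < c (Suc (Suc i))" using c_less ik by auto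
      then have "f v < f u" "f u < f ?w"
        using less_iff[of i i v u] less_iff[of i "Suc i" u ?w] incr[of i "Suc i"] uv i ik by auto
      then show False
        using key_intervalsD(4)[OF xy, of v ?w u] uv False i b c_le[of 0 i] by auto
    qed
    have "c 0 < y" using b by simp
    then obtain j where j: "j < k" and j': "c j < y" "y \<le> c (Suc j)"
      using block_ending_after b(3) by blast
    have ij: "i < j" using j' False c_less[of "Suc i" "Suc j"] i j by auto
    have y: "y = c (Suc j)"
    proof (rule ccontr)
      assume "y \<noteq> c (Suc j)"
      then obtain u v where uv: "c j \<le> u" "u < y" "y \<le> v" "v < c (Suc j)" "g j v < g j u"
        using indec[of j y] j j' by auto
      have "c i < c (Suc i)" "c i < c j" "c j \<le> c k" using c_less c_le i ij j by auto
      then have "f x < f v" "f v < f u"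
        using less_iff[of i j x v] less_iff[of j j v u] incr[OF ij] uv i j x by auto
      then show False
        using key_intervalsD(4)[OF xy, of x u v] uv b \<open>c i < c j\<close> x c_le[of 0 j] c_le[of "Suc j" k] j by auto
    qed
    have "i < Suc j" "Suc j \<le> k" using ij j by simp_all
    then show ?thesis using x y unfolding compose_blocks_def by auto
  qed
next
  fix x y assume xy: "(x, y) \<in> compose_blocks False k c (\<lambda>i. key_intervals (g i) (c i) (c (Suc i)))"
  then consider i where "i < k" "(x, y) \<in> key_intervals (g i) (c i) (c (Suc i))"
    | i j where "i < j" "j \<le> k" "x = c i" "y = c j"
    by (auto simp: compose_blocks_def)
  then show "(x, y) \<in> key_intervals f (c 0) (c k)"
  proof cases
    case 1
    then show ?thesis using within_block[of i x y] key_intervalsD(1,3)[OF 1(2)] by auto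
  next
    case 2
    have "(i, j) \<in> key_intervals \<pi> 0 k"
    proof (rule key_intervalsI)
      fix u v w assume h: "i \<le> u" "u < j" "i \<le> w" "w < j" "0 \<le> v" "v < k" "\<pi> u < \<pi> v" "\<pi> v < \<pi> w"
      then have "u < v" "v < w"
        using incr[of v u] incr[of w v] 2 by (metis less_asym less_irrefl less_le_trans linorder_neqE_nat)+
      then show "i \<le> v \<and> v < j" using h by auto
    qed (use 2 in auto)
    then show ?thesis using union_of_blocks 2 by auto
  qed
qed

text \<open>Rounding an interval that is not contained in a block outwards gives a union of at least two blocks, hence
everything, because \<open>\<pi>\<close> is simple. Were the interval itself smaller, removing the partially covered first
or last block would leave a union of at least two but not all blocks that is an interval.\<close>

lemma family_prime:
  assumes four: "4 \<le> k"
    and simple: "\<And>x y. (x, y) \<in> key_intervals \<pi> 0 k \<Longrightarrow> x + 2 \<le> y \<Longrightarrow> x = 0 \<and> y = k"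
    and inj_g: "\<And>i. i < k \<Longrightarrow> inj_on (g i) {c i..<c (Suc i)}"
  shows "key_intervals f (c 0) (c k)
    = compose_blocks True k c (\<lambda>i. key_intervals (g i) (c i) (c (Suc i)))"
proof -
  interpret interval_family "key_intervals f (c 0) (c k)" "c 0" "c k"
    by (rule interval_family_f)
  have block: "(c i, c (Suc i)) \<in> key_intervals f (c 0) (c k)" if "i < k" for i
  proof -
    interpret B: interval_family "key_intervals (g i) (c i) (c (Suc i))" "c i" "c (Suc i)"
      using interval_family_key_intervals inj_g[OF that] c_less[of i "Suc i"] that by auto
    show ?thesis using within_block[of i "c i" "c (Suc i)"] B.whole that by auto
  qed
  show ?thesis
  proof (intro set_eqI iffI; clarify)
    fix x y assume xy: "(x, y) \<in> key_intervals f (c 0) (c k)"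
    note b = key_intervalsD(1-3)[OF xy]
    obtain i where i: "i < k" "c i \<le> x" "x < c (Suc i)" using block_of[of x] b by auto
    show "(x, y) \<in> compose_blocks True k c (\<lambda>i. key_intervals (g i) (c i) (c (Suc i)))"
    proof (cases "y \<le> c (Suc i)")
      case True
      then show ?thesis using within_block[of i x y] xy i by (auto simp: compose_blocks_def)
    next
      case False
      have "c 0 < y" using b by simp
      then obtain j where j: "j < k" and j': "c j < y" "y \<le> c (Suc j)"
        using block_ending_after b(3) by blast
      have ij: "i < j" using j' False c_less[of "Suc i" "Suc j"] i j by auto
      \<comment> \<open>Rounding both ends outwards to block boundaries keeps the interval property.\<close>
      have round_right: "(c p, c (Suc j)) \<in> key_intervals f (c 0) (c k)"
        if "(c p, y) \<in> key_intervals f (c 0) (c k)" "p < j" for p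
        using that overlap_union[OF that(1) block[of j]] c_less[of p j] j j'
        by (cases "y = c (Suc j)") auto
      have "(c i, y) \<in> key_intervals f (c 0) (c k)"
        using overlap_union[OF block[of i] xy] i False xy by (cases "x = c i") auto
      then have "(i, Suc j) \<in> key_intervals \<pi> 0 k"
        using round_right[of i] union_of_blocks[of i "Suc j"] ij j by auto
      then have whole': "i = 0" "Suc j = k" using simple[of i "Suc j"] ij by auto
      have x: "x = c 0"
      proof (rule ccontr)
        assume "x \<noteq> c 0"
        then have "(c 1, y) \<in> key_intervals f (c 0) (c k)"
          using overlap_right[OF block[of i] xy] i False whole' by auto
        then have "(c 1, c k) \<in> key_intervals f (c 0) (c k)"
          using round_right[of 1] whole' four by auto
        then show False using simple[of 1 k] union_of_blocks[of 1 k] four by auto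
      qed
      have y: "y = c k"
      proof (rule ccontr)
        assume "y \<noteq> c k"
        then have "(c 0, c j) \<in> key_intervals f (c 0) (c k)"
          using overlap_left[OF xy block[of j]] x j j' whole' c_less[of 0 j] four by auto
        then show False using simple[of 0 j] union_of_blocks[of 0 j] four whole' by auto
      qed
      show ?thesis using x y by (auto simp: compose_blocks_def)
    qed
  next
    fix x y assume xy: "(x, y) \<in> compose_blocks True k c (\<lambda>i. key_intervals (g i) (c i) (c (Suc i)))"
    then consider i where "i < k" "(x, y) \<in> key_intervals (g i) (c i) (c (Suc i))" | "x = c 0" "y = c k"
      by (auto simp: compose_blocks_def)
    then show "(x, y) \<in> key_intervals f (c 0) (c k)"
    proof cases
      case 1
      then show ?thesis using within_block[of i x y] key_intervalsD(1,3)[OF 1(2)] by auto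
    qed (use whole in auto)
  qed
qed

end

lemma ex_inflation:
  assumes c: "strict_mono_on {..k} c" and two: "2 \<le> k" and inj_pi: "inj_on \<pi> {0..<k}"
    and inj_g: "\<And>i. i < k \<Longrightarrow> inj_on (g i) {c i..<c (Suc i)}"
  shows "\<exists>f. inflation k c \<pi> g f"
proof -
  note lt = strict_mono_on_leD[OF c]
  define N where "N = Suc (\<Sum>i<k. \<Sum>v<c k. g i v)"
  have N: "g i v < N" if "i < k" "v < c k" for i v
  proof -
    have "g i v \<le> (\<Sum>v<c k. g i v)" using that by (intro member_le_sum) auto
    also have "\<dots> \<le> (\<Sum>i<k. \<Sum>v<c k. g i v)"
      using that by (intro member_le_sum[of i "{..<k}" "\<lambda>i. \<Sum>v<c k. g i v"]) auto
    finally show ?thesis by (simp add: N_def)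
  qed
  define blk where "blk v = (THE i. i < k \<and> c i \<le> v \<and> v < c (Suc i))" for v
  have same_block: "i = j" if "i < k" "j < k" "c i \<le> x" "x < c (Suc i)" "c j \<le> x" "x < c (Suc j)" for i j x
    using that lt(1)[of i "Suc j"] lt(1)[of j "Suc i"] by auto
  have blk: "blk v = i" if "i < k" "c i \<le> v" "v < c (Suc i)" for i v
    unfolding blk_def using that same_block by (intro the_equality) auto
  define f where "f v = \<pi> (blk v) * N + g (blk v) v" for v
  have lex: "p * N + r < q * N + s \<longleftrightarrow> p < q \<or> p = q \<and> r < s" if "r < N" "s < N" for p q r s
  proof (cases p q rule: linorder_cases)
    case less
    then have "Suc p * N \<le> q * N" by (intro mult_right_mono) auto
    then show ?thesis using less that by simp
  next
    case greater
    then have "Suc q * N \<le> p * N" by (intro mult_right_mono) auto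
    then show ?thesis using greater that by simp
  qed simp
  have in_range: "v < c k" if "i < k" "v < c (Suc i)" for i v
    using that lt(2)[of "Suc i" k] by simp
  have less_iff: "f u < f v \<longleftrightarrow> \<pi> i < \<pi> j \<or> i = j \<and> g i u < g i v"
    if h: "i < k" "j < k" "c i \<le> u" "u < c (Suc i)" "c j \<le> v" "v < c (Suc j)" for i j u v
  proof -
    have "\<pi> i = \<pi> j \<longleftrightarrow> i = j" using inj_pi h by (auto simp: inj_on_eq_iff)
    then show ?thesis
      using lex[OF N N, of i u j v "\<pi> i" "\<pi> j"] h in_range blk by (auto simp: f_def)
  qed
  have "inj_on f {c 0..<c k}"
  proof (rule inj_onI)
    fix u v assume *: "u \<in> {c 0..<c k}" "v \<in> {c 0..<c k}" and eq: "f u = f v"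
    obtain i where i: "i < k" "c i \<le> u" "u < c (Suc i)" using ex_block[OF c, of u] * by auto
    obtain j where j: "j < k" "c j \<le> v" "v < c (Suc j)" using ex_block[OF c, of v] * by auto
    have "\<not> \<pi> i < \<pi> j" "\<not> \<pi> j < \<pi> i"
      using less_iff[of i j u v] less_iff[of j i v u] i j eq by auto
    then have "i = j" using inj_pi i j by (metis atLeastLessThan_iff inj_on_eq_iff less_eq_nat.simps(1) linorder_neqE_nat)
    then have "g i u = g i v"
      using less_iff[of i j u v] less_iff[of j i v u] i j eq by auto
    then show "u = v" using inj_g[of i] i j \<open>i = j\<close> by (auto simp: inj_on_eq_iff)
  qed
  then show ?thesis using c two inj_pi less_iff by (intro exI[of _ f]) (unfold_locales, auto)
qed

section \<open>Decomposition trees\<close>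

text \<open>The flag of a node is true for a simple and false for a linear node. A simple node does not record which simple
permutation it carries, since all of those of the same size have the same intervals.\<close>

datatype tree = Leaf | Node bool "tree list"

primrec leaves :: "tree \<Rightarrow> nat" where
  "leaves Leaf = 1"
| "leaves (Node s ts) = sum_list (map leaves ts)"

definition boundary :: "nat \<Rightarrow> tree list \<Rightarrow> nat \<Rightarrow> nat" where
  "boundary a ts i = a + sum_list (map leaves (take i ts))"

primrec family :: "tree \<Rightarrow> nat \<Rightarrow> (nat \<times> nat) set" where
  "family Leaf = (\<lambda>a. {(a, Suc a)})"
| "family (Node s ts) = (\<lambda>a. compose_blocks s (length ts) (boundary a ts)
     (\<lambda>i. (map family ts ! i) (boundary a ts i)))"

text \<open>The two arities are those of a direct sum and of the smallest simple permutation.\<close>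

fun proper :: "tree \<Rightarrow> bool" where
  "proper Leaf = True"
| "proper (Node s ts) = ((if s then 4 else 2) \<le> length ts \<and> (\<forall>t\<in>set ts. proper t))"

lemma compose_blocks_cong:
  assumes "\<And>i. i < k \<Longrightarrow> G i = G' i" "\<And>i. i \<le> k \<Longrightarrow> c i = c' i"
  shows "compose_blocks s k c G = compose_blocks s k c' G'"
proof -
  have "(\<Union>i<k. G i) = (\<Union>i<k. G' i)" using assms by auto
  moreover have "{(c i, c j) | i j. i < j \<and> j \<le> k} = {(c' i, c' j) | i j. i < j \<and> j \<le> k}"
  proof -
    have "{(d i, d j) | i j. i < j \<and> j \<le> k} = (\<lambda>(i, j). (d i, d j)) ` {(i, j). i < j \<and> j \<le> k}"
      for d :: "nat \<Rightarrow> nat" by auto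
    moreover have "(\<lambda>(i, j). (c i, c j)) ` {(i, j). i < j \<and> j \<le> k} =
      (\<lambda>(i, j). (c' i, c' j)) ` {(i, j). i < j \<and> j \<le> k}"
      using assms(2) by (intro image_cong) auto
    ultimately show ?thesis by simp
  qed
  ultimately show ?thesis using assms(2) unfolding compose_blocks_def by simp
qed

lemma compose_blocks_cases:
  assumes "(u, v) \<in> compose_blocks s k c G" "0 < k"
  shows "(\<exists>i<k. (u, v) \<in> G i) \<or> (\<exists>i j. i < j \<and> j \<le> k \<and> u = c i \<and> v = c j)"
proof (cases s)
  case True
  then have "(\<exists>i<k. (u, v) \<in> G i) \<or> u = c 0 \<and> v = c k"
    using assms(1) by (auto simp: compose_blocks_def)
  with assms(2) show ?thesis by blast
next
  case False
  then show ?thesis using assms(1) by (auto simp: compose_blocks_def)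
qed

lemma family_Node:
  "family (Node s ts) a = compose_blocks s (length ts) (boundary a ts) (\<lambda>i. family (ts ! i) (boundary a ts i))"
  by (auto simp: family.simps(2) intro!: compose_blocks_cong)

declare family.simps(2) [simp del]

lemma boundary_0 [simp]: "boundary a ts 0 = a"
  and boundary_Suc: "i < length ts \<Longrightarrow> boundary a ts (Suc i) = boundary a ts i + leaves (ts ! i)"
  and boundary_length: "boundary a ts (length ts) = a + leaves (Node s ts)"
  by (simp_all add: boundary_def take_Suc_conv_app_nth)

lemma leaves_pos: "proper t \<Longrightarrow> 1 \<le> leaves t"
proof (induction t)
  case (Node s ts)
  then have "ts \<noteq> []" by (auto split: if_splits)
  then obtain t where t: "t \<in> set ts" using hd_in_set by blast
  then have "leaves t \<le> sum_list (map leaves ts)" by (intro member_le_sum_list) auto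
  then show ?case using Node t by fastforce
qed simp

lemma strict_mono_on_boundary:
  assumes "\<And>t. t \<in> set ts \<Longrightarrow> proper t"
  shows "strict_mono_on {..length ts} (boundary a ts)"
proof -
  have step: "boundary a ts i < boundary a ts (Suc i)" if "i < length ts" for i
    using boundary_Suc[OF that] leaves_pos[of "ts ! i"] assms[of "ts ! i"] that by simp
  have "boundary a ts i < boundary a ts j" if "i < j" "j \<le> length ts" for i j
    using that
  proof (induction j)
    case (Suc j)
    then show ?case using step[of j] by (cases "i = j") auto
  qed simp
  then show ?thesis by (intro strict_mono_onI) auto
qed

lemma family_bounds:
  "proper t \<Longrightarrow> (a, a + leaves t) \<in> family t a \<and>
    (\<forall>u v. (u, v) \<in> family t a \<longrightarrow> a \<le> u \<and> u < v \<and> v \<le> a + leaves t)"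
proof (induction t arbitrary: a)
  case (Node s ts)
  let ?k = "length ts" and ?c = "boundary a ts"
  have pr: "proper t" if "t \<in> set ts" for t using Node.prems that by simp
  note lt = strict_mono_on_leD[OF strict_mono_on_boundary[of ts a, OF pr]]
  have end_eq: "?c ?k = a + leaves (Node s ts)" by (rule boundary_length)
  have k2: "2 \<le> ?k" using Node.prems by (auto split: if_splits)
  have "(?c 0, ?c ?k) \<in> family (Node s ts) a"
  proof -
    have "\<exists>i j. ?c 0 = ?c i \<and> ?c ?k = ?c j \<and> i < j \<and> j \<le> ?k"
      using k2 by (intro exI[of _ 0] exI[of _ ?k]) auto
    then show ?thesis unfolding family_Node compose_blocks_def by (cases s) auto
  qed
  moreover have "a \<le> u \<and> u < v \<and> v \<le> a + leaves (Node s ts)"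
    if uv: "(u, v) \<in> family (Node s ts) a" for u v
  proof -
    consider i where "i < ?k" "(u, v) \<in> family (ts ! i) (?c i)"
      | i j where "i < j" "j \<le> ?k" "u = ?c i" "v = ?c j"
      using compose_blocks_cases[OF uv[unfolded family_Node]] k2 by fastforce
    then show ?thesis
    proof cases
      case 1
      have "?c i \<le> u \<and> u < v \<and> v \<le> ?c i + leaves (ts ! i)"
        using Node.IH[of "ts ! i" "?c i"] pr[of "ts ! i"] 1 by auto
      moreover have "?c 0 \<le> ?c i" "?c (Suc i) \<le> ?c ?k"
        using lt(2)[of 0 i] lt(2)[of "Suc i" ?k] 1 by auto
      ultimately show ?thesis using end_eq boundary_Suc[of i ts a] 1 by auto
    next
      case 2
      then show ?thesis using lt(1)[of i j] lt(2)[of 0 i] lt(2)[of j ?k] end_eq by auto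
    qed
  qed
  ultimately show ?case using end_eq by (metis boundary_0)
qed simp

lemma family_Node_children:
  assumes "proper (Node s ts)"
  shows "strict_mono_on {..length ts} (boundary a ts)" "(if s then 4 else 2) \<le> length ts"
    "\<And>i u v. i < length ts \<Longrightarrow> (u, v) \<in> family (ts ! i) (boundary a ts i) \<Longrightarrow>
      boundary a ts i \<le> u \<and> u < v \<and> v \<le> boundary a ts (Suc i)"
    "\<And>i. i < length ts \<Longrightarrow> (boundary a ts i, boundary a ts (Suc i)) \<in> family (ts ! i) (boundary a ts i)"
proof -
  have pr: "proper t" if "t \<in> set ts" for t using assms that by simp
  show "strict_mono_on {..length ts} (boundary a ts)" using pr by (rule strict_mono_on_boundary)
  show "(if s then 4 else 2) \<le> length ts" using assms by simp
  show "boundary a ts i \<le> u \<and> u < v \<and> v \<le> boundary a ts (Suc i)"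
    if "i < length ts" "(u, v) \<in> family (ts ! i) (boundary a ts i)" for i u v
    using family_bounds[of "ts ! i" "boundary a ts i"] pr[of "ts ! i"] that boundary_Suc[of i ts a] by auto
  show "(boundary a ts i, boundary a ts (Suc i)) \<in> family (ts ! i) (boundary a ts i)" if "i < length ts" for i
    using family_bounds[of "ts ! i" "boundary a ts i"] pr[of "ts ! i"] that boundary_Suc[of i ts a] by auto
qed

lemma leaves_Node_ge_2: "proper (Node s ts) \<Longrightarrow> 2 \<le> leaves (Node s ts)"
proof -
  assume p: "proper (Node s ts)"
  then have "2 \<le> length ts" by (auto split: if_splits)
  also have "length ts = sum_list (map (\<lambda>_. 1) ts)" by (simp add: sum_list_triv)
  also have "\<dots> \<le> sum_list (map leaves ts)"
    using p leaves_pos by (intro sum_list_mono) auto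
  finally show ?thesis by simp
qed

text \<open>By induction: the root is determined by \<open>compose_blocks_boundaries\<close>, and the children have smaller families.\<close>

lemma family_inj:
  "proper t \<Longrightarrow> proper t' \<Longrightarrow> family t a = family t' a \<Longrightarrow> t = t'"
proof (induction t arbitrary: t' a)
  case Leaf
  then have "leaves t' = 1"
    using family_bounds[OF Leaf.prems(2), of a] Leaf.prems(3)[symmetric] by simp
  then show ?case using leaves_Node_ge_2 Leaf.prems(2) by (cases t') force+
next
  case (Node s ts)
  note p = Node.prems(1) and p' = Node.prems(2)
  have leaves_eq: "leaves (Node s ts) = leaves t'"
    using family_bounds[OF p, of a] family_bounds[OF p', of a] Node.prems(3)
    by (metis add_le_cancel_left le_antisym)
  then obtain s' ts' where t': "t' = Node s' ts'"
    using leaves_Node_ge_2[OF p] by (cases t') auto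
  note p' = p'[unfolded t']
  let ?k = "length ts" and ?c = "boundary a ts" and ?k' = "length ts'" and ?c' = "boundary a ts'"
  note ch = family_Node_children(1)[OF p, where a=a] family_Node_children(2)[OF p]
    family_Node_children(3)[OF p, where a=a] family_Node_children(4)[OF p, where a=a]
  note ch' = family_Node_children(1)[OF p', where a=a] family_Node_children(2)[OF p']
    family_Node_children(3)[OF p', where a=a] family_Node_children(4)[OF p', where a=a]
  note b = compose_blocks_boundaries[where G = "\<lambda>i. family (ts ! i) (?c i)", OF ch,
      folded family_Node, unfolded boundary_0]
  note b' = compose_blocks_boundaries[where G = "\<lambda>i. family (ts' ! i) (?c' i)", OF ch',
      folded family_Node, unfolded boundary_0]
  have ends: "?c ?k = ?c' ?k'" using leaves_eq t' by (simp add: boundary_def)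
  have F: "family (Node s ts) a = family (Node s' ts') a" using Node.prems(3) t' by simp
  have s: "s = s'" using b(1) b'(1) F ends by simp
  have "?c ` {..?k} = ?c' ` {..?k'}"
    by (simp only: b(2) b'(2)[folded s] F[folded s] ends)
  then have k: "?k = ?k'" and c: "\<And>i. i \<le> ?k \<Longrightarrow> ?c i = ?c' i"
    using strict_mono_enumeration_unique[OF ch(1) ch'(1)]
    by auto
  have "ts = ts'"
  proof (rule nth_equalityI[OF k])
    fix i assume i: "i < ?k"
    have "family (ts ! i) (?c i) = restrict_family (family (Node s ts) a) (?c i) (?c (Suc i))"
      by (rule b(3)) (use i in auto)
    also have "\<dots> = restrict_family (family (Node s' ts') a) (?c' i) (?c' (Suc i))"
      using i c[of i] c[of "Suc i"] F by simp
    also have "\<dots> = family (ts' ! i) (?c' i)"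
      by (rule b'(3)[symmetric]) (use i k in auto)
    finally have "family (ts ! i) (?c i) = family (ts' ! i) (?c i)"
      using c[of i] i by simp
    then show "ts ! i = ts' ! i"
      using Node.IH[of "ts ! i" "ts' ! i" "?c i"] p p' i k by simp
  qed
  then show ?case using s t' by simp
qed

lemma interval_family_imp_tree:
  "interval_family F a b \<Longrightarrow> \<exists>t. proper t \<and> leaves t = b - a \<and> family t a = F"
proof (induction "b - a" arbitrary: F a b rule: less_induct)
  case less
  interpret interval_family F a b by (rule less.prems)
  show ?case
  proof (cases "a + 2 \<le> b")
    case False
    then have b: "b = Suc a" using nonempty by simp
    have "F = {(a, b)}"
    proof (intro set_eqI iffI; clarify)
      fix u v assume "(u, v) \<in> F"
      then show "u = a \<and> v = b" using bounds[of u v] b by auto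
    qed (use whole in auto)
    then show ?thesis using b by (intro exI[of _ Leaf]) auto
  next
    case True
    obtain s k c where c: "strict_mono_on {..k} c" "c 0 = a" "c k = b" and k: "(if s then 4 else 2) \<le> k"
      and blk: "\<And>i. i < k \<Longrightarrow> (c i, c (Suc i)) \<in> F"
      and F: "F = compose_blocks s k c (\<lambda>i. restrict_family F (c i) (c (Suc i)))"
    proof (cases "cuts = {}")
      case True
      obtain k c where c: "strict_mono_on {..k} c" "c 0 = a" "c k = b" and k: "4 \<le> k"
        and blk: "\<And>i. i < k \<Longrightarrow> (c i, c (Suc i)) \<in> F"
        and F: "F = compose_blocks True k c (\<lambda>i. restrict_family F (c i) (c (Suc i)))"
        by (rule decompose_prime[OF True \<open>a + 2 \<le> b\<close>]) (rule that; assumption)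
      have "(if True then 4 else 2) \<le> k" using k by (simp only: if_True if_False)
      then show ?thesis by (rule that[OF c _ blk F])
    next
      case False
      obtain k c where c: "strict_mono_on {..k} c" "c 0 = a" "c k = b" and k: "2 \<le> k"
        and blk: "\<And>i. i < k \<Longrightarrow> (c i, c (Suc i)) \<in> F"
        and F: "F = compose_blocks False k c (\<lambda>i. restrict_family F (c i) (c (Suc i)))"
        by (rule decompose_linear[OF False]) (rule that; assumption)
      have "(if False then 4 else 2) \<le> k" using k by (simp only: if_True if_False)
      then show ?thesis by (rule that[OF c _ blk F])
    qed
    note lt = strict_mono_on_leD[OF c(1)]
    have k2: "2 \<le> k" using k by (auto split: if_splits)
    have "\<exists>t. proper t \<and> leaves t = c (Suc i) - c i \<and> family t (c i) = restrict_family F (c i) (c (Suc i))"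
      if i: "i < k" for i
    proof (rule less.hyps)
      show "interval_family (restrict_family F (c i) (c (Suc i))) (c i) (c (Suc i))"
        by (rule interval_family_restrict) (rule blk[OF i])
      have "c 0 \<le> c i" "c i < c (Suc i)" "c (Suc i) \<le> c k" using lt i by auto
      moreover have "c i \<noteq> c 0 \<or> c (Suc i) \<noteq> c k" using lt(3)[of i 0] lt(3)[of "Suc i" k] i k2 by auto
      ultimately show "c (Suc i) - c i < b - a" using c by auto
    qed
    then obtain T where T: "\<And>i. i < k \<Longrightarrow> proper (T i) \<and> leaves (T i) = c (Suc i) - c i \<and>
        family (T i) (c i) = restrict_family F (c i) (c (Suc i))"
      by metis
    let ?ts = "map T [0..<k]"
    have bd: "boundary a ?ts i = c i" if "i \<le> k" for i
      using that
    proof (induction i)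
      case (Suc i)
      then show ?case using boundary_Suc[of i ?ts a] T[of i] lt(2)[of i "Suc i"] by simp
    qed (simp add: c)
    have len: "length ?ts = k" by simp
    have "family (Node s ?ts) a =
        compose_blocks s k (boundary a ?ts) (\<lambda>i. family (?ts ! i) (boundary a ?ts i))"
      by (simp only: family_Node len)
    also have "\<dots> = compose_blocks s k c (\<lambda>i. restrict_family F (c i) (c (Suc i)))"
      by (rule compose_blocks_cong) (simp_all add: T bd)
    also have "\<dots> = F" by (rule F[symmetric])
    finally have "family (Node s ?ts) a = F" .
    moreover have "leaves (Node s ?ts) = b - a"
      using boundary_length[of a ?ts s] bd[of k] c by simp
    moreover have "proper (Node s ?ts)" using T k by auto
    ultimately show ?thesis by blast
  qed
qed

text \<open>Every tree is realised from its leaves upwards: a linear node by an increasing arrangement of keys that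
are not direct sums, a simple node by inflating a simple permutation.\<close>

lemma tree_imp_key:
  "proper t \<Longrightarrow> \<exists>f. inj_on f {a..<a + leaves t} \<and> key_intervals f a (a + leaves t) = family t a"
proof (induction t arbitrary: a)
  case Leaf
  have "key_intervals (\<lambda>v. v) a (Suc a) = {(a, Suc a)}"
    by (auto simp: key_intervals_def)
  then show ?case by (intro exI[of _ "\<lambda>v. v"]) simp
next
  case (Node s ts)
  let ?k = "length ts" and ?c = "boundary a ts"
  note ch = family_Node_children(1)[OF Node.prems, where a=a] family_Node_children(2)[OF Node.prems]
    family_Node_children(3)[OF Node.prems, where a=a] family_Node_children(4)[OF Node.prems, where a=a]
  have k2: "2 \<le> ?k" using ch(2) by (auto split: if_splits)
  have end_eq: "?c ?k = a + leaves (Node s ts)" by (rule boundary_length)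
  have "\<exists>g. inj_on g {?c i..<?c (Suc i)} \<and> key_intervals g (?c i) (?c (Suc i)) = family (ts ! i) (?c i) \<and>
      (\<forall>x. ?c i < x \<and> x < ?c (Suc i) \<longrightarrow>
        (\<exists>u v. ?c i \<le> u \<and> u < x \<and> x \<le> v \<and> v < ?c (Suc i) \<and> g v < g u))" if i: "i < ?k" for i
  proof -
    obtain g where g: "inj_on g {?c i..<?c (Suc i)}"
        "key_intervals g (?c i) (?c (Suc i)) = family (ts ! i) (?c i)"
      using Node.IH[of "ts ! i" "?c i"] Node.prems i boundary_Suc[OF i, of a] by auto
    show ?thesis using ex_sum_indecomposable_key[OF g(1)] g(2) by metis
  qed
  then obtain g where g: "\<And>i. i < ?k \<Longrightarrow> inj_on (g i) {?c i..<?c (Suc i)}"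
      "\<And>i. i < ?k \<Longrightarrow> key_intervals (g i) (?c i) (?c (Suc i)) = family (ts ! i) (?c i)"
      "\<And>i x. i < ?k \<Longrightarrow> ?c i < x \<Longrightarrow> x < ?c (Suc i) \<Longrightarrow>
        (\<exists>u v. ?c i \<le> u \<and> u < x \<and> x \<le> v \<and> v < ?c (Suc i) \<and> g i v < g i u)"
    by metis
  have cong: "compose_blocks s ?k ?c (\<lambda>i. key_intervals (g i) (?c i) (?c (Suc i))) = family (Node s ts) a" for s
    unfolding family_Node using g(2) by (intro compose_blocks_cong) auto
  show ?case
  proof (cases s)
    case False
    obtain f where "inflation ?k ?c (\<lambda>i. i) g f"
      using ex_inflation[OF ch(1) k2 _ g(1), of "\<lambda>i. i"] by auto
    then interpret inflation ?k ?c "\<lambda>i. i" g f .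
    have "key_intervals f (?c 0) (?c ?k) = family (Node False ts) a"
      using family_linear g(3) cong by auto
    then show ?thesis using inj_f False end_eq by (intro exI[of _ f]) auto
  next
    case True
    then have four: "4 \<le> ?k" using ch(2) by simp
    obtain \<pi> where \<pi>: "inj_on \<pi> {0..<?k}"
        "\<And>x y. (x, y) \<in> key_intervals \<pi> 0 ?k \<Longrightarrow> x + 2 \<le> y \<Longrightarrow> x = 0 \<and> y = ?k"
      using ex_simple_key[OF four] by auto
    obtain f where "inflation ?k ?c \<pi> g f"
      using ex_inflation[OF ch(1) k2 \<pi>(1) g(1)] by auto
    then interpret inflation ?k ?c \<pi> g f .
    have "key_intervals f (?c 0) (?c ?k) = family (Node True ts) a"
      using family_prime[OF four \<pi>(2) g(1)] cong by auto
    then show ?thesis using inj_f True end_eq by (intro exI[of _ f]) auto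
  qed
qed

theorem key_intervals_iff_tree:
  "(\<exists>f. inj_on f {a..<a + n} \<and> F = key_intervals f a (a + n)) \<and> n \<ge> 1 \<longleftrightarrow>
   (\<exists>t. proper t \<and> leaves t = n \<and> F = family t a)"
  using interval_family_key_intervals[of a "a + n"] interval_family_imp_tree[of _ a "a + n"] tree_imp_key
    leaves_pos by (metis add_diff_cancel_left' less_add_same_cancel1 less_eq_Suc_le One_nat_def)

section \<open>Interval posets correspond to decomposition trees\<close>

definition interval_sets :: "(nat \<times> nat) set \<Rightarrow> nat set set" where
  "interval_sets F = (\<lambda>(x, y). {x..<y}) ` F"

lemma interval_sets_inj:
  assumes "\<And>x y. (x, y) \<in> F \<Longrightarrow> x < y" "\<And>x y. (x, y) \<in> F' \<Longrightarrow> x < y"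
    and eq: "interval_sets F = interval_sets F'"
  shows "F = F'"
proof -
  have *: "F \<subseteq> F'" if "\<And>x y. (x, y) \<in> F \<Longrightarrow> x < y" "interval_sets F = interval_sets F'" for F F' :: "(nat \<times> nat) set"
  proof clarify
    fix x y assume xy: "(x, y) \<in> F"
    have "{x..<y} \<in> interval_sets F"
      unfolding interval_sets_def by (rule image_eqI[OF _ xy]) simp
    then have "{x..<y} \<in> interval_sets F'" using that(2) by simp
    then obtain x' y' where F': "(x', y') \<in> F'" and eq: "{x..<y} = {x'..<y'}" by (auto simp: interval_sets_def)
    have "x < y" using that(1)[OF xy] .
    then have "x \<in> {x'..<y'}" using eq by auto
    then have "x' < y'" by simp
    then have "x = x' \<and> y = y'" using atLeastLessThan_eq_iff[OF \<open>x < y\<close>] eq by blast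
    then show "(x, y) \<in> F'" using F' by simp
  qed
  show ?thesis using *[OF assms(1) eq] *[OF assms(2) eq[symmetric]] by (rule subset_antisym)
qed

lemma key_intervals_order_cong:
  assumes "\<And>u v. \<lbrakk>a \<le> u; u < b; a \<le> v; v < b\<rbrakk> \<Longrightarrow> f u < f v \<longleftrightarrow> f' u < f' v"
  shows "key_intervals f a b = key_intervals f' a b"
proof -
  have *: "key_intervals f a b \<subseteq> key_intervals f' a b"
    if ff: "\<And>u v. \<lbrakk>a \<le> u; u < b; a \<le> v; v < b\<rbrakk> \<Longrightarrow> f u < f v \<longleftrightarrow> f' u < f' v" for f f' :: "nat \<Rightarrow> nat"
  proof clarify
    fix x y assume xy: "(x, y) \<in> key_intervals f a b"
    note b = key_intervalsD(1-3)[OF xy]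
    show "(x, y) \<in> key_intervals f' a b"
    proof (rule key_intervalsI[OF b])
      fix u v w assume h: "x \<le> u" "u < y" "x \<le> w" "w < y" "a \<le> v" "v < b" "f' u < f' v" "f' v < f' w"
      then have "f u < f v" "f v < f w" using ff[of u v] ff[of v w] b by auto
      then show "x \<le> v \<and> v < y" using key_intervalsD(4)[OF xy, of u w v] h by auto
    qed
  qed
  show ?thesis by (intro subset_antisym *) (use assms in auto)
qed

lemma convex_nat_set_interval:
  fixes S :: "nat set"
  assumes "finite S" "S \<noteq> {}" and conv: "\<And>p q r. \<lbrakk>p \<in> S; r \<in> S; p < q; q < r\<rbrakk> \<Longrightarrow> q \<in> S"
  shows "S = {Min S..Max S}"
proof (intro set_eqI iffI)
  fix q assume q: "q \<in> {Min S..Max S}"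
  consider "q = Min S" | "q = Max S" | "Min S < q" "q < Max S" using q by fastforce
  then show "q \<in> S"
    using conv[of "Min S" "Max S" q] Min_in[OF assms(1,2)] Max_in[OF assms(1,2)] by cases auto
qed (use assms(1) in auto)

text \<open>A set of positions is a contiguous stretch exactly if it is convex in the order of positions, which
is the condition on the key.\<close>

lemma intervals_eq_interval_sets:
  assumes \<sigma>: "\<sigma> permutes {1..n}"
  shows "intervals n \<sigma> = interval_sets (key_intervals (inv \<sigma>) 1 (1 + n))"
proof (intro set_eqI iffI)
  note inv1 = permutes_inverses[OF \<sigma>]
  have mem: "\<sigma> i \<in> {1..n} \<longleftrightarrow> i \<in> {1..n}" "inv \<sigma> i \<in> {1..n} \<longleftrightarrow> i \<in> {1..n}" for i
    using permutes_in_image[OF \<sigma>] permutes_in_image[OF permutes_inv[OF \<sigma>]] by auto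
  fix I :: "nat set"
  {
    assume "I \<in> intervals n \<sigma>"
    then obtain j h i where I: "I = {j..j + h}" and i: "i \<ge> 1" "i + h \<le> n" "\<sigma> ` {i..i + h} = {j..j + h}"
      unfolding intervals_def by auto
    have sub: "{j..j + h} \<subseteq> {1..n}"
    proof
      fix v assume "v \<in> {j..j + h}"
      then obtain p where "p \<in> {i..i + h}" "v = \<sigma> p" using i(3) by blast
      then show "v \<in> {1..n}" using mem(1)[of p] i(1,2) by simp
    qed
    have pos: "inv \<sigma> u \<in> {i..i + h} \<longleftrightarrow> u \<in> {j..j + h}" for u
    proof
      assume "inv \<sigma> u \<in> {i..i + h}"
      then have "\<sigma> (inv \<sigma> u) \<in> \<sigma> ` {i..i + h}" by (rule imageI)
      then show "u \<in> {j..j + h}" using i(3) inv1 by simp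
    next
      assume "u \<in> {j..j + h}"
      then obtain p where "p \<in> {i..i + h}" "u = \<sigma> p" using i(3) by blast
      then show "inv \<sigma> u \<in> {i..i + h}" using inv1 by simp
    qed
    have "(j, Suc (j + h)) \<in> key_intervals (inv \<sigma>) 1 (1 + n)"
    proof (rule key_intervalsI)
      show "1 \<le> j" "j < Suc (j + h)" "Suc (j + h) \<le> 1 + n" using sub by auto
      fix u v w assume "j \<le> u" "u < Suc (j + h)" "j \<le> w" "w < Suc (j + h)"
        "inv \<sigma> u < inv \<sigma> v" "inv \<sigma> v < inv \<sigma> w"
      then have "inv \<sigma> v \<in> {i..i + h}" using pos[of u] pos[of w] by auto
      then show "j \<le> v \<and> v < Suc (j + h)" using pos[of v] by auto
    qed
    moreover have "I = {j..<Suc (j + h)}" using I by auto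
    ultimately show "I \<in> interval_sets (key_intervals (inv \<sigma>) 1 (1 + n))"
      unfolding interval_sets_def by (metis (mono_tags, lifting) case_prod_conv image_eqI)
  next
    assume "I \<in> interval_sets (key_intervals (inv \<sigma>) 1 (1 + n))"
    then obtain x y where xy: "(x, y) \<in> key_intervals (inv \<sigma>) 1 (1 + n)" and I: "I = {x..<y}"
      by (auto simp: interval_sets_def)
    note b = key_intervalsD(1-3)[OF xy]
    let ?S = "inv \<sigma> ` {x..<y}"
    have S: "?S \<subseteq> {1..n}" using mem(2) b by force
    have "?S = {Min ?S..Max ?S}"
    proof (rule convex_nat_set_interval)
      fix p q r assume h: "p \<in> ?S" "r \<in> ?S" "p < q" "q < r"
      then obtain u w where uw: "u \<in> {x..<y}" "p = inv \<sigma> u" "w \<in> {x..<y}" "r = inv \<sigma> w" by blast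
      have "p \<in> {1..n}" "r \<in> {1..n}" using h S by blast+
      then have "q \<in> {1..n}" using h by auto
      then have "\<sigma> q \<in> {1..n}" using mem by blast
      then have "\<sigma> q \<in> {x..<y}"
        using key_intervalsD(4)[OF xy, of u w "\<sigma> q"] uw h inv1 by auto
      then have "inv \<sigma> (\<sigma> q) \<in> ?S" by (rule imageI)
      then show "q \<in> ?S" using inv1 by simp
    qed (use b in auto)
    then obtain i j where ij: "?S = {i..j}" by blast
    have "card ?S = y - x"
      using permutes_inj[OF permutes_inv[OF \<sigma>]] by (subst card_image) (auto intro: inj_on_subset)
    then have "Suc j - i = y - x" using ij by simp
    then have j: "j = i + (y - x - 1)" using b by simp
    have "\<sigma> ` ?S = {x..<y}" using inv1 by (simp add: image_image)
    then have "\<sigma> ` {i..i + (y - x - 1)} = {x..x + (y - x - 1)}" using ij j b by auto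
    moreover have "i \<ge> 1" "i + (y - x - 1) \<le> n" using S ij j by auto
    moreover have "I = {x..x + (y - x - 1)}" using I b by auto
    ultimately show "I \<in> intervals n \<sigma>" unfolding intervals_def by blast
  }
qed

text \<open>The position of a value is the rank of its key.\<close>

lemma ex_permutation_of_key:
  assumes inj: "inj_on f {1..<1 + n}"
  shows "\<exists>\<sigma>. \<sigma> permutes {1..n} \<and> key_intervals (inv \<sigma>) 1 (1 + n) = key_intervals f 1 (1 + n)"
proof -
  define r where "r v = (if v \<in> {1..n} then card {w \<in> {1..n}. f w \<le> f v} else v)" for v
  have r_less: "r u < r v" if "u \<in> {1..n}" "v \<in> {1..n}" "f u < f v" for u v
  proof -
    have "{w \<in> {1..n}. f w \<le> f u} \<subseteq> {w \<in> {1..n}. f w \<le> f v}" using that by auto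
    moreover have "v \<in> {w \<in> {1..n}. f w \<le> f v}" "v \<notin> {w \<in> {1..n}. f w \<le> f u}" using that by auto
    ultimately have "{w \<in> {1..n}. f w \<le> f u} \<subset> {w \<in> {1..n}. f w \<le> f v}" by blast
    then have "card {w \<in> {1..n}. f w \<le> f u} < card {w \<in> {1..n}. f w \<le> f v}"
      by (intro psubset_card_mono) auto
    then show ?thesis using that by (simp add: r_def)
  qed
  have r_iff: "f u < f v \<longleftrightarrow> r u < r v" if h: "u \<in> {1..n}" "v \<in> {1..n}" for u v
  proof (cases "f u" "f v" rule: linorder_cases)
    case equal
    then have "u = v" using inj h by (auto simp: inj_on_eq_iff)
    then show ?thesis by simp
  qed (use r_less[OF h] r_less[OF h(2,1)] in auto)
  have "inj_on r {1..n}"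
  proof (rule inj_onI)
    fix u v assume h: "u \<in> {1..n}" "v \<in> {1..n}" "r u = r v"
    then have "f u = f v" using r_iff[of u v] r_iff[of v u] by auto
    then show "u = v" using inj h by (auto simp: inj_on_eq_iff)
  qed
  moreover have "r ` {1..n} \<subseteq> {1..n}"
  proof clarify
    fix v assume v: "v \<in> {1..n}"
    have "card {w \<in> {1..n}. f w \<le> f v} \<le> card {1..n}" by (intro card_mono) auto
    moreover have "card {w \<in> {1..n}. f w \<le> f v} > 0" using v by (subst card_gt_0_iff) auto
    ultimately show "r v \<in> {1..n}" using v by (auto simp: r_def)
  qed
  ultimately have "bij_betw r {1..n} {1..n}"
    by (simp add: bij_betw_def card_image card_subset_eq)
  then have r: "r permutes {1..n}"
    by (rule bij_imp_permutes) (auto simp: r_def)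
  have "key_intervals r 1 (1 + n) = key_intervals f 1 (1 + n)"
    by (rule key_intervals_order_cong) (use r_iff in auto)
  then show ?thesis
    using permutes_inv[OF r] permutes_inv_inv[OF r] by (intro exI[of _ "inv r"]) auto
qed

definition trees :: "nat \<Rightarrow> tree set" where
  "trees n = {t. proper t \<and> leaves t = n}"

lemma permutation_intervals_eq_trees:
  assumes "n \<ge> 1"
  shows "{intervals n \<sigma> | \<sigma>. \<sigma> permutes {1..n}} = (\<lambda>t. interval_sets (family t 1)) ` trees n"
proof (intro set_eqI iffI)
  fix A assume "A \<in> {intervals n \<sigma> | \<sigma>. \<sigma> permutes {1..n}}"
  then obtain \<sigma> where \<sigma>: "\<sigma> permutes {1..n}" and A: "A = intervals n \<sigma>" by blast
  have "inj_on (inv \<sigma>) {1..<1 + n}"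
    using permutes_inj[OF permutes_inv[OF \<sigma>]] by (auto intro: inj_on_subset)
  then have "\<exists>t. proper t \<and> leaves t = n \<and> key_intervals (inv \<sigma>) 1 (1 + n) = family t 1"
    using key_intervals_iff_tree[of 1 n "key_intervals (inv \<sigma>) 1 (1 + n)"] assms by blast
  then show "A \<in> (\<lambda>t. interval_sets (family t 1)) ` trees n"
    using A intervals_eq_interval_sets[OF \<sigma>] by (auto simp: trees_def)
next
  fix A assume "A \<in> (\<lambda>t. interval_sets (family t 1)) ` trees n"
  then obtain t where "proper t" "leaves t = n" and A: "A = interval_sets (family t 1)"
    by (auto simp: trees_def)
  then obtain f where "inj_on f {1..<1 + n}" "family t 1 = key_intervals f 1 (1 + n)"
    using key_intervals_iff_tree[of 1 n "family t 1"] by auto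
  then obtain \<sigma> where \<sigma>: "\<sigma> permutes {1..n}" "family t 1 = key_intervals (inv \<sigma>) 1 (1 + n)"
    using ex_permutation_of_key[of f n] by metis
  then have "A = intervals n \<sigma>" using A intervals_eq_interval_sets[OF \<sigma>(1)] by simp
  with \<sigma>(1) show "A \<in> {intervals n \<sigma> | \<sigma>. \<sigma> permutes {1..n}}" by blast
qed

lemma Field_relation_of_subset: "Field (relation_of (\<subseteq>) A) = A"
  by (auto simp: Field_def relation_of_def)

text \<open>All singletons are intervals and every interval contains one, so the minimal elements count the size.\<close>

lemma card_minimal_elements:
  assumes \<sigma>: "\<sigma> permutes {1..n}"
  shows "card (minimal_elements (interval_poset n \<sigma>)) = n"
proof -
  have sing: "{v} \<in> intervals n \<sigma> \<longleftrightarrow> v \<in> {1..n}" for v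
  proof
    assume "{v} \<in> intervals n \<sigma>"
    then obtain j h i where "{v} = {j..j + h}" "i \<ge> 1" "i + h \<le> n" "\<sigma> ` {i..i + h} = {j..j + h}"
      unfolding intervals_def by auto
    then have "v \<in> \<sigma> ` {i..i + h}" "{i..i + h} \<subseteq> {1..n}" by auto
    then show "v \<in> {1..n}" using permutes_in_image[OF \<sigma>] by blast
  next
    assume v: "v \<in> {1..n}"
    have "inv \<sigma> v \<in> {1..n}" using v permutes_in_image[OF permutes_inv[OF \<sigma>]] by blast
    then have "1 \<le> inv \<sigma> v \<and> inv \<sigma> v + 0 \<le> n \<and> \<sigma> ` {inv \<sigma> v..inv \<sigma> v + 0} = {v..v + 0}"
      using permutes_inverses[OF \<sigma>] by simp
    moreover have "{v} = {v..v + 0}" by simp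
    ultimately show "{v} \<in> intervals n \<sigma>" unfolding intervals_def by blast
  qed
  have "minimal_elements (interval_poset n \<sigma>) = (\<lambda>v. {v}) ` {1..n}"
  proof (intro set_eqI iffI)
    fix I assume "I \<in> minimal_elements (interval_poset n \<sigma>)"
    then have I: "I \<in> intervals n \<sigma>" and min: "\<And>J. J \<in> intervals n \<sigma> \<Longrightarrow> J \<subseteq> I \<Longrightarrow> J = I"
      unfolding minimal_elements_def interval_poset_def Field_relation_of_subset
      by (auto simp: relation_of_def)
    from I obtain j h i where jhi: "I = {j..j + h}" "i \<ge> 1" "i + h \<le> n" "\<sigma> ` {i..i + h} = {j..j + h}"
      unfolding intervals_def by auto
    then have "j \<in> \<sigma> ` {i..i + h}" "{i..i + h} \<subseteq> {1..n}" by auto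
    then have j: "j \<in> {1..n}" using permutes_in_image[OF \<sigma>] by blast
    then have "{j} = I" using min[of "{j}"] sing jhi by auto
    then show "I \<in> (\<lambda>v. {v}) ` {1..n}" using j by blast
  next
    fix I assume "I \<in> (\<lambda>v. {v}) ` {1..n}"
    then obtain v where v: "v \<in> {1..n}" "I = {v}" by auto
    have "J = {v}" if "J \<in> intervals n \<sigma>" "J \<subseteq> {v}" for J
    proof -
      have "J \<noteq> {}" using that(1) unfolding intervals_def by auto
      then show ?thesis using that(2) by blast
    qed
    then show "I \<in> minimal_elements (interval_poset n \<sigma>)"
      using v sing unfolding minimal_elements_def interval_poset_def Field_relation_of_subset
      by (auto simp: relation_of_def)
  qed
  then show ?thesis by (simp add: card_image)
qed

lemma inj_on_interval_sets_family: "inj_on (\<lambda>t. interval_sets (family t 1)) (trees n)"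
proof (rule inj_onI)
  fix t t' assume t: "t \<in> trees n" "t' \<in> trees n" and eq: "interval_sets (family t 1) = interval_sets (family t' 1)"
  have p: "proper t" "proper t'" using t by (auto simp: trees_def)
  have "family t 1 = family t' 1"
    using family_bounds[OF p(1), of 1] family_bounds[OF p(2), of 1]
    by (intro interval_sets_inj[OF _ _ eq]) blast+
  then show "t = t'" using family_inj p by blast
qed

text \<open>An interval poset determines its set of intervals, since that is the field of the order.\<close>

theorem num_interval_posets_eq_card_trees:
  assumes "n \<ge> 1"
  shows "num_interval_posets n = card (trees n)"
proof -
  have "{r. is_interval_poset r \<and> card (minimal_elements r) = n} =
      relation_of (\<subseteq>) ` {intervals n \<sigma> | \<sigma>. \<sigma> permutes {1..n}}"
    unfolding is_interval_poset_def using card_minimal_elements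
    by (auto simp: interval_poset_def image_iff) metis+
  also have "\<dots> = relation_of (\<subseteq>) ` (\<lambda>t. interval_sets (family t 1)) ` trees n"
    using permutation_intervals_eq_trees[OF assms] by simp
  finally have "num_interval_posets n = card (relation_of (\<subseteq>) ` (\<lambda>t. interval_sets (family t 1)) ` trees n)"
    unfolding num_interval_posets_def by simp
  also have "\<dots> = card ((\<lambda>t. interval_sets (family t 1)) ` trees n)"
    by (rule card_image) (metis Field_relation_of_subset inj_onI)
  also have "\<dots> = card (trees n)"
    by (rule card_image) (rule inj_on_interval_sets_family)
  finally show ?thesis .
qed

lemma finite_trees: "finite (trees n)"
proof (rule finite_imageD)
  show "inj_on (\<lambda>t. family t 1) (trees n)"
    using family_inj by (auto simp: inj_on_def trees_def)
  have "(\<lambda>t. family t 1) ` trees n \<subseteq> Pow ({..n + 1} \<times> {..n + 1})"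
  proof clarify
    fix t u v assume t: "t \<in> trees n" "(u, v) \<in> family t 1"
    then have "u < v \<and> v \<le> 1 + n" using family_bounds[of t 1] by (auto simp: trees_def)
    then show "u \<in> {..n + 1} \<and> v \<in> {..n + 1}" by auto
  qed
  then show "finite ((\<lambda>t. family t 1) ` trees n)" by (rule finite_subset) auto
qed

section \<open>The functional equation\<close>

definition forests :: "nat \<Rightarrow> nat \<Rightarrow> tree list set" where
  "forests k n = {ts. length ts = k \<and> (\<forall>t\<in>set ts. proper t) \<and> sum_list (map leaves ts) = n}"

definition tree_gf :: "complex fps" where
  "tree_gf = Abs_fps (\<lambda>n. of_nat (card (trees n)))"

lemma trees_0: "trees 0 = {}"
  using leaves_pos by (force simp: trees_def)

lemma tree_gf_0: "fps_nth tree_gf 0 = 0"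
  by (simp add: tree_gf_def trees_0)

lemma card_forests: "finite (forests k n) \<and> of_nat (card (forests k n)) = fps_nth (tree_gf ^ k) n"
proof (induction k arbitrary: n)
  case 0
  have "forests 0 n = (if n = 0 then {[]} else {})" by (auto simp: forests_def)
  then show ?case by simp
next
  case (Suc k)
  let ?A = "\<lambda>i. (\<lambda>(t, ts). t # ts) ` (trees i \<times> forests k (n - i))"
  have eq: "forests (Suc k) n = (\<Union>i\<in>{0..n}. ?A i)"
  proof (intro set_eqI iffI)
    fix ts assume "ts \<in> forests (Suc k) n"
    then obtain t us where "ts = t # us" "length us = k" "proper t" "\<forall>t\<in>set us. proper t"
        "leaves t + sum_list (map leaves us) = n"
      unfolding forests_def by (cases ts) auto
    then show "ts \<in> (\<Union>i\<in>{0..n}. ?A i)"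
      by (intro UN_I[of "leaves t"]) (auto simp: trees_def forests_def)
  qed (auto simp: trees_def forests_def)
  have fin: "finite (?A i)" for i using finite_trees Suc.IH by auto
  have disj: "\<forall>i\<in>{0..n}. \<forall>j\<in>{0..n}. i \<noteq> j \<longrightarrow> ?A i \<inter> ?A j = {}"
    by (auto simp: trees_def)
  have card_A: "card (?A i) = card (trees i) * card (forests k (n - i))" for i
    by (subst card_image) (auto simp: inj_on_def card_cartesian_product)
  have "of_nat (card (forests (Suc k) n)) = (\<Sum>i=0..n. of_nat (card (trees i)) * (of_nat (card (forests k (n - i))) :: complex))"
    unfolding eq using fin disj by (subst card_UN_disjoint) (auto simp: card_A)
  also have "\<dots> = (\<Sum>i=0..n. fps_nth tree_gf i * fps_nth (tree_gf ^ k) (n - i))"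
    using Suc.IH by (simp add: tree_gf_def)
  also have "\<dots> = fps_nth (tree_gf ^ Suc k) n" by (simp add: fps_mult_nth)
  finally show ?case using fin unfolding eq by auto
qed

text \<open>Since every leaf counts, only forests with at most \<open>n\<close> trees contribute; summing up to \<open>n + 4\<close> adds zero
terms and keeps both ranges nonempty.\<close>

lemma card_trees:
  "of_nat (card (trees n)) = fps_nth (fps_X + (\<Sum>k=2..n+4. tree_gf ^ k) + (\<Sum>k=4..n+4. tree_gf ^ k)) n"
proof -
  have len: "length ts \<le> n" if "ts \<in> forests k n" for ts k
  proof -
    have "length ts = sum_list (map (\<lambda>_. 1) ts)" by (simp add: sum_list_triv)
    also have "\<dots> \<le> sum_list (map leaves ts)"
      using that leaves_pos by (intro sum_list_mono) (auto simp: forests_def)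
    finally show ?thesis using that by (simp add: forests_def)
  qed
  let ?A = "\<Union>k\<in>{2..n+4}. Node False ` forests k n" and ?B = "\<Union>k\<in>{4..n+4}. Node True ` forests k n"
  let ?L = "if n = 1 then {Leaf} else {}"
  have "trees n = ?L \<union> ?A \<union> ?B"
  proof (intro set_eqI iffI)
    fix t assume t: "t \<in> trees n"
    show "t \<in> ?L \<union> ?A \<union> ?B"
    proof (cases t)
      case (Node s ts)
      then have ts: "ts \<in> forests (length ts) n" using t by (auto simp: trees_def forests_def)
      then show ?thesis using len[OF ts] Node t by (cases s) (auto simp: trees_def)
    qed (use t in \<open>auto simp: trees_def\<close>)
  qed (auto simp: trees_def forests_def split: if_splits)
  moreover have "finite ?A" "finite ?B" "finite ?L" using card_forests by auto
  moreover have "?L \<inter> ?A = {}" "(?L \<union> ?A) \<inter> ?B = {}" by auto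
  ultimately have "card (trees n) = card ?L + card ?A + card ?B"
    by (simp add: card_Un_disjoint)
  moreover have "card (\<Union>k\<in>{m..n+4}. Node s ` forests k n) = (\<Sum>k=m..n+4. card (forests k n))" for m s
  proof (subst card_UN_disjoint)
    show "(\<Sum>k=m..n+4. card (Node s ` forests k n)) = (\<Sum>k=m..n+4. card (forests k n))"
      by (intro sum.cong refl card_image) (auto simp: inj_on_def)
  qed (use card_forests in \<open>auto simp: forests_def\<close>)
  ultimately have "card (trees n) = (if n = 1 then 1 else 0) + (\<Sum>k=2..n+4. card (forests k n)) + (\<Sum>k=4..n+4. card (forests k n))"
    by simp
  then show ?thesis
    using card_forests by (simp add: fps_sum_nth del: sum.cl_ivl_Suc)
qed

lemma fps_mult_nth_cong:
  assumes "\<And>i. i \<le> n \<Longrightarrow> fps_nth g i = fps_nth h i"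
  shows "fps_nth (f * g) n = fps_nth (f * h) n"
  using assms by (simp add: fps_mult_nth)

text \<open>The sums of powers are geometric, and in degree \<open>n\<close> their truncation is invisible.\<close>

lemma tree_gf_equation: "(1 - tree_gf) * (tree_gf - fps_X) = tree_gf ^ 2 + tree_gf ^ 4"
proof (rule fps_ext)
  fix n
  let ?T = tree_gf
  let ?S = "(\<Sum>k=2..n+4. ?T ^ k) + (\<Sum>k=4..n+4. ?T ^ k)"
  have zero: "fps_nth (?T ^ k) m = 0" if "m < k" for k m
    using startsby_zero_power_prefix[OF tree_gf_0] that by blast
  have cut: "fps_nth (\<Sum>k=j..m+4. ?T ^ k) m = fps_nth (\<Sum>k=j..n+4. ?T ^ k) m" if "m \<le> n" for m j
    unfolding fps_sum_nth using that zero by (intro sum.mono_neutral_left) auto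
  have "fps_nth (?T - fps_X) m = fps_nth ?S m" if "m \<le> n" for m
  proof -
    have "fps_nth ?T m = of_nat (card (trees m))" by (simp add: tree_gf_def)
    also have "\<dots> = fps_nth (fps_X + (\<Sum>k=2..m+4. ?T ^ k) + (\<Sum>k=4..m+4. ?T ^ k)) m"
      by (rule card_trees)
    also have "\<dots> = fps_nth (fps_X + ?S) m" using cut[OF that] by (simp add: add.assoc)
    finally show ?thesis by simp
  qed
  then have "fps_nth ((1 - ?T) * (?T - fps_X)) n = fps_nth ((1 - ?T) * ?S) n"
    by (rule fps_mult_nth_cong)
  also have "(1 - ?T) * ?S = ?T ^ 2 + ?T ^ 4 - 2 * ?T ^ Suc (n + 4)"
    using sum_gp_multiplied[of 2 "n+4" ?T] sum_gp_multiplied[of 4 "n+4" ?T]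
    by (simp only: distrib_left) (simp del: sum.cl_ivl_Suc power_Suc)
  also have "fps_nth (2 * ?T ^ Suc (n + 4)) n = (0 :: complex)"
    by (simp add: numeral_fps_const zero del: power_Suc)
  then have "fps_nth (?T ^ 2 + ?T ^ 4 - 2 * ?T ^ Suc (n + 4)) n = fps_nth (?T ^ 2 + ?T ^ 4) n" by simp
  finally show "fps_nth ((1 - ?T) * (?T - fps_X)) n = fps_nth (?T ^ 2 + ?T ^ 4) n" .
qed

lemma interval_poset_gf_eq_tree_gf: "interval_poset_gf = tree_gf"
  by (rule fps_ext) (auto simp: interval_poset_gf_def tree_gf_def num_interval_posets_eq_card_trees trees_0
    not_le simp flip: not_less_eq_eq)

theorem interval_poset_gf_equation:
  "(1 - interval_poset_gf) * (interval_poset_gf - fps_X) = interval_poset_gf ^ 2 + interval_poset_gf ^ 4"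
  unfolding interval_poset_gf_eq_tree_gf by (rule tree_gf_equation)

section \<open>The saddle point\<close>

text \<open>Comparing \<open>sin (\<pi> / 6) = 1 / 2\<close> with Taylor sums at \<open>3.14 / 6\<close> and \<open>3.142 / 6\<close>.\<close>

lemma pi_between: "3.14 < pi" "pi < 3.142"
proof -
  have bound: "\<bar>sin x - (x - x ^ 3 / 6 + x ^ 5 / 120 - x ^ 7 / 5040)\<bar> \<le> \<bar>x\<bar> ^ 8 / 40320" for x :: real
  proof -
    have "(\<Sum>m<8. sin_coeff m * x ^ m) = x - x ^ 3 / 6 + x ^ 5 / 120 - x ^ 7 / 5040"
      by (simp add: sin_coeff_def lessThan_nat_numeral pred_numeral_simps fact_numeral)
    then have "\<bar>sin x - (x - x ^ 3 / 6 + x ^ 5 / 120 - x ^ 7 / 5040)\<bar> \<le> inverse (fact 8) * \<bar>x\<bar> ^ 8"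
      using Maclaurin_sin_bound[of x 8] by (simp only:)
    also have "fact 8 = (40320 :: real)" by (simp add: fact_numeral)
    also have "inverse 40320 * \<bar>x\<bar> ^ 8 = \<bar>x\<bar> ^ 8 / 40320" by (simp only: divide_inverse mult.commute)
    finally show ?thesis .
  qed
  have upper: "sin x \<le> x - x ^ 3 / 6 + x ^ 5 / 120 - x ^ 7 / 5040 + \<bar>x\<bar> ^ 8 / 40320"
    and lower: "x - x ^ 3 / 6 + x ^ 5 / 120 - x ^ 7 / 5040 - \<bar>x\<bar> ^ 8 / 40320 \<le> sin x" for x :: real
    using bound[of x] by linarith+
  have half: "sin (pi / 6) = 1 / 2" by (rule sin_30)
  have pi: "2 \<le> pi" "pi < 4" using pi_ge_two pi_less_4 by auto
  have "sin (3.14 / 6 :: real) < 1 / 2"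
    using upper[of "3.14 / 6"] by (simp add: power_numeral_reduce)
  then have "sin (3.14 / 6) < sin (pi / 6)" using half by simp
  then show "3.14 < pi"
    using sin_le_zero sin_monotone_2pi_le[of "pi / 6" "3.14 / 6"] pi by (cases "pi \<le> 3.14") auto
  have "sin (3.142 / 6 :: real) > 1 / 2"
    using lower[of "3.142 / 6"] by (simp add: power_numeral_reduce)
  then have "sin (pi / 6) < sin (3.142 / 6)" using half by simp
  then show "pi < 3.142"
    using sin_monotone_2pi_le[of "3.142 / 6" "pi / 6"] pi by (cases "3.142 \<le> pi") auto
qed

text \<open>A quadratic bound on the whole period: the Taylor remainder \<open>x\<^sup>4 / 24\<close> costs at most \<open>10 / 24\<close> of \<open>x\<^sup>2\<close> because
\<open>\<pi>\<^sup>2 < 10\<close>.\<close>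

lemma one_minus_cos_ge:
  fixes x :: real
  assumes "\<bar>x\<bar> \<le> pi"
  shows "x ^ 2 / 12 \<le> 1 - cos x"
proof -
  obtain t where t: "cos x = (\<Sum>m<4. cos_coeff m * x ^ m) + cos (t + 1 / 2 * real 4 * pi) / fact 4 * x ^ 4"
    using Maclaurin_cos_expansion[of x 4] by blast
  have "cos (t + 1 / 2 * real 4 * pi) / fact 4 * x ^ 4 \<le> 1 / 24 * x ^ 4"
    by (intro mult_right_mono) (auto simp: fact_numeral)
  moreover have "(\<Sum>m<4. cos_coeff m * x ^ m) = 1 - x ^ 2 / 2"
    by (simp add: cos_coeff_def lessThan_nat_numeral pred_numeral_simps fact_numeral)
  ultimately have c: "cos x \<le> 1 - x ^ 2 / 2 + x ^ 2 * x ^ 2 / 24" using t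
    by (simp add: power_numeral_reduce)
  have "\<bar>x\<bar> ^ 2 \<le> 3.142 ^ 2"
    using assms pi_between by (intro power_mono) auto
  then have "x ^ 2 \<le> 10" by (simp add: power2_eq_square)
  then have "x ^ 2 * x ^ 2 \<le> x ^ 2 * 10" by (intro mult_left_mono) auto
  with c show ?thesis by simp
qed

text \<open>The numerator of \<open>1 - \<Lambda>'(u)\<close> over the denominator \<open>(1 - u)\<^sup>2\<close>.\<close>

definition critical_poly :: "real \<Rightarrow> real" where
  "critical_poly u = 3 * u ^ 4 - 4 * u ^ 3 + 2 * u ^ 2 - 4 * u + 1"

lemma critical_poly_strict_antimono:
  assumes "0 \<le> u" "u < v" "v \<le> 1"
  shows "critical_poly v < critical_poly u"
proof (rule DERIV_neg_imp_decreasing_open[OF assms(2)])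
  show "continuous_on {u..v} critical_poly"
    unfolding critical_poly_def by (intro continuous_intros)
  fix x assume x: "u < x" "x < v"
  have "(critical_poly has_real_derivative (12 * x ^ 2 + 4) * (x - 1)) (at x)"
    unfolding critical_poly_def by (auto intro!: derivative_eq_intros simp: algebra_simps power_numeral_reduce)
  moreover have "(12 * x ^ 2 + 4) * (x - 1) < 0"
    using x assms by (intro mult_pos_neg) (auto intro: add_nonneg_pos)
  ultimately show "\<exists>y. (critical_poly has_real_derivative y) (at x) \<and> y < 0" by blast
qed

lemma deriv_Lambda: "u < 1 \<Longrightarrow> deriv \<Lambda> u = 1 - critical_poly u / (1 - u) ^ 2"
proof (rule DERIV_imp_deriv)
  assume u: "u < 1"
  then have nz: "1 - u \<noteq> 0" by simp
  have eq: "((2 * u + 4 * u ^ 3) * (1 - u) + (u ^ 2 + u ^ 4)) / ((1 - u) * (1 - u)) = 1 - critical_poly u / (1 - u) ^ 2"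
    using nz unfolding critical_poly_def
    by (simp add: divide_simps power2_eq_square) (simp add: algebra_simps power_numeral_reduce)
  have "((\<lambda>u. (u ^ 2 + u ^ 4) / (1 - u)) has_real_derivative
      ((2 * u + 4 * u ^ 3) * (1 - u) + (u ^ 2 + u ^ 4)) / ((1 - u) * (1 - u))) (at u)"
    using nz by (auto intro!: derivative_eq_intros)
  then show "(\<Lambda> has_real_derivative 1 - critical_poly u / (1 - u) ^ 2) (at u)"
    unfolding eq \<Lambda>_def[abs_def] .
qed

lemma second_deriv_Lambda:
  assumes u: "u < 1" and crit: "critical_poly u = 0"
  shows "(deriv ^^ 2) \<Lambda> u = (12 * u ^ 2 + 4) / (1 - u)"
proof -
  have "eventually (\<lambda>v. v \<in> {..<1}) (nhds u)" using u by (intro eventually_nhds_in_open) auto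
  then have "eventually (\<lambda>v. deriv \<Lambda> v = 1 - critical_poly v / (1 - v) ^ 2) (nhds u)"
    by eventually_elim (auto simp: deriv_Lambda)
  then have "deriv (deriv \<Lambda>) u = deriv (\<lambda>v. 1 - critical_poly v / (1 - v) ^ 2) u"
    by (rule deriv_cong_ev) simp
  also have "\<dots> = (12 * u ^ 2 + 4) / (1 - u)"
  proof (rule DERIV_imp_deriv)
    have d: "(critical_poly has_real_derivative (12 * u ^ 2 + 4) * (u - 1)) (at u)"
      unfolding critical_poly_def by (auto intro!: derivative_eq_intros simp: algebra_simps power_numeral_reduce)
    have nz: "1 - u \<noteq> 0" using u by simp
    have "((\<lambda>v. (1 - v) ^ 2) has_real_derivative - 2 * (1 - u)) (at u)"
      by (auto intro!: derivative_eq_intros)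
    from DERIV_divide[OF d this]
    have "((\<lambda>v. critical_poly v / (1 - v) ^ 2) has_real_derivative
        ((12 * u ^ 2 + 4) * (u - 1)) / (1 - u) ^ 2) (at u)"
      using nz by (simp add: crit power2_eq_square)
    from DERIV_diff[OF DERIV_const this, of 1]
    have "((\<lambda>v. 1 - critical_poly v / (1 - v) ^ 2) has_real_derivative
        - (((12 * u ^ 2 + 4) * (u - 1)) / (1 - u) ^ 2)) (at u)" by simp
    moreover have "- (((12 * u ^ 2 + 4) * (u - 1)) / (1 - u) ^ 2) = (12 * u ^ 2 + 4) / (1 - u)"
      using nz by (simp add: divide_simps power2_eq_square) (simp add: algebra_simps)
    ultimately show "((\<lambda>v. 1 - critical_poly v / (1 - v) ^ 2) has_real_derivative (12 * u ^ 2 + 4) / (1 - u)) (at u)"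
      by simp
  qed
  finally show ?thesis by (simp add: numeral_2_eq_2)
qed

lemma deriv_Lambda_eq_1_iff: "u \<in> {0<..<1} \<Longrightarrow> deriv \<Lambda> u = 1 \<longleftrightarrow> critical_poly u = 0"
  by (simp add: deriv_Lambda)

lemma critical_poly_sign: "critical_poly 0.270846 > 0" "critical_poly 0.2708463 < 0"
  by (simp_all add: critical_poly_def power_numeral_reduce)

lemma ex1_critical_point: "\<exists>!u. u \<in> {0<..<1} \<and> deriv \<Lambda> u = 1"
proof -
  have "\<exists>u\<ge>0.270846. u \<le> 0.2708463 \<and> critical_poly u = 0"
    using critical_poly_sign
    by (intro IVT2') (auto simp: critical_poly_def[abs_def] intro!: continuous_intros)
  then obtain u where b: "0.270846 \<le> u" "u \<le> 0.2708463" and c: "critical_poly u = 0" by blast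
  have u: "u \<in> {0<..<1}" "critical_poly u = 0" using b c by simp_all
  have uniq: "v = u" if "v \<in> {0<..<1}" "critical_poly v = 0" for v
    using critical_poly_strict_antimono[of u v] critical_poly_strict_antimono[of v u] u that
    by (cases u v rule: linorder_cases) auto
  show ?thesis
  proof (rule ex1I[of _ u])
    show "u \<in> {0<..<1} \<and> deriv \<Lambda> u = 1" using u deriv_Lambda_eq_1_iff[OF u(1)] by blast
    fix v assume v: "v \<in> {0<..<1} \<and> deriv \<Lambda> v = 1"
    then show "v = u" using uniq[of v] deriv_Lambda_eq_1_iff[of v] by blast
  qed
qed

locale saddle_point =
  fixes \<tau> \<rho> :: real
  assumes tau_in: "\<tau> \<in> {0<..<1}" and crit: "critical_poly \<tau> = 0"
    and rho_eq_Lambda: "\<rho> = \<tau> - \<Lambda> \<tau>"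
begin

lemma tau_gt: "0.270846 < \<tau>"
proof (rule ccontr)
  assume "\<not> 0.270846 < \<tau>"
  then consider "\<tau> = 0.270846" | "\<tau> < 0.270846" by linarith
  then show False
    using critical_poly_strict_antimono[of \<tau> "0.270846"] critical_poly_sign(1) crit tau_in by cases auto
qed

lemma tau_lt: "\<tau> < 0.2708463"
proof (rule ccontr)
  assume "\<not> \<tau> < 0.2708463"
  then consider "\<tau> = 0.2708463" | "0.2708463 < \<tau>" by linarith
  then show False
    using critical_poly_strict_antimono[of "0.2708463" \<tau>] critical_poly_sign(2) crit tau_in by cases auto
qed

lemma tau_pos: "0 < \<tau>" using tau_in by simp

text \<open>Reducing \<open>\<rho>\<close> modulo the critical polynomial. Together the two equations say that \<open>\<tau>\<close> is a double root of
\<open>u\<^sup>4 + 2 u\<^sup>2 - (1 + \<rho>) u + \<rho>\<close>.\<close>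

lemma rho_eq: "\<rho> = 2 * \<tau> ^ 2 + 3 * \<tau> ^ 4" and one_plus_rho_eq: "1 + \<rho> = 4 * \<tau> + 4 * \<tau> ^ 3"
proof -
  have c: "3 * \<tau> ^ 4 - 4 * \<tau> ^ 3 + 2 * \<tau> ^ 2 - 4 * \<tau> + 1 = 0" using crit by (simp add: critical_poly_def)
  have "\<rho> * (1 - \<tau>) = \<tau> * (1 - \<tau>) - (\<tau> ^ 2 + \<tau> ^ 4)"
    using tau_in unfolding rho_eq_Lambda \<Lambda>_def by (simp add: field_simps)
  also have "\<dots> = (2 * \<tau> ^ 2 + 3 * \<tau> ^ 4) * (1 - \<tau>) - \<tau> * (3 * \<tau> ^ 4 - 4 * \<tau> ^ 3 + 2 * \<tau> ^ 2 - 4 * \<tau> + 1) * (- 1)"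
    by (simp add: algebra_simps power_numeral_reduce)
  finally show "\<rho> = 2 * \<tau> ^ 2 + 3 * \<tau> ^ 4" using c tau_in by simp
  then show "1 + \<rho> = 4 * \<tau> + 4 * \<tau> ^ 3" using c by simp
qed

lemma rho_gt: "0.162858 < \<rho>" and rho_lt: "\<rho> < 0.1628596"
proof -
  have "0.270846 ^ 2 < \<tau> ^ 2" "0.270846 ^ 4 < \<tau> ^ 4" "\<tau> ^ 2 < 0.2708463 ^ 2" "\<tau> ^ 4 < 0.2708463 ^ 4"
    using tau_gt tau_lt by (intro power_strict_mono; simp)+
  then show "0.162858 < \<rho>" "\<rho> < 0.1628596" unfolding rho_eq by (simp_all add: power_numeral_reduce)
qed

lemma rho_pos: "0 < \<rho>" using rho_gt by simp

text \<open>Half of \<open>\<Lambda>''(\<tau>)\<close>, simplified by the critical equation.\<close>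

definition \<gamma> :: real where "\<gamma> = (6 * \<tau> ^ 2 + 2) / (1 - \<tau>)"

lemma Lambda''_eq: "(deriv ^^ 2) \<Lambda> \<tau> = 2 * \<gamma>"
  using second_deriv_Lambda[OF _ crit] tau_in by (simp add: \<gamma>_def algebra_simps)

lemma gamma_gt: "3.3465 < \<gamma>" and gamma_lt: "\<gamma> < 3.3466"
proof -
  have t: "0.270846 ^ 2 < \<tau> ^ 2" "\<tau> ^ 2 < 0.2708463 ^ 2"
    using tau_gt tau_lt by (intro power_strict_mono; simp)+
  show "3.3465 < \<gamma>" "\<gamma> < 3.3466"
    unfolding \<gamma>_def using t tau_gt tau_lt by (simp_all add: field_simps power_numeral_reduce)
qed

lemma gamma_pos: "0 < \<gamma>" using gamma_gt by simp

lemma abs_diff_le_of_bounds: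
  fixes x :: real
  shows "l \<le> x \<Longrightarrow> x \<le> u \<Longrightarrow> m - e \<le> l \<Longrightarrow> u \<le> m + e \<Longrightarrow> \<bar>x - m\<bar> \<le> e"
  by linarith

lemma numerics:
  "\<bar>\<tau> - 0.2708\<bar> \<le> 0.00005" "\<bar>\<rho> - 0.1629\<bar> \<le> 0.00005"
  "\<bar>sqrt (2 * \<rho> / (2 * \<gamma>)) - 0.2206\<bar> \<le> 0.00005"
  "\<bar>sqrt (\<rho> / (2 * pi * (2 * \<gamma>))) - 0.0622\<bar> \<le> 0.00005"
  "\<bar>inverse \<rho> - 6.1403\<bar> \<le> 0.00005"
proof -
  show "\<bar>\<tau> - 0.2708\<bar> \<le> 0.00005" using tau_gt tau_lt by simp
  show "\<bar>\<rho> - 0.1629\<bar> \<le> 0.00005" using rho_gt rho_lt by simp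
  have "0.22055 ^ 2 \<le> 2 * \<rho> / (2 * \<gamma>)" "2 * \<rho> / (2 * \<gamma>) \<le> 0.22065 ^ 2"
    using rho_gt rho_lt gamma_gt gamma_lt by (simp_all add: field_simps power2_eq_square)
  then have "0.22055 \<le> sqrt (2 * \<rho> / (2 * \<gamma>))" "sqrt (2 * \<rho> / (2 * \<gamma>)) \<le> 0.22065"
    by (intro real_le_rsqrt real_le_lsqrt; simp)+
  then show "\<bar>sqrt (2 * \<rho> / (2 * \<gamma>)) - 0.2206\<bar> \<le> 0.00005"
    by (rule abs_diff_le_of_bounds) simp_all
  have "3.14 * 3.3465 \<le> pi * \<gamma>" "pi * \<gamma> \<le> 3.142 * 3.3466"
    using pi_between gamma_gt gamma_lt by (intro mult_mono; simp)+
  then have "0.06215 ^ 2 \<le> \<rho> / (4 * (pi * \<gamma>))" "\<rho> / (4 * (pi * \<gamma>)) \<le> 0.06225 ^ 2"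
    using rho_gt rho_lt gamma_pos pi_gt_zero by (simp_all add: divide_simps power2_eq_square)
  then have "0.06215 \<le> sqrt (\<rho> / (4 * (pi * \<gamma>)))" "sqrt (\<rho> / (4 * (pi * \<gamma>))) \<le> 0.06225"
    by (intro real_le_rsqrt real_le_lsqrt; simp)+
  moreover have "2 * pi * (2 * \<gamma>) = 4 * (pi * \<gamma>)" by simp
  ultimately have "0.06215 \<le> sqrt (\<rho> / (2 * pi * (2 * \<gamma>)))" "sqrt (\<rho> / (2 * pi * (2 * \<gamma>))) \<le> 0.06225"
    by simp_all
  then show "\<bar>sqrt (\<rho> / (2 * pi * (2 * \<gamma>))) - 0.0622\<bar> \<le> 0.00005"
    by (rule abs_diff_le_of_bounds) simp_all
  have "6.14025 \<le> inverse \<rho>" "inverse \<rho> \<le> 6.14035"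
    using rho_gt rho_lt by (simp_all add: field_simps)
  then show "\<bar>inverse \<rho> - 6.1403\<bar> \<le> 0.00005"
    by (rule abs_diff_le_of_bounds) simp_all
qed

end

section \<open>Lagrange inversion\<close>

text \<open>With \<open>\<psi> = X q\<close> and \<open>\<phi> = 1 / q\<close>, the derivative of \<open>P \<circ> \<psi> = X\<close> gives \<open>1 = (\<Sum>i. (i + 1) p\<^bsub>i+1\<^esub> \<psi>\<^sup>i) \<psi>'\<close>. Multiply by \<open>\<phi>\<^sup>n\<close>
and compare coefficients of \<open>X\<^sup>n\<^sup>-\<^sup>1\<close>: as \<open>\<psi> \<phi> = X\<close>, the \<open>i\<close>-th term contributes the coefficient of degree \<open>k - 1\<close> in
\<open>\<phi>\<^sup>k \<psi>'\<close> with \<open>k = n - i\<close>. For \<open>k \<ge> 2\<close> this series is \<open>\<phi>\<^sup>k\<^sup>-\<^sup>1\<close> minus \<open>X / (k - 1)\<close> times its derivative, whose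
coefficient of degree \<open>k - 1\<close> cancels. Only \<open>i = n - 1\<close> remains.\<close>

lemma fps_lagrange_inversion:
  fixes P q :: "'a :: field_char_0 fps"
  assumes P0: "fps_nth P 0 = 0" and q0: "fps_nth q 0 \<noteq> 0" and inv: "(fps_X * q) oo P = fps_X" and n: "n \<ge> 1"
  shows "of_nat n * fps_nth P n = fps_nth (inverse q ^ n) (n - 1)"
proof -
  define \<psi> where "\<psi> = fps_X * q"
  define \<phi> where "\<phi> = inverse q"
  have \<psi>0: "fps_nth \<psi> 0 = 0" and \<psi>1: "fps_nth \<psi> 1 \<noteq> 0" using q0 by (simp_all add: \<psi>_def)
  have q\<phi>: "q * \<phi> = 1" using q0 by (simp add: \<phi>_def inverse_mult_eq_1')
  have "P = (fps_inv \<psi> oo \<psi>) oo P" using P0 fps_inv[OF \<psi>0 \<psi>1] by simp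
  also have "\<dots> = fps_inv \<psi> oo (\<psi> oo P)" by (rule fps_compose_assoc[OF P0 \<psi>0, symmetric])
  also have "\<dots> = fps_inv \<psi>" using inv by (simp add: \<psi>_def)
  finally have "P oo \<psi> = fps_X" using fps_inv[OF \<psi>0 \<psi>1] by simp
  then have D: "(fps_deriv P oo \<psi>) * fps_deriv \<psi> = 1"
    using fps_compose_deriv[OF \<psi>0, of P] by simp
  define R where "R = (\<Sum>i<n. fps_const (fps_nth (fps_deriv P) i) * \<psi> ^ i)"
  have R: "fps_nth (fps_deriv P oo \<psi>) j = fps_nth R j" if "j \<le> n - 1" for j
  proof -
    have "fps_nth (fps_deriv P oo \<psi>) j = (\<Sum>i=0..j. fps_nth (fps_deriv P) i * fps_nth (\<psi> ^ i) j)"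
      by (rule fps_compose_nth)
    also have "\<dots> = (\<Sum>i<n. fps_nth (fps_deriv P) i * fps_nth (\<psi> ^ i) j)"
      using that n startsby_zero_power_prefix[OF \<psi>0] by (intro sum.mono_neutral_left) auto
    finally show ?thesis by (simp add: R_def fps_sum_nth)
  qed
  have key: "fps_nth (\<phi> ^ k * fps_deriv \<psi>) (k - 1) = (if k = 1 then 1 else 0)" if k: "k \<ge> 1" for k
  proof (cases "k = 1")
    case True
    have "fps_nth (q * \<phi>) 0 = 1" using q\<phi> by simp
    then show ?thesis using True by (simp add: \<psi>_def mult.commute)
  next
    case False
    define m where "m = k - 2"
    have m: "k = Suc (Suc m)" using k False by (simp add: m_def)
    have "fps_deriv \<psi> = q + fps_X * fps_deriv q" by (simp add: \<psi>_def)
    then have "\<phi> ^ k * fps_deriv \<psi> = \<phi> ^ Suc m * (q * \<phi>) + fps_X * (\<phi> ^ m * (fps_deriv q * \<phi> ^ 2))"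
      by (simp add: m algebra_simps power2_eq_square)
    also have "fps_deriv q * \<phi> ^ 2 = - fps_deriv \<phi>"
      unfolding \<phi>_def using fps_inverse_deriv[OF q0] by simp
    finally have e: "\<phi> ^ k * fps_deriv \<psi> = \<phi> ^ Suc m - fps_X * (\<phi> ^ m * fps_deriv \<phi>)" using q\<phi> by simp
    have "fps_deriv (\<phi> ^ Suc m) = fps_const (of_nat (Suc m)) * (\<phi> ^ m * fps_deriv \<phi>)"
      by (simp add: fps_deriv_power mult_ac del: power_Suc)
    then have "fps_nth (fps_deriv (\<phi> ^ Suc m)) m = of_nat (Suc m) * fps_nth (\<phi> ^ m * fps_deriv \<phi>) m"
      by (metis fps_mult_left_const_nth)
    then have "of_nat (Suc m) * fps_nth (\<phi> ^ Suc m) (Suc m) = of_nat (Suc m) * fps_nth (\<phi> ^ m * fps_deriv \<phi>) m"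
      by (simp del: power_Suc of_nat_Suc)
    then have "fps_nth (\<phi> ^ Suc m) (Suc m) = fps_nth (\<phi> ^ m * fps_deriv \<phi>) m"
      by (simp del: power_Suc of_nat_Suc)
    then show ?thesis using e m False by (simp del: power_Suc)
  qed
  have shift: "\<phi> ^ n * \<psi> ^ i = fps_X ^ i * \<phi> ^ (n - i)" if "i < n" for i
  proof -
    have "\<phi> ^ n = \<phi> ^ i * \<phi> ^ (n - i)" using that by (simp flip: power_add)
    then have "\<phi> ^ n * \<psi> ^ i = fps_X ^ i * (q * \<phi>) ^ i * \<phi> ^ (n - i)"
      by (simp add: \<psi>_def power_mult_distrib mult_ac)
    then show ?thesis using q\<phi> by simp
  qed
  have coeff: "fps_nth (\<phi> ^ n * fps_deriv \<psi> * \<psi> ^ i) (n - 1) = (if i = n - 1 then 1 else 0)" if i: "i < n" for i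
  proof -
    have "\<phi> ^ n * fps_deriv \<psi> * \<psi> ^ i = \<phi> ^ n * \<psi> ^ i * fps_deriv \<psi>" by (simp only: mult_ac)
    also have "\<dots> = fps_X ^ i * (\<phi> ^ (n - i) * fps_deriv \<psi>)" by (simp only: shift[OF i] mult.assoc)
    also have "fps_nth \<dots> (n - 1) = fps_nth (\<phi> ^ (n - i) * fps_deriv \<psi>) (n - i - 1)"
      using i by (simp add: fps_X_power_mult_nth)
    finally have "fps_nth (\<phi> ^ n * fps_deriv \<psi> * \<psi> ^ i) (n - 1) = fps_nth (\<phi> ^ (n - i) * fps_deriv \<psi>) (n - i - 1)" .
    then show ?thesis using key[of "n - i"] i by auto
  qed
  have "fps_nth (\<phi> ^ n) (n - 1) = fps_nth (\<phi> ^ n * fps_deriv \<psi> * (fps_deriv P oo \<psi>)) (n - 1)"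
  proof -
    have "\<phi> ^ n * fps_deriv \<psi> * (fps_deriv P oo \<psi>) = \<phi> ^ n * ((fps_deriv P oo \<psi>) * fps_deriv \<psi>)"
      by (simp only: mult_ac)
    then show ?thesis by (simp only: D mult_1_right)
  qed
  also have "\<dots> = fps_nth (\<phi> ^ n * fps_deriv \<psi> * R) (n - 1)"
    unfolding fps_mult_nth[of "\<phi> ^ n * fps_deriv \<psi>"] using R by (intro sum.cong) auto
  also have "\<phi> ^ n * fps_deriv \<psi> * R = (\<Sum>i<n. fps_const (fps_nth (fps_deriv P) i) * (\<phi> ^ n * fps_deriv \<psi> * \<psi> ^ i))"
    by (simp add: R_def sum_distrib_left mult_ac)
  also have "fps_nth \<dots> (n - 1) = (\<Sum>i<n. fps_nth (fps_deriv P) i * (if i = n - 1 then 1 else 0))"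
    by (simp only: fps_sum_nth fps_mult_left_const_nth) (rule sum.cong, use coeff in auto)
  also have "\<dots> = fps_nth (fps_deriv P) (n - 1)"
    using n by (simp add: if_distrib[of "(*) _"] cong: if_cong)
  also have "\<dots> = of_nat n * fps_nth P n" using n by simp
  finally show ?thesis by (simp add: \<phi>_def)
qed

section \<open>Laplace's method\<close>

lemma gaussian_integral:
  assumes b: "b > 0"
  shows "(\<integral>t. exp (- b * t ^ 2) \<partial>lborel) = sqrt (pi / b)"
proof -
  define \<sigma> where "\<sigma> = 1 / sqrt (2 * b)"
  have \<sigma>: "\<sigma> > 0" "\<sigma> ^ 2 = 1 / (2 * b)" using b by (simp_all add: \<sigma>_def power_divide)
  have nd: "normal_density 0 \<sigma> t = exp (- b * t ^ 2) / sqrt (pi / b)" for t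
    using b unfolding normal_density_def \<sigma>(2) by (simp add: field_simps)
  have "1 = (\<integral>t. exp (- b * t ^ 2) / sqrt (pi / b) \<partial>lborel)"
    using integral_normal_density[OF \<sigma>(1), of 0] unfolding nd by (rule sym)
  also have "\<dots> = (\<integral>t. exp (- b * t ^ 2) \<partial>lborel) / sqrt (pi / b)" by simp
  finally have "1 = (\<integral>t. exp (- b * t ^ 2) \<partial>lborel) / sqrt (pi / b)" .
  moreover have "sqrt (pi / b) \<noteq> 0" using b by simp
  ultimately show ?thesis by (metis eq_divide_eq mult_1)
qed

lemma integrable_inverse_1_plus_mult_square:
  assumes "c > 0"
  shows "integrable lborel (\<lambda>t::real. inverse (1 + c * t ^ 2))"
proof -
  have "einterval (-\<infinity>) \<infinity> = UNIV" by (auto simp: einterval_def)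
  then have "integrable lborel (\<lambda>t::real. inverse (1 + t ^ 2))"
    using integrable_inverse_1_plus_square by (simp add: set_integrable_def)
  then have "integrable lborel (\<lambda>t::real. inverse (1 + (0 + sqrt c * t) ^ 2))"
    using lborel_integrable_real_affine_iff[of "sqrt c" "\<lambda>t. inverse (1 + t ^ 2)" 0] assms by simp
  then show ?thesis using assms by (simp add: power_mult_distrib)
qed

text \<open>Both \<open>1 / W\<close> and \<open>exp (- b t\<^sup>2 / n)\<close> have modulus at most 1 and agree up to \<open>o(1 / n)\<close>, so their \<open>n\<close>-th powers agree
in the limit.\<close>

lemma power_limit_exp:
  fixes W :: "real \<Rightarrow> complex"
  assumes W0: "W 0 = 1" and ge1: "\<And>s. \<bar>s\<bar> \<le> \<delta> \<Longrightarrow> norm (W s) \<ge> 1" and \<delta>: "\<delta> > 0"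
    and lim: "((\<lambda>s. (W s - 1) / of_real (s ^ 2)) \<longlongrightarrow> of_real b) (at 0)" and b: "b > 0"
  shows "(\<lambda>n. 1 / W (t / sqrt (real n)) ^ n) \<longlonglongrightarrow> of_real (exp (- b * t ^ 2))"
proof (cases "t = 0")
  case True
  then show ?thesis using W0 by simp
next
  case False
  define a where "a = b * t ^ 2"
  have a: "a > 0" using b False by (simp add: a_def)
  define s where "s n = t / sqrt (real n)" for n :: nat
  have s0: "s \<longlonglongrightarrow> 0" unfolding s_def by real_asymp
  have s_nz: "eventually (\<lambda>n. s n \<noteq> 0) sequentially"
    using eventually_gt_at_top[of 0] by eventually_elim (use False in \<open>simp add: s_def\<close>)
  have s_at: "filterlim s (at 0) sequentially"
    using s0 s_nz by (simp add: filterlim_at)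
  have quot: "(\<lambda>n. (W (s n) - 1) / of_real (s n ^ 2)) \<longlonglongrightarrow> of_real b"
    by (rule filterlim_compose[OF lim s_at])
  have s2: "(\<lambda>n. of_real (s n ^ 2) :: complex) \<longlonglongrightarrow> of_real (0 ^ 2)"
    by (intro tendsto_intros s0)
  have "(\<lambda>n. (W (s n) - 1) / of_real (s n ^ 2) * of_real (s n ^ 2) + 1) \<longlonglongrightarrow> of_real b * of_real (0 ^ 2) + 1"
    by (intro tendsto_intros quot s2)
  moreover have "eventually (\<lambda>n. (W (s n) - 1) / of_real (s n ^ 2) * of_real (s n ^ 2) + 1 = W (s n)) sequentially"
    using s_nz by eventually_elim simp
  ultimately have Wlim: "(\<lambda>n. W (s n)) \<longlonglongrightarrow> 1"
    by (simp add: tendsto_cong)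
  have "(\<lambda>n. - ((W (s n) - 1) / of_real (s n ^ 2)) * of_real (t ^ 2) / W (s n)) \<longlonglongrightarrow> - of_real b * of_real (t ^ 2) / 1"
    by (intro tendsto_intros quot Wlim) auto
  moreover have small: "eventually (\<lambda>n. \<bar>s n\<bar> \<le> \<delta>) sequentially"
    using order_tendstoD(2)[OF tendsto_rabs_zero[OF s0] \<delta>] by eventually_elim simp
  have "eventually (\<lambda>n. - ((W (s n) - 1) / of_real (s n ^ 2)) * of_real (t ^ 2) / W (s n)
      = of_real (real n) * (1 / W (s n) - 1)) sequentially"
    using small eventually_gt_at_top[of 0]
  proof eventually_elim
    case (elim n)
    have "W (s n) \<noteq> 0" using ge1[OF elim(1)] by auto
    moreover have "of_real (s n ^ 2) = (of_real (t ^ 2) / of_real (real n) :: complex)"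
      using elim by (simp add: s_def power_divide)
    ultimately have e: "(W (s n) - 1) / of_real (s n ^ 2) * of_real (t ^ 2) = (W (s n) - 1) * of_real (real n)"
      and nz: "W (s n) \<noteq> 0" using False by simp_all
    have "- ((W (s n) - 1) / of_real (s n ^ 2)) * of_real (t ^ 2) / W (s n)
        = - ((W (s n) - 1) / of_real (s n ^ 2) * of_real (t ^ 2)) / W (s n)" by simp
    also have "\<dots> = of_real (real n) * (1 / W (s n) - 1)"
      unfolding e using nz by (simp add: field_simps)
    finally show ?case .
  qed
  ultimately have A: "(\<lambda>n. of_real (real n) * (1 / W (s n) - 1)) \<longlonglongrightarrow> - of_real a"
    by (simp add: tendsto_cong a_def)
  have "(\<lambda>n. real n * (exp (- a / real n) - 1)) \<longlonglongrightarrow> - a"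
    using a by real_asymp
  then have "(\<lambda>n. of_real (real n * (exp (- a / real n) - 1)) :: complex) \<longlonglongrightarrow> of_real (- a)"
    by (rule tendsto_of_real)
  from tendsto_diff[OF A this]
  have "(\<lambda>n. of_real (real n) * (1 / W (s n) - of_real (exp (- a / real n)))) \<longlonglongrightarrow> 0"
    by (simp add: algebra_simps)
  then have D: "(\<lambda>n. norm (of_real (real n) * (1 / W (s n) - of_real (exp (- a / real n))))) \<longlonglongrightarrow> 0"
    by (rule tendsto_norm_zero)
  have "(\<lambda>n. (1 / W (s n)) ^ n - of_real (exp (- a / real n)) ^ n) \<longlonglongrightarrow> 0"
  proof (rule Lim_null_comparison[OF _ D])
    show "eventually (\<lambda>n. norm ((1 / W (s n)) ^ n - of_real (exp (- a / real n)) ^ n)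
        \<le> norm (of_real (real n) * (1 / W (s n) - of_real (exp (- a / real n))))) sequentially"
      using small
    proof eventually_elim
      case (elim n)
      have "norm (1 / W (s n)) \<le> 1" using ge1[OF elim] by (simp add: norm_divide divide_le_eq_1)
      moreover have "norm (of_real (exp (- a / real n)) :: complex) \<le> 1" using a by simp
      ultimately show ?case
        using norm_power_diff[of "1 / W (s n)" "of_real (exp (- a / real n))" n] by (simp add: norm_mult)
    qed
  qed
  moreover have "eventually (\<lambda>n. (1 / W (s n)) ^ n - of_real (exp (- a / real n)) ^ n
      = 1 / W (s n) ^ n - of_real (exp (- a))) sequentially"
    using eventually_gt_at_top[of 0]
  proof eventually_elim
    case (elim n)
    have "exp (- a / real n) ^ n = exp (- a)"
      using elim by (simp flip: exp_of_nat_mult)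
    then have "(of_real (exp (- a / real n)) :: complex) ^ n = of_real (exp (- a))"
      by (metis of_real_power)
    then show ?case by (simp add: power_divide)
  qed
  ultimately have "(\<lambda>n. 1 / W (s n) ^ n - of_real (exp (- a))) \<longlonglongrightarrow> 0"
    by (simp add: tendsto_cong)
  then show ?thesis by (simp add: LIM_zero_iff s_def a_def)
qed

text \<open>Rescaling by \<open>s = t / sqrt n\<close> turns the integrand into \<open>V(s) / W(s)\<^sup>n\<close>, which tends to a Gaussian. Bernoulli's
inequality gives \<open>(1 + c t\<^sup>2 / n)\<^sup>n \<ge> 1 + c t\<^sup>2\<close>, so a multiple of \<open>1 / (1 + c t\<^sup>2)\<close> dominates on the whole
range at once.\<close>

lemma laplace_method:
  fixes V W :: "real \<Rightarrow> complex"
  assumes \<delta>: "\<delta> > 0" and contV: "continuous_on {-\<delta>..\<delta>} V" and contW: "continuous_on {-\<delta>..\<delta>} W"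
    and W0: "W 0 = 1" and c: "c > 0" and lower: "\<And>s. \<bar>s\<bar> \<le> \<delta> \<Longrightarrow> norm (W s) \<ge> 1 + c * s ^ 2"
    and lim: "((\<lambda>s. (W s - 1) / of_real (s ^ 2)) \<longlongrightarrow> of_real b) (at 0)" and b: "b > 0"
  shows "(\<lambda>n. of_real (sqrt (real n)) * integral {-\<delta>..\<delta>} (\<lambda>s. V s / W s ^ n))
    \<longlonglongrightarrow> V 0 * of_real (sqrt (pi / b))"
proof -
  have ge1: "norm (W s) \<ge> 1" if "\<bar>s\<bar> \<le> \<delta>" for s
    using lower[OF that] c by (smt (verit) mult_nonneg_nonneg zero_le_power2)
  have nz: "W s \<noteq> 0" if "s \<in> {-\<delta>..\<delta>}" for s using ge1[of s] that by (auto simp: abs_le_iff)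
  have cont: "continuous_on {-\<delta>..\<delta>} (\<lambda>s. V s / W s ^ n)" for n
    using nz by (intro continuous_intros contV contW) auto
  obtain M where "\<forall>s\<in>{-\<delta>..\<delta>}. norm (V s) \<le> M"
    using compact_imp_bounded[OF compact_continuous_image[OF contV compact_Icc]]
    unfolding bounded_iff by auto
  then have M: "norm (V s) \<le> M" if "s \<in> {-\<delta>..\<delta>}" for s using that by blast
  have M0: "M \<ge> 0" using M[of 0] \<delta> by (smt (verit) atLeastAtMost_iff norm_ge_zero)
  define F where "F n s = indicator {-\<delta>..\<delta>} s *\<^sub>R (V s / W s ^ n)" for n s
  define S where "S n t = F n (t / sqrt (real n))" for n t
  have F_meas[measurable]: "F n \<in> borel_measurable borel" for n
    unfolding F_def[abs_def] by (intro borel_measurable_continuous_on_indicator cont) auto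
  have S_eq: "of_real (sqrt (real n)) * integral {-\<delta>..\<delta>} (\<lambda>s. V s / W s ^ n) = (\<integral>t. S n t \<partial>lborel)"
    if n: "n > 0" for n
  proof -
    have "integral {-\<delta>..\<delta>} (\<lambda>s. V s / W s ^ n) = (LINT s:{-\<delta>..\<delta>}|lborel. V s / W s ^ n)"
      by (rule set_borel_integral_eq_integral(2)[symmetric]) (intro borel_integrable_atLeastAtMost' cont)
    also have "\<dots> = (\<integral>s. F n s \<partial>lborel)" by (simp add: set_lebesgue_integral_def F_def)
    also have "\<dots> = \<bar>1 / sqrt (real n)\<bar> *\<^sub>R (\<integral>t. F n (0 + 1 / sqrt (real n) * t) \<partial>lborel)"
      using n by (intro lborel_integral_real_affine) auto
    finally show ?thesis using n by (simp add: S_def scaleR_conv_of_real)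
  qed
  have "(\<lambda>n. \<integral>t. S (Suc n) t \<partial>lborel) \<longlonglongrightarrow> (\<integral>t. V 0 * of_real (exp (- b * t ^ 2)) \<partial>lborel)"
  proof (rule integral_dominated_convergence)
    show "(\<lambda>t. V 0 * of_real (exp (- b * t ^ 2))) \<in> borel_measurable lborel" by measurable
    show "S (Suc n) \<in> borel_measurable lborel" for n unfolding S_def[abs_def] by measurable
    show "integrable lborel (\<lambda>t. M * inverse (1 + c * t ^ 2))"
      by (intro integrable_mult_right integrable_inverse_1_plus_mult_square c)
    show "AE t in lborel. (\<lambda>n. S (Suc n) t) \<longlonglongrightarrow> V 0 * of_real (exp (- b * t ^ 2))"
    proof (rule AE_I2)
      fix t :: real
      have s0: "(\<lambda>n. t / sqrt (real n)) \<longlonglongrightarrow> 0" by real_asymp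
      have "isCont V 0" using continuous_on_interior[OF contV, of 0] \<delta> by (simp add: interior_atLeastAtMost_real)
      then have "(\<lambda>n. V (t / sqrt (real n))) \<longlonglongrightarrow> V 0" by (rule isCont_tendsto_compose[OF _ s0])
      then have "(\<lambda>n. V (t / sqrt (real n)) * (1 / W (t / sqrt (real n)) ^ n)) \<longlonglongrightarrow> V 0 * of_real (exp (- b * t ^ 2))"
        by (intro tendsto_mult power_limit_exp[OF W0 ge1 \<delta> lim b])
      moreover have "eventually (\<lambda>n. V (t / sqrt (real n)) * (1 / W (t / sqrt (real n)) ^ n) = S n t) sequentially"
        using order_tendstoD(2)[OF tendsto_rabs_zero[OF s0] \<delta>]
      proof eventually_elim
        case (elim n)
        have "t / sqrt (real n) \<in> {-\<delta>..\<delta>}"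
          unfolding atLeastAtMost_iff using elim[unfolded abs_less_iff] by linarith
        then show ?case by (simp add: S_def F_def)
      qed
      ultimately have "(\<lambda>n. S n t) \<longlonglongrightarrow> V 0 * of_real (exp (- b * t ^ 2))"
        by (rule Lim_transform_eventually)
      then show "(\<lambda>n. S (Suc n) t) \<longlonglongrightarrow> V 0 * of_real (exp (- b * t ^ 2))"
        by (rule LIMSEQ_Suc)
    qed
    show "AE t in lborel. norm (S (Suc m) t) \<le> M * inverse (1 + c * t ^ 2)" for m
    proof (rule AE_I2)
      fix t :: real
      define n where "n = Suc m"
      have n: "n > 0" by (simp add: n_def)
      have pos: "0 < 1 + c * t ^ 2" using c by (simp add: add_pos_nonneg)
      have "norm (S n t) \<le> M * inverse (1 + c * t ^ 2)"
      proof (cases "t / sqrt (real n) \<in> {-\<delta>..\<delta>}")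
        case False
        then show ?thesis using M0 pos by (simp add: S_def F_def)
      next
        case in_range: True
        let ?s = "t / sqrt (real n)"
        have sM: "norm (V ?s) \<le> M" by (rule M[OF in_range])
        have "1 + c * t ^ 2 = 1 + real n * (c * ?s ^ 2)" using n by (simp add: power_divide)
        also have "\<dots> \<le> (1 + c * ?s ^ 2) ^ n"
        proof (rule Bernoulli_inequality)
          have "0 \<le> c * ?s ^ 2" using c by simp
          then show "- 1 \<le> c * ?s ^ 2" by linarith
        qed
        also have "\<dots> \<le> norm (W ?s) ^ n"
          using lower[of ?s] in_range c by (intro power_mono) auto
        finally have "norm (V ?s) / norm (W ?s) ^ n \<le> M / (1 + c * t ^ 2)"
          using sM pos M0 by (intro frac_le) auto
        moreover have "norm (S n t) = norm (V ?s) / norm (W ?s) ^ n"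
          using in_range by (simp add: S_def F_def norm_divide norm_power)
        ultimately show ?thesis by (simp only: divide_inverse)
      qed
      then show "norm (S (Suc m) t) \<le> M * inverse (1 + c * t ^ 2)" by (simp add: n_def)
    qed
  qed
  then have "(\<lambda>n. \<integral>t. S n t \<partial>lborel) \<longlonglongrightarrow> (\<integral>t. V 0 * of_real (exp (- b * t ^ 2)) \<partial>lborel)"
    by (rule LIMSEQ_imp_Suc)
  also have "(\<integral>t. V 0 * of_real (exp (- b * t ^ 2)) \<partial>lborel) = V 0 * of_real (sqrt (pi / b))"
    using gaussian_integral[OF b] by (simp only: integral_mult_right_zero integral_complex_of_real)
  finally show ?thesis
    by (rule Lim_transform_eventually)
      (use eventually_gt_at_top[of 0] in \<open>eventually_elim, simp add: S_eq\<close>)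
qed

text \<open>Cauchy's formula on a circle that is parametrised symmetrically around its positive real point, where the
saddle point will be. The standard parametrisation starts there; applying Cauchy's formula to \<open>f (- u)\<close> and
shifting the parameter by half a turn moves the point to the middle of the range.\<close>

lemma circle_integral_taylor_coefficient:
  fixes f :: "complex \<Rightarrow> complex"
  assumes hol: "f holomorphic_on ball 0 R" and r: "0 < r" "r < R"
  shows "((\<lambda>s. f (of_real r * cis (2 * pi * s)) / (of_real r * cis (2 * pi * s)) ^ m)
    has_integral ((deriv ^^ m) f 0 / fact m)) {-1/2..1/2}"
proof -
  define g where "g u = f (- 1 * u)" for u
  have holg: "g holomorphic_on ball 0 R"
  proof -
    have "(f \<circ> (\<lambda>u. - 1 * u)) holomorphic_on ball 0 R"
      by (rule holomorphic_on_compose_gen[OF _ hol]) (auto intro!: holomorphic_intros)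
    then show ?thesis by (simp add: o_def g_def[abs_def])
  qed
  have dg: "(deriv ^^ m) g 0 = (- 1) ^ m * (deriv ^^ m) f 0"
    using higher_deriv_compose_linear[OF hol open_ball open_ball, of 0 0 R "- 1" m] r
    unfolding g_def[abs_def] by simp
  have sub: "cball 0 r \<subseteq> ball (0::complex) R" using r by auto
  have "((\<lambda>u. g u / (u - 0) ^ Suc m) has_contour_integral (2 * pi * \<i>) / fact m * (deriv ^^ m) g 0) (circlepath 0 r)"
  proof (rule Cauchy_has_contour_integral_higher_derivative_circlepath)
    show "continuous_on (cball 0 r) g"
      using holomorphic_on_imp_continuous_on[OF holg] sub continuous_on_subset by blast
    show "g holomorphic_on ball 0 r"
      by (rule holomorphic_on_subset[OF holg]) (use r in auto)
  qed (use r in auto)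
  then have "((\<lambda>x. g (circlepath 0 r x) / (circlepath 0 r x) ^ Suc m * (2 * pi * \<i> * circlepath 0 r x))
      has_integral (2 * pi * \<i>) / fact m * ((- 1) ^ m * (deriv ^^ m) f 0)) (cbox 0 1)"
    unfolding has_contour_integral dg vector_derivative_circlepath
    by (simp add: circlepath mult_ac)
  from has_integral_affinity[OF this, of 1 "1/2"]
  have "((\<lambda>s. g (circlepath 0 r (s + 1/2)) / (circlepath 0 r (s + 1/2)) ^ Suc m * (2 * pi * \<i> * circlepath 0 r (s + 1/2)))
      has_integral (2 * pi * \<i>) / fact m * ((- 1) ^ m * (deriv ^^ m) f 0)) ((\<lambda>x. x - 1/2) ` {0..1})"
    by simp
  also have "(\<lambda>x. x - 1/2) ` {0..1} = {-1/2..1/2::real}"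
    using image_add_atLeastAtMost[of "-1/2" "0::real" 1] by simp
  finally have "((\<lambda>s. (- 1) ^ m / (2 * pi * \<i>) * (g (circlepath 0 r (s + 1/2)) / (circlepath 0 r (s + 1/2)) ^ Suc m * (2 * pi * \<i> * circlepath 0 r (s + 1/2))))
      has_integral (- 1) ^ m / (2 * pi * \<i>) * ((2 * pi * \<i>) / fact m * ((- 1) ^ m * (deriv ^^ m) f 0))) {-1/2..1/2}"
    by (rule has_integral_mult_right)
  moreover have "(- 1) ^ m / (2 * pi * \<i>) * ((2 * pi * \<i>) / fact m * ((- 1) ^ m * (deriv ^^ m) f 0)) = (deriv ^^ m) f 0 / fact m"
    by (simp add: field_simps flip: power_mult_distrib)
  moreover have "(- 1) ^ m / (2 * pi * \<i>) * (g (circlepath 0 r (s + 1/2)) / (circlepath 0 r (s + 1/2)) ^ Suc m * (2 * pi * \<i> * circlepath 0 r (s + 1/2)))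
      = f (of_real r * cis (2 * pi * s)) / (of_real r * cis (2 * pi * s)) ^ m" for s
  proof -
    define v where "v = of_real r * cis (2 * pi * s)"
    have v: "v \<noteq> 0" using r by (simp add: v_def)
    have "circlepath 0 r (s + 1/2) = of_real r * (exp (\<i> * of_real (2 * pi * s)) * exp (\<i> * of_real pi))"
    proof -
      have "2 * of_real pi * \<i> * of_real (s + 1/2) = \<i> * of_real (2 * pi * s) + \<i> * of_real pi"
        by (simp add: algebra_simps)
      then show ?thesis by (simp only: circlepath add_0 exp_add)
    qed
    also have "\<dots> = - v"
    proof -
      have "exp (\<i> * of_real pi) = (- 1 :: complex)" by simp
      then show ?thesis by (simp only: v_def cis_conv_exp mult_minus1_right mult_minus_right mult_1_right)
    qed
    finally have e: "circlepath 0 r (s + 1/2) = - v" .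
    have "(- v) ^ Suc m = (- 1) ^ m * v ^ m * (- v)"
      by (metis mult.commute mult_minus1 power_Suc power_mult_distrib)
    then show ?thesis unfolding e g_def v_def[symmetric] using v
      by (simp add: field_simps flip: power_mult_distrib)
  qed
  ultimately show ?thesis by simp
qed

section \<open>Coefficient asymptotics\<close>

context saddle_point
begin

text \<open>\<open>\<psi>(u) = u - \<Lambda>(u)\<close>, the inverse function of the generating function.\<close>

definition \<psi> :: "complex \<Rightarrow> complex" where
  "\<psi> u = u * (1 - 2 * u - u ^ 3) / (1 - u)"

lemma small_denominators:
  fixes u :: complex
  assumes "norm u < 2/5"
  shows "1 - u \<noteq> 0" "1 - 2 * u - u ^ 3 \<noteq> 0"
proof -
  have "norm u < 1" using assms by simp
  then show "1 - u \<noteq> 0" by auto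
  have "norm (2 * u + u ^ 3) \<le> 2 * norm u + norm u ^ 3"
    by (rule order.trans[OF norm_triangle_ineq]) (simp add: norm_mult norm_power)
  also have "\<dots> \<le> 2 * (2/5) + (2/5) ^ 3"
    using assms by (intro add_mono mult_left_mono power_mono) auto
  also have "\<dots> < 1" by (simp add: power_numeral_reduce)
  finally have "2 * u + u ^ 3 \<noteq> 1" by (metis less_irrefl norm_one)
  then show "1 - 2 * u - u ^ 3 \<noteq> 0" by (simp add: algebra_simps)
qed

lemma double_root_factorization:
  fixes u :: complex
  shows "of_real \<rho> * (1 - u) - u * (1 - 2 * u - u ^ 3)
    = (u - of_real \<tau>) ^ 2 * (u ^ 2 + 2 * of_real \<tau> * u + of_real (2 + 3 * \<tau> ^ 2))"
proof -
  define t where "t = (of_real \<tau> :: complex)"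
  define R where "R = (of_real \<rho> :: complex)"
  have R1: "R = 2 * t ^ 2 + 3 * t ^ 4" and R2: "1 + R = 4 * t + 4 * t ^ 3"
  proof -
    have "(of_real \<rho> :: complex) = of_real (2 * \<tau> ^ 2 + 3 * \<tau> ^ 4)" by (simp only: rho_eq[symmetric])
    then show "R = 2 * t ^ 2 + 3 * t ^ 4" by (simp add: t_def R_def)
    have "(of_real (1 + \<rho>) :: complex) = of_real (4 * \<tau> + 4 * \<tau> ^ 3)" by (simp only: one_plus_rho_eq)
    then show "1 + R = 4 * t + 4 * t ^ 3" by (simp add: t_def R_def)
  qed
  have "(u - t) ^ 2 * (u ^ 2 + 2 * t * u + (2 + 3 * t ^ 2))
      = u ^ 4 + 2 * u ^ 2 - (4 * t + 4 * t ^ 3) * u + (2 * t ^ 2 + 3 * t ^ 4)"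
    by (simp add: algebra_simps power_numeral_reduce)
  also have "\<dots> = u ^ 4 + 2 * u ^ 2 - (1 + R) * u + R" by (simp only: R1[symmetric] R2[symmetric])
  also have "\<dots> = R * (1 - u) - u * (1 - 2 * u - u ^ 3)"
    by (simp add: algebra_simps power_numeral_reduce)
  finally show ?thesis by (simp add: t_def R_def)
qed

definition curvature :: "complex \<Rightarrow> complex" where
  "curvature u = (u ^ 2 + 2 * of_real \<tau> * u + of_real (2 + 3 * \<tau> ^ 2)) / (1 - u)"

lemma rho_minus_psi:
  assumes "u \<noteq> 1"
  shows "of_real \<rho> - \<psi> u = (u - of_real \<tau>) ^ 2 * curvature u"
proof -
  have "(of_real \<rho> * (1 - u) - u * (1 - 2 * u - u ^ 3)) / (1 - u) = (u - of_real \<tau>) ^ 2 * curvature u"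
    unfolding curvature_def double_root_factorization by simp
  then show ?thesis using assms by (simp add: \<psi>_def diff_divide_distrib)
qed

definition circ :: "real \<Rightarrow> complex" where "circ s = of_real \<tau> * cis (2 * pi * s)"

lemma norm_circ: "norm (circ s) = \<tau>"
  using tau_pos by (simp add: circ_def norm_mult)

lemma circ_0: "circ 0 = of_real \<tau>" by (simp add: circ_def)

lemma norm_circ_less: "norm (circ s) < 2/5" using tau_lt by (simp add: norm_circ)

text \<open>Write \<open>\<psi>(u) = u (1 - L(u))\<close>, where \<open>L(u) = u + u\<^sup>2 + 2 u\<^sup>3 / (1 - u)\<close> has nonnegative Taylor coefficients. The triangle
inequality is used for all of \<open>L\<close> except the first two terms, where \<open>|1 + u|\<close> falls short of \<open>1 + \<tau>\<close> by an
amount of order \<open>1 - cos \<theta>\<close>.\<close>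

lemma psi_circ_lower:
  assumes s: "\<bar>s\<bar> \<le> 1/2"
  shows "norm (\<psi> (circ s)) \<ge> \<rho> + 3 * \<tau> ^ 3 / (1 + \<tau>) * s ^ 2"
proof -
  define u where "u = circ s"
  define \<theta> where "\<theta> = 2 * pi * s"
  have nu: "norm u = \<tau>" by (simp add: u_def norm_circ)
  have nz: "1 - u \<noteq> 0" using small_denominators norm_circ_less by (simp add: u_def)
  define L where "L = u * (1 + u) + 2 * u ^ 3 / (1 - u)"
  have psi: "\<psi> u = u * (1 - L)"
    using nz unfolding \<psi>_def L_def by (simp add: divide_simps) (simp add: algebra_simps power_numeral_reduce)
  have s2: "3 * s ^ 2 \<le> 1 - cos \<theta>"
  proof -
    have "\<bar>\<theta>\<bar> \<le> pi" using s by (simp add: \<theta>_def abs_mult)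
    then have "\<theta> ^ 2 / 12 \<le> 1 - cos \<theta>" by (rule one_minus_cos_ge)
    moreover have "9 \<le> pi ^ 2" using pi_between power_mono[of 3 pi 2] by simp
    then have "9 * s ^ 2 \<le> pi ^ 2 * s ^ 2" by (intro mult_right_mono) auto
    ultimately show ?thesis by (simp add: \<theta>_def power_mult_distrib)
  qed
  define d where "d = \<tau> * (1 - cos \<theta>) / (1 + \<tau>)"
  have d: "0 \<le> d" "d \<le> 1 + \<tau>"
  proof -
    show "0 \<le> d" using tau_pos by (simp add: d_def)
    have "1 - cos \<theta> \<le> 2" using cos_ge_minus_one[of \<theta>] by simp
    then have "\<tau> * (1 - cos \<theta>) \<le> \<tau> * 2" using tau_pos by (intro mult_left_mono) auto
    also have "\<dots> \<le> (1 + \<tau>) * (1 + \<tau>)" by (simp add: algebra_simps)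
    finally show "d \<le> 1 + \<tau>" using tau_pos by (simp add: d_def divide_le_eq)
  qed
  have n1u: "norm (1 + u) \<le> 1 + \<tau> - d"
  proof (rule power2_le_imp_le)
    have "norm (1 + u) ^ 2 = (1 + \<tau> * cos \<theta>) ^ 2 + (\<tau> * sin \<theta>) ^ 2"
      by (simp add: cmod_power2 u_def circ_def \<theta>_def)
    also have "\<dots> = 1 + 2 * \<tau> * cos \<theta> + \<tau> ^ 2 * (cos \<theta> ^ 2 + sin \<theta> ^ 2)"
      by (simp only: power2_eq_square distrib_left distrib_right mult_ac add_ac mult_1_left mult_2)
    also have "\<dots> = 1 + 2 * \<tau> * cos \<theta> + \<tau> ^ 2 * 1" by (simp only: sin_cos_squared_add2)
    also have "\<dots> = (1 + \<tau>) ^ 2 - 2 * (\<tau> * (1 - cos \<theta>))"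
      by (simp add: power2_eq_square algebra_simps)
    also have "\<tau> * (1 - cos \<theta>) = (1 + \<tau>) * d"
      using tau_pos by (simp add: d_def)
    also have "(1 + \<tau>) ^ 2 - 2 * ((1 + \<tau>) * d) = (1 + \<tau> - d) ^ 2 - d ^ 2"
      by (simp add: power2_eq_square algebra_simps)
    also have "\<dots> \<le> (1 + \<tau> - d) ^ 2" by simp
    finally show "norm (1 + u) ^ 2 \<le> (1 + \<tau> - d) ^ 2" .
  qed (use d in simp)
  have n1mu: "1 - \<tau> \<le> norm (1 - u)" using norm_triangle_ineq2[of 1 u] nu by simp
  have "norm L \<le> norm (u * (1 + u)) + norm (2 * u ^ 3 / (1 - u))"
    unfolding L_def by (rule norm_triangle_ineq)
  also have "\<dots> = \<tau> * norm (1 + u) + 2 * \<tau> ^ 3 / norm (1 - u)"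
    by (simp add: norm_mult norm_divide norm_power nu)
  also have "\<dots> \<le> \<tau> * (1 + \<tau> - d) + 2 * \<tau> ^ 3 / (1 - \<tau>)"
  proof (intro add_mono mult_left_mono divide_left_mono)
    have "0 < norm (1 - u)" using nz by simp
    then show "0 < norm (1 - u) * (1 - \<tau>)" using tau_in by (intro mult_pos_pos) auto
  qed (use n1u n1mu tau_pos in auto)
  finally have L: "norm L \<le> \<tau> * (1 + \<tau> - d) + 2 * \<tau> ^ 3 / (1 - \<tau>)" .
  have rho': "\<rho> = \<tau> * (1 - (\<tau> * (1 + \<tau>) + 2 * \<tau> ^ 3 / (1 - \<tau>)))"
    using tau_in unfolding rho_eq_Lambda \<Lambda>_def
    by (simp add: divide_simps) (simp add: algebra_simps power_numeral_reduce)
  have "1 - norm L \<le> norm (1 - L)" using norm_triangle_ineq2[of 1 L] by simp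
  then have "1 - (\<tau> * (1 + \<tau> - d) + 2 * \<tau> ^ 3 / (1 - \<tau>)) \<le> norm (1 - L)" using L by linarith
  then have "\<tau> * (1 - (\<tau> * (1 + \<tau> - d) + 2 * \<tau> ^ 3 / (1 - \<tau>))) \<le> \<tau> * norm (1 - L)"
    using tau_pos by (intro mult_left_mono) auto
  also have "\<dots> = norm (\<psi> u)" by (simp add: psi norm_mult nu)
  also have "\<tau> * (1 - (\<tau> * (1 + \<tau> - d) + 2 * \<tau> ^ 3 / (1 - \<tau>))) = \<rho> + \<tau> ^ 2 * d"
    unfolding rho' by (simp add: algebra_simps power2_eq_square)
  finally have "\<rho> + \<tau> ^ 2 * d \<le> norm (\<psi> u)" .
  moreover have "3 * \<tau> ^ 3 / (1 + \<tau>) * s ^ 2 \<le> \<tau> ^ 2 * d"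
  proof -
    have "\<tau> ^ 3 / (1 + \<tau>) * (3 * s ^ 2) \<le> \<tau> ^ 3 / (1 + \<tau>) * (1 - cos \<theta>)"
      using s2 tau_pos by (intro mult_left_mono) auto
    also have "\<dots> = \<tau> ^ 2 * d" by (simp add: d_def power_numeral_reduce)
    finally show ?thesis by (simp add: mult_ac)
  qed
  ultimately show ?thesis by (simp add: u_def)
qed

lemma psi_circ_0: "\<psi> (circ 0) = of_real \<rho>"
proof -
  have "of_real \<tau> \<noteq> (1 :: complex)" using tau_in by simp
  from rho_minus_psi[OF this] show ?thesis by (simp add: circ_0)
qed

lemma curvature_tau: "curvature (of_real \<tau>) = of_real \<gamma>"
proof -
  have "curvature (of_real \<tau>) = of_real ((\<tau> ^ 2 + 2 * \<tau> * \<tau> + (2 + 3 * \<tau> ^ 2)) / (1 - \<tau>))"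
    by (simp add: curvature_def)
  also have "(\<tau> ^ 2 + 2 * \<tau> * \<tau> + (2 + 3 * \<tau> ^ 2)) / (1 - \<tau>) = \<gamma>"
    by (simp add: \<gamma>_def power2_eq_square)
  finally show ?thesis .
qed

lemma circ_derivative: "((\<lambda>s. (circ s - of_real \<tau>) / of_real s) \<longlongrightarrow> of_real (2 * pi * \<tau>) * \<i>) (at 0)"
proof -
  define f where "f z = of_real \<tau> * exp (of_real (2 * pi) * \<i> * z)" for z :: complex
  have "(f has_field_derivative of_real (2 * pi * \<tau>) * \<i>) (at 0)"
    unfolding f_def[abs_def] by (auto intro!: derivative_eq_intros)
  then have "((\<lambda>h. (f h - of_real \<tau>) / h) \<longlongrightarrow> of_real (2 * pi * \<tau>) * \<i>) (at 0)"
    by (simp add: DERIV_def f_def)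
  moreover have "filterlim (of_real :: real \<Rightarrow> complex) (at 0) (at 0)"
    unfolding filterlim_at by (auto simp: eventually_at_filter intro!: tendsto_eq_intros)
  ultimately have "((\<lambda>s. (f (of_real s) - of_real \<tau>) / of_real s) \<longlongrightarrow> of_real (2 * pi * \<tau>) * \<i>) (at 0)"
    by (rule filterlim_compose)
  moreover have "f (of_real s) = circ s" for s
    by (simp add: f_def circ_def cis_conv_exp mult_ac)
  ultimately show ?thesis by simp
qed

text \<open>At \<open>\<tau>\<close> the derivative of \<open>\<psi>\<close> vanishes, so the leading term of \<open>\<psi>\<close> along the circle is quadratic.\<close>

lemma psi_circ_quadratic:
  "((\<lambda>s. (\<psi> (circ s) / of_real \<rho> - 1) / of_real (s ^ 2)) \<longlongrightarrow> of_real (4 * pi ^ 2 * \<tau> ^ 2 * \<gamma> / \<rho>)) (at 0)"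
proof -
  have contc: "isCont circ 0" unfolding circ_def cis_conv_exp by (intro continuous_intros)
  then have "(circ \<longlongrightarrow> of_real \<tau>) (at 0)" by (simp add: isCont_def circ_0)
  then have "((\<lambda>s. curvature (circ s)) \<longlongrightarrow> curvature (of_real \<tau>)) (at 0)"
    unfolding curvature_def using tau_in by (intro tendsto_intros) auto
  then have "((\<lambda>s. curvature (circ s)) \<longlongrightarrow> of_real \<gamma>) (at 0)" unfolding curvature_tau .
  then have "((\<lambda>s. - (((circ s - of_real \<tau>) / of_real s) ^ 2 * curvature (circ s)) / of_real \<rho>)
      \<longlongrightarrow> - ((of_real (2 * pi * \<tau>) * \<i>) ^ 2 * of_real \<gamma>) / of_real \<rho>) (at 0)"
    using rho_pos by (intro tendsto_intros circ_derivative) auto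
  also have "- ((of_real (2 * pi * \<tau>) * \<i>) ^ 2 * of_real \<gamma>) / of_real \<rho> = (of_real (4 * pi ^ 2 * \<tau> ^ 2 * \<gamma> / \<rho>) :: complex)"
    by (simp add: power_mult_distrib)
  finally show ?thesis
  proof (rule Lim_transform_eventually)
    show "eventually (\<lambda>s. - (((circ s - of_real \<tau>) / of_real s) ^ 2 * curvature (circ s)) / of_real \<rho>
        = (\<psi> (circ s) / of_real \<rho> - 1) / of_real (s ^ 2)) (at 0)"
    proof (rule always_eventually, rule allI)
      fix s
      have "circ s \<noteq> 1" using norm_circ_less[of s] by auto
      then have "\<psi> (circ s) = of_real \<rho> - (circ s - of_real \<tau>) ^ 2 * curvature (circ s)"
        using rho_minus_psi[of "circ s"] by (simp add: algebra_simps)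
      then have "\<psi> (circ s) / of_real \<rho> - 1 = - ((circ s - of_real \<tau>) ^ 2 * curvature (circ s)) / of_real \<rho>"
        using rho_pos by (simp add: diff_divide_distrib)
      then show "- (((circ s - of_real \<tau>) / of_real s) ^ 2 * curvature (circ s)) / of_real \<rho>
        = (\<psi> (circ s) / of_real \<rho> - 1) / of_real (s ^ 2)" by (simp add: power_divide)
    qed
  qed
qed

text \<open>Lagrange inversion expresses \<open>n p\<^sub>n\<close> as a Taylor coefficient of \<open>\<phi>\<^sup>n\<close> with \<open>\<phi>(u) = u / \<psi>(u)\<close>. As \<open>\<phi>\<close> is holomorphic
beyond \<open>\<tau>\<close>, this coefficient is an integral over the circle of radius \<open>\<tau>\<close>.\<close>

lemma coefficient_integral:
  fixes P :: "complex fps"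
  assumes eq: "(1 - P) * (P - fps_X) = P ^ 2 + P ^ 4" and P0: "fps_nth P 0 = 0" and n: "n \<ge> 1"
  shows "of_nat n * fps_nth P n = integral {-(1/2)..1/2} (\<lambda>s. circ s / \<psi> (circ s) ^ n)"
proof -
  define q :: "complex fps" where "q = (1 - 2 * fps_X - fps_X ^ 3) * inverse (1 - fps_X)"
  have q0: "fps_nth q 0 \<noteq> 0" by (simp add: q_def)
  have inv: "(fps_X * q) oo P = fps_X"
  proof -
    have nz: "fps_nth (1 - P) 0 \<noteq> 0" using P0 by simp
    have comp: "(1 - fps_X) oo P = 1 - P" "(1 - 2 * fps_X - fps_X ^ 3) oo P = 1 - 2 * P - P ^ 3"
      using P0 by (simp_all add: fps_compose_sub_distrib fps_compose_mult_distrib fps_compose_power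
          fps_X_power_compose numeral_fps_const)
    have "(fps_X * q) oo P = P * ((1 - 2 * P - P ^ 3) * inverse (1 - P))"
      unfolding q_def using P0
      by (simp add: fps_compose_mult_distrib fps_inverse_compose comp)
    also have "\<dots> = (P * (1 - 2 * P - P ^ 3)) * inverse (1 - P)" by (simp only: mult.assoc)
    also have "P * (1 - 2 * P - P ^ 3) = fps_X * (1 - P)"
      using eq by (simp add: algebra_simps power_numeral_reduce)
    also have "fps_X * (1 - P) * inverse (1 - P) = fps_X"
      using inverse_mult_eq_1'[OF nz] by (simp add: mult.assoc)
    finally show ?thesis .
  qed
  define \<phi> :: "complex \<Rightarrow> complex" where "\<phi> u = inverse ((1 - 2 * u - u ^ 3) * inverse (1 - u))" for u
  have "(\<lambda>u. (1 - 2 * u - u ^ 3) * inverse (1 - u)) has_fps_expansion q"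
    unfolding q_def by (intro fps_expansion_intros) simp_all
  then have "\<phi> has_fps_expansion inverse q"
    unfolding \<phi>_def[abs_def] using q0 by (rule has_fps_expansion_inverse)
  then have exp: "(\<lambda>u. \<phi> u ^ k) has_fps_expansion inverse q ^ k" for k
    by (induction k) (auto intro: fps_expansion_intros)
  have hol: "(\<lambda>u. \<phi> u ^ n) holomorphic_on ball 0 (2/5)"
    unfolding \<phi>_def using small_denominators by (intro holomorphic_intros) auto
  have "of_nat n * fps_nth P n = fps_nth (inverse q ^ n) (n - 1)"
    by (rule fps_lagrange_inversion[OF P0 q0 inv n])
  also have "\<dots> = (deriv ^^ (n - 1)) (\<lambda>u. \<phi> u ^ n) 0 / fact (n - 1)"
    by (rule fps_nth_fps_expansion[OF exp])
  also have "\<dots> = integral {-(1/2)..1/2} (\<lambda>s. \<phi> (circ s) ^ n / circ s ^ (n - 1))"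
    using circle_integral_taylor_coefficient[OF hol, of \<tau> "n - 1"] tau_pos tau_lt
    unfolding circ_def by (intro integral_unique[symmetric]) auto
  also have "\<dots> = integral {-(1/2)..1/2} (\<lambda>s. circ s / \<psi> (circ s) ^ n)"
  proof (rule integral_cong)
    fix s
    define u where "u = circ s"
    have u: "u \<noteq> 0" using norm_circ[of s] tau_pos by (auto simp: u_def)
    have nz: "1 - u \<noteq> 0" "1 - 2 * u - u ^ 3 \<noteq> 0"
      using small_denominators[OF norm_circ_less[of s]] by (simp_all add: u_def)
    have "\<phi> u = u / \<psi> u" using nz u unfolding \<phi>_def \<psi>_def by (simp add: divide_inverse)
    then have "\<phi> u ^ n / u ^ (n - 1) = u ^ n / u ^ (n - 1) / \<psi> u ^ n" by (simp add: power_divide)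
    also have "u ^ n / u ^ (n - 1) = u" using u n by (simp flip: power_diff)
    finally show "\<phi> (circ s) ^ n / circ s ^ (n - 1) = circ s / \<psi> (circ s) ^ n" by (simp add: u_def)
  qed
  finally show ?thesis .
qed

text \<open>Laplace's method with \<open>W = \<psi> / \<rho>\<close>; the exponent \<open>3/2\<close> is the sum of the 1 from \<open>n p\<^sub>n\<close> and the 1/2 from the
width of the saddle.\<close>

lemma coefficient_asymptotics:
  fixes P :: "complex fps"
  assumes eq: "(1 - P) * (P - fps_X) = P ^ 2 + P ^ 4" and P0: "fps_nth P 0 = 0"
  shows "(\<lambda>n. of_real (real n powr (3/2) * \<rho> ^ n) * fps_nth P n)
    \<longlonglongrightarrow> of_real (sqrt (\<rho> / (4 * pi * \<gamma>)))"
proof -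
  define W where "W s = \<psi> (circ s) / of_real \<rho>" for s
  define b where "b = 4 * pi ^ 2 * \<tau> ^ 2 * \<gamma> / \<rho>"
  define c where "c = 3 * \<tau> ^ 3 / (1 + \<tau>) / \<rho>"
  have contc: "continuous_on {-(1/2)..1/2} circ"
    unfolding circ_def[abs_def] cis_conv_exp by (intro continuous_intros)
  have "(\<lambda>n. of_real (sqrt (real n)) * integral {-(1/2)..1/2} (\<lambda>s. circ s / W s ^ n))
    \<longlonglongrightarrow> circ 0 * of_real (sqrt (pi / b))"
  proof (rule laplace_method)
    show "continuous_on {-(1/2)..1/2} circ" using contc by simp
    show "continuous_on {-(1/2)..1/2} W"
      unfolding W_def[abs_def] \<psi>_def using contc rho_pos small_denominators(1)[OF norm_circ_less]
      by (intro continuous_intros) auto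
    show "W 0 = 1" using psi_circ_0 rho_pos by (simp add: W_def)
    show "c > 0" using tau_pos rho_pos by (simp add: c_def)
    show "norm (W s) \<ge> 1 + c * s ^ 2" if "\<bar>s\<bar> \<le> 1/2" for s
    proof -
      have "norm (W s) = norm (\<psi> (circ s)) / \<rho>" using rho_pos by (simp add: W_def norm_divide)
      moreover have "(\<rho> + 3 * \<tau> ^ 3 / (1 + \<tau>) * s ^ 2) / \<rho> \<le> norm (\<psi> (circ s)) / \<rho>"
        using psi_circ_lower[OF that] rho_pos by (intro divide_right_mono) auto
      moreover have "(\<rho> + 3 * \<tau> ^ 3 / (1 + \<tau>) * s ^ 2) / \<rho> = 1 + c * s ^ 2"
        using rho_pos by (simp add: c_def add_divide_distrib)
      ultimately show ?thesis by simp
    qed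
    show "((\<lambda>s. (W s - 1) / of_real (s ^ 2)) \<longlongrightarrow> of_real b) (at 0)"
      using psi_circ_quadratic by (simp only: W_def b_def)
    show "b > 0" using tau_pos rho_pos gamma_pos by (simp add: b_def)
  qed simp
  also have "circ 0 * of_real (sqrt (pi / b)) = of_real (sqrt (\<rho> / (4 * pi * \<gamma>)))"
  proof -
    have "pi / b = (1 / \<tau>) ^ 2 * (\<rho> / (4 * pi * \<gamma>))"
      using tau_pos rho_pos gamma_pos by (simp add: b_def field_simps power2_eq_square)
    then have "sqrt (pi / b) = sqrt ((1 / \<tau>) ^ 2) * sqrt (\<rho> / (4 * pi * \<gamma>))"
      by (simp only: real_sqrt_mult)
    also have "sqrt ((1 / \<tau>) ^ 2) = 1 / \<tau>" using tau_pos by (simp only: real_sqrt_abs) simp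
    finally have "sqrt (pi / b) = 1 / \<tau> * sqrt (\<rho> / (4 * pi * \<gamma>))" .
    then have "\<tau> * sqrt (pi / b) = sqrt (\<rho> / (4 * pi * \<gamma>))" using tau_pos by simp
    then show ?thesis unfolding circ_0 by (simp only: of_real_mult[symmetric])
  qed
  finally show ?thesis
  proof (rule Lim_transform_eventually)
    show "eventually (\<lambda>n. of_real (sqrt (real n)) * integral {-(1/2)..1/2} (\<lambda>s. circ s / W s ^ n)
        = of_real (real n powr (3/2) * \<rho> ^ n) * fps_nth P n) sequentially"
      using eventually_ge_at_top[of 1]
    proof eventually_elim
      case (elim n)
      have "(\<lambda>s. circ s / W s ^ n) = (\<lambda>s. of_real (\<rho> ^ n) * (circ s / \<psi> (circ s) ^ n))"
        by (simp add: W_def power_divide fun_eq_iff mult_ac)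
      then have "integral {-(1/2)..1/2} (\<lambda>s. circ s / W s ^ n)
          = of_real (\<rho> ^ n) * integral {-(1/2)..1/2} (\<lambda>s. circ s / \<psi> (circ s) ^ n)"
        by (simp only: integral_mult_right)
      also have "\<dots> = of_real (\<rho> ^ n) * (of_nat n * fps_nth P n)"
        by (simp only: coefficient_integral[OF eq P0 elim])
      finally have I: "integral {-(1/2)..1/2} (\<lambda>s. circ s / W s ^ n) = of_real (\<rho> ^ n) * (of_nat n * fps_nth P n)" .
      have "real n powr (3/2) = real n powr (1/2) * real n powr 1"
        using powr_add[of "real n" "1/2" 1] by simp
      then have pw: "real n powr (3/2) = sqrt (real n) * real n"
        using elim by (simp add: powr_half_sqrt)
      show ?case unfolding I pw by (simp add: mult_ac)
    qed
  qed
qed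

end

section \<open>The square-root singularity\<close>

lemma holomorphic_quadratic_remainder:
  fixes f :: "complex \<Rightarrow> complex"
  assumes hol: "f holomorphic_on ball 0 e" and e: "0 < e"
  obtains B where "\<And>w. norm w \<le> e / 2 \<Longrightarrow> norm (f w - f 0 - deriv f 0 * w) \<le> B * norm w ^ 2"
proof -
  let ?S = "cball (0::complex) (e / 2)"
  have sub: "?S \<subseteq> ball 0 e" using e by auto
  have hol1: "deriv f holomorphic_on ball 0 e" by (rule holomorphic_deriv[OF hol]) simp
  have hol2: "deriv (deriv f) holomorphic_on ball 0 e" by (rule holomorphic_deriv[OF hol1]) simp
  have "continuous_on ?S (deriv (deriv f))"
    using continuous_on_subset[OF holomorphic_on_imp_continuous_on[OF hol2] sub] .
  then have "bounded (deriv (deriv f) ` ?S)"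
    by (intro compact_imp_bounded compact_continuous_image) auto
  then obtain B where B: "\<forall>x\<in>?S. norm (deriv (deriv f) x) \<le> B"
    unfolding bounded_iff by auto
  have "norm (f w - f 0 - deriv f 0 * w) \<le> B * norm w ^ 2" if w: "norm w \<le> e / 2" for w
  proof -
    have D: "((deriv ^^ i) f has_field_derivative (deriv ^^ Suc i) f x) (at x within ?S)" if "x \<in> ?S" "i \<le> 1" for i x
    proof -
      have "x \<in> ball 0 e" using that sub by blast
      then have "((deriv ^^ i) f has_field_derivative (deriv ^^ Suc i) f x) (at x)"
        using that(2) holomorphic_derivI[OF hol open_ball, of x] holomorphic_derivI[OF hol1 open_ball, of x]
        by (cases i) auto
      then show ?thesis by (rule DERIV_subset) simp
    qed
    have "norm ((deriv ^^ 0) f w - (\<Sum>i\<le>1. (deriv ^^ i) f 0 * (w - 0) ^ i / fact i)) \<le> B * norm (w - 0) ^ Suc 1 / fact 1"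
      by (rule complex_Taylor[of ?S 1]) (use D B w e in auto)
    then show ?thesis by (simp add: power2_eq_square algebra_simps)
  qed
  then show ?thesis by (rule that)
qed

lemma norm_csqrt_power2: "norm (csqrt z) ^ 2 = norm z"
  by (metis norm_power power2_csqrt)

locale interval_poset_series = saddle_point +
  fixes P :: "complex fps" and p :: "nat \<Rightarrow> real"
  assumes eq: "(1 - P) * (P - fps_X) = P ^ 2 + P ^ 4"
    and coeff: "\<And>n. fps_nth P n = of_real (p n)" and nonneg: "\<And>n. 0 \<le> p n" and p0: "p 0 = 0"
begin

definition K :: real where "K = sqrt (\<rho> / (4 * pi * \<gamma>))"

lemma K_pos: "0 < K"
  using rho_pos gamma_pos by (simp add: K_def)

lemma p_limit: "(\<lambda>n. real n powr (3/2) * \<rho> ^ n * p n) \<longlonglongrightarrow> K"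
proof -
  have "(\<lambda>n. of_real (real n powr (3/2) * \<rho> ^ n) * fps_nth P n) \<longlonglongrightarrow> of_real K"
    unfolding K_def by (rule coefficient_asymptotics[OF eq]) (simp add: coeff p0)
  then have "(\<lambda>n. of_real (real n powr (3/2) * \<rho> ^ n * p n) :: complex) \<longlonglongrightarrow> of_real K"
    by (simp add: coeff)
  then show ?thesis by (simp only: tendsto_of_real_iff)
qed

lemma p_asymp: "p \<sim>[sequentially] (\<lambda>n. K * (\<rho> powi (- int n) / real n powr (3/2)))"
proof (rule asymp_equivI')
  have "(\<lambda>n. real n powr (3/2) * \<rho> ^ n * p n / K) \<longlonglongrightarrow> K / K"
    using K_pos by (intro tendsto_intros p_limit) auto
  then have "(\<lambda>n. real n powr (3/2) * \<rho> ^ n * p n / K) \<longlonglongrightarrow> 1" using K_pos by simp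
  then show "(\<lambda>n. p n / (K * (\<rho> powi (- int n) / real n powr (3/2)))) \<longlonglongrightarrow> 1"
    by (simp add: power_int_minus field_simps)
qed

text \<open>The ratio test: in the quotient of consecutive coefficients the power of \<open>n\<close> disappears in the limit.\<close>

lemma conv_radius: "fps_conv_radius P = ereal \<rho>"
  unfolding fps_conv_radius_def
proof (rule conv_radius_ratio_limit_nonzero[OF refl])
  define a where "a n = real n powr (3/2) * \<rho> ^ n * p n" for n
  have a: "a \<longlonglongrightarrow> K" using p_limit by (simp only: a_def[abs_def])
  have "(\<lambda>n. a n / a (Suc n) * ((real (Suc n) / real n) powr (3/2)) * \<rho>) \<longlonglongrightarrow> K / K * 1 * \<rho>"
  proof (intro tendsto_intros a LIMSEQ_Suc)
    show "(\<lambda>n. (real (Suc n) / real n) powr (3/2)) \<longlonglongrightarrow> 1" by real_asymp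
  qed (use K_pos in auto)
  then have "(\<lambda>n. a n / a (Suc n) * ((real (Suc n) / real n) powr (3/2)) * \<rho>) \<longlonglongrightarrow> \<rho>"
    using K_pos by simp
  then show "(\<lambda>n. norm (fps_nth P n) / norm (fps_nth P (Suc n))) \<longlonglongrightarrow> \<rho>"
  proof (rule Lim_transform_eventually)
    show "eventually (\<lambda>n. a n / a (Suc n) * ((real (Suc n) / real n) powr (3/2)) * \<rho>
        = norm (fps_nth P n) / norm (fps_nth P (Suc n))) sequentially"
      using eventually_gt_at_top[of 0]
    proof eventually_elim
      case (elim n)
      have "norm (fps_nth P k) = p k" for k using nonneg[of k] by (simp add: coeff)
      moreover have "real n powr (3/2) > 0" "real (Suc n) powr (3/2) > 0" using elim by simp_all
      moreover have "(real (Suc n) / real n) powr (3/2) = real (Suc n) powr (3/2) / real n powr (3/2)"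
        by (rule powr_divide)
      ultimately show ?case
        using rho_pos by (simp add: a_def divide_simps mult_ac)
    qed
  qed
qed (use rho_pos in simp)

text \<open>The exponent \<open>3/2\<close> makes the series converge absolutely on the boundary circle as well.\<close>

lemma summable_p: "summable (\<lambda>n. p n * \<rho> ^ n)"
proof -
  have "Bseq (\<lambda>n. real n powr (3/2) * \<rho> ^ n * p n)"
    by (rule convergent_imp_Bseq) (use p_limit in \<open>auto simp: convergent_def\<close>)
  then obtain B where B: "\<And>n. norm (real n powr (3/2) * \<rho> ^ n * p n) \<le> B" by (auto simp: Bseq_def)
  have "summable (\<lambda>n. B * real n powr (-3/2))"
    by (intro summable_mult) (simp add: summable_real_powr_iff)
  then show ?thesis
  proof (rule summable_comparison_test_ev[rotated])
    show "eventually (\<lambda>n. norm (p n * \<rho> ^ n) \<le> B * real n powr (-3/2)) sequentially"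
      using eventually_gt_at_top[of 0]
    proof eventually_elim
      case (elim n)
      have "real n powr (3/2) * (p n * \<rho> ^ n) \<le> B"
        using B[of n] by (simp add: mult_ac)
      then have "p n * \<rho> ^ n \<le> B / real n powr (3/2)"
        using elim by (simp add: pos_le_divide_eq mult_ac)
      also have "B / real n powr (3/2) = B * real n powr (-3/2)"
      proof -
        have "real n powr (-3/2) = inverse (real n powr (3/2))" using powr_minus[of "real n" "3/2"] by simp
        then show ?thesis by (simp only: divide_inverse)
      qed
      finally show ?case using nonneg[of n] rho_pos by simp
    qed
  qed
qed

definition F :: "complex \<Rightarrow> complex" where "F z = eval_fps P z"

definition G :: "real \<Rightarrow> real" where "G x = (\<Sum>n. p n * x ^ n)"

lemma term_le: "0 \<le> x \<Longrightarrow> x \<le> \<rho> \<Longrightarrow> p n * x ^ n \<le> p n * \<rho> ^ n"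
  using nonneg by (intro mult_left_mono power_mono) auto

lemma summable_G: "0 \<le> x \<Longrightarrow> x \<le> \<rho> \<Longrightarrow> summable (\<lambda>n. p n * x ^ n)"
  by (rule summable_comparison_test'[OF summable_p, of 0]) (use term_le nonneg in auto)

lemma F_of_real: "0 \<le> x \<Longrightarrow> x \<le> \<rho> \<Longrightarrow> F (of_real x) = of_real (G x)"
  unfolding F_def G_def eval_fps_def using suminf_of_real[OF summable_G, of x, where 'a = complex]
  by (simp add: coeff)

lemma G_nonneg: "0 \<le> x \<Longrightarrow> x \<le> \<rho> \<Longrightarrow> 0 \<le> G x"
  unfolding G_def by (intro suminf_nonneg summable_G) (use nonneg in auto)

lemma G_mono: "0 \<le> x \<Longrightarrow> x \<le> \<rho> \<Longrightarrow> G x \<le> G \<rho>"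
  unfolding G_def by (intro suminf_le summable_G term_le) (use rho_pos in auto)

lemma norm_F_le: "norm z \<le> \<rho> \<Longrightarrow> norm (F z) \<le> G \<rho>"
proof -
  assume z: "norm z \<le> \<rho>"
  have "norm (F z) \<le> (\<Sum>n. norm (fps_nth P n * z ^ n))"
    unfolding F_def eval_fps_def
    by (rule summable_norm) (use summable_G[of "norm z"] z nonneg in \<open>simp add: norm_mult norm_power coeff\<close>)
  also have "\<dots> = G (norm z)" using nonneg by (simp add: G_def norm_mult norm_power coeff)
  also have "\<dots> \<le> G \<rho>" using z by (intro G_mono) auto
  finally show ?thesis .
qed

lemma continuous_on_F: "continuous_on (cball 0 \<rho>) F"
proof -
  have "uniform_limit (cball 0 \<rho>) (\<lambda>n z. \<Sum>i<n. fps_nth P i * z ^ i) (\<lambda>z. \<Sum>i. fps_nth P i * z ^ i) sequentially"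
  proof (rule Weierstrass_m_test[OF _ summable_p])
    fix n and z :: complex assume "z \<in> cball 0 \<rho>"
    then show "norm (fps_nth P n * z ^ n) \<le> p n * \<rho> ^ n"
      using nonneg[of n] term_le[of "norm z" n] by (simp add: coeff norm_mult norm_power)
  qed
  then have "continuous_on (cball 0 \<rho>) (\<lambda>z. \<Sum>i. fps_nth P i * z ^ i)"
    by (rule uniform_limit_theorem[rotated])
      (auto intro!: always_eventually continuous_intros)
  then show ?thesis by (simp add: F_def[abs_def] eval_fps_def[abs_def])
qed

text \<open>The identity of formal series holds for values inside the disc, and on the boundary by continuity.\<close>

lemma F_equation:
  assumes "norm z \<le> \<rho>"
  shows "(1 - F z) * (F z - z) - (F z ^ 2 + F z ^ 4) = 0"
proof (rule continuous_constant_on_closure[of "ball 0 \<rho>" "\<lambda>z. (1 - F z) * (F z - z) - (F z ^ 2 + F z ^ 4)"])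
  have cl: "closure (ball (0::complex) \<rho>) = cball 0 \<rho>" using rho_pos by simp
  show "continuous_on (closure (ball 0 \<rho>)) (\<lambda>z. (1 - F z) * (F z - z) - (F z ^ 2 + F z ^ 4))"
    unfolding cl by (intro continuous_intros continuous_on_F)
  show "z \<in> closure (ball 0 \<rho>)" using assms unfolding cl by simp
  fix z :: complex assume "z \<in> ball 0 \<rho>"
  then have z: "ereal (norm z) < fps_conv_radius P" by (simp add: conv_radius)
  have r1: "fps_conv_radius (1 - P) \<ge> fps_conv_radius P" "fps_conv_radius (P - fps_X) \<ge> fps_conv_radius P"
    using fps_conv_radius_diff[of 1 P] fps_conv_radius_diff[of P fps_X] by simp_all
  have rp: "fps_conv_radius (P ^ k) \<ge> fps_conv_radius P" for k by (rule fps_conv_radius_power)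
  have "eval_fps ((1 - P) * (P - fps_X)) z = (1 - F z) * (F z - z)"
    using z r1 by (subst eval_fps_mult) (auto simp: eval_fps_diff F_def intro: less_le_trans)
  moreover have "eval_fps (P ^ 2 + P ^ 4) z = F z ^ 2 + F z ^ 4"
    using z less_le_trans[OF z rp] by (simp add: eval_fps_add eval_fps_power F_def)
  ultimately show "(1 - F z) * (F z - z) - (F z ^ 2 + F z ^ 4) = 0" using eq by simp
qed

text \<open>Eliminating the powers of \<open>F z\<close> by the functional equation, the quartic in \<open>F z\<close> is the one with the
double root \<open>\<tau>\<close>.\<close>

lemma F_factorization:
  assumes "norm z \<le> \<rho>"
  shows "(of_real \<rho> - z) * (1 - F z)
    = (F z - of_real \<tau>) ^ 2 * (F z ^ 2 + 2 * of_real \<tau> * F z + of_real (2 + 3 * \<tau> ^ 2))"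
proof -
  have "(of_real \<rho> - z) * (1 - F z) = of_real \<rho> * (1 - F z) - F z * (1 - 2 * F z - F z ^ 3)
      - ((1 - F z) * (F z - z) - (F z ^ 2 + F z ^ 4)) * (- 1)"
    by (simp add: algebra_simps power_numeral_reduce)
  then show ?thesis unfolding F_equation[OF assms] by (simp add: double_root_factorization)
qed

text \<open>At \<open>z = \<rho>\<close> the left-hand side of the factorisation vanishes, while the quadratic factor is positive on
nonnegative reals.\<close>

lemma G_rho: "G \<rho> = \<tau>"
proof -
  have pos: "0 < G \<rho> ^ 2 + 2 * \<tau> * G \<rho> + (2 + 3 * \<tau> ^ 2)"
    using G_nonneg[of \<rho>] rho_pos tau_pos by (intro add_nonneg_pos add_pos_nonneg) auto
  have "(of_real \<rho> - of_real \<rho>) * (1 - F (of_real \<rho>)) = (of_real (G \<rho>) - of_real \<tau>) ^ 2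
      * (of_real (G \<rho>) ^ 2 + 2 * of_real \<tau> * of_real (G \<rho>) + of_real (2 + 3 * \<tau> ^ 2))"
    using F_factorization[of "of_real \<rho>"] F_of_real[of \<rho>] rho_pos by simp
  also have "\<dots> = of_real ((G \<rho> - \<tau>) ^ 2 * (G \<rho> ^ 2 + 2 * \<tau> * G \<rho> + (2 + 3 * \<tau> ^ 2)))"
    by simp
  finally have "(of_real ((G \<rho> - \<tau>) ^ 2 * (G \<rho> ^ 2 + 2 * \<tau> * G \<rho> + (2 + 3 * \<tau> ^ 2))) :: complex) = 0"
    by simp
  then have "(G \<rho> - \<tau>) ^ 2 * (G \<rho> ^ 2 + 2 * \<tau> * G \<rho> + (2 + 3 * \<tau> ^ 2)) = 0"
    by (simp only: of_real_eq_0_iff)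
  then show ?thesis using pos by simp
qed

lemma F_ne_1: "norm z \<le> \<rho> \<Longrightarrow> F z \<noteq> 1"
  using norm_F_le[of z] G_rho tau_in by auto

lemma F_rho: "F (of_real \<rho>) = of_real \<tau>"
  using F_of_real[of \<rho>] rho_pos G_rho by simp

lemma rho_minus_z:
  assumes "norm z \<le> \<rho>"
  shows "of_real \<rho> - z = (F z - of_real \<tau>) ^ 2 * curvature (F z)"
proof -
  have "(of_real \<rho> - z) * (1 - F z) / (1 - F z) = of_real \<rho> - z"
    using F_ne_1[OF assms] by simp
  then show ?thesis unfolding F_factorization[OF assms] by (simp add: curvature_def)
qed

text \<open>A coordinate around \<open>\<tau>\<close> in which \<open>u \<mapsto> \<rho> - \<psi> u\<close> becomes squaring.\<close>

definition h :: "complex \<Rightarrow> complex" where "h u = (u - of_real \<tau>) * csqrt (curvature u)"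

lemma h_power2: "h u ^ 2 = (u - of_real \<tau>) ^ 2 * curvature u"
  by (simp add: h_def power_mult_distrib)

text \<open>Since \<open>h'(\<tau>) = sqrt \<gamma>\<close> is nonzero, \<open>h\<close> is injective near \<open>\<tau>\<close>.\<close>

lemma ex_local_inverse:
  obtains \<delta> H \<epsilon> where "0 < \<delta>" "0 < \<epsilon>" "H holomorphic_on ball 0 \<epsilon>" "H 0 = of_real \<tau>"
    "deriv H 0 = of_real (1 / sqrt \<gamma>)" "\<And>u. u \<in> ball (of_real \<tau>) \<delta> \<Longrightarrow> H (h u) = u"
    "continuous_on (ball (of_real \<tau>) \<delta>) h"
proof -
  have t1: "of_real \<tau> \<noteq> (1 :: complex)" using tau_in by simp
  have "isCont curvature (of_real \<tau>)"
    unfolding curvature_def[abs_def] using t1 by (intro continuous_intros) auto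
  then have "(curvature \<longlongrightarrow> of_real \<gamma>) (nhds (of_real \<tau>))"
    unfolding isCont_def curvature_tau by (metis curvature_tau tendsto_at_iff_tendsto_nhds)
  then have "((\<lambda>u. Re (curvature u)) \<longlongrightarrow> Re (of_real \<gamma>)) (nhds (of_real \<tau>))"
    by (rule tendsto_Re)
  then have "eventually (\<lambda>u. 0 < Re (curvature u)) (nhds (of_real \<tau>))"
    by (rule order_tendstoD) (simp add: gamma_pos)
  moreover have "eventually (\<lambda>u. u \<noteq> 1) (nhds (of_real \<tau> :: complex))"
    using t1 by (rule t1_space_nhds)
  ultimately have "eventually (\<lambda>u. 0 < Re (curvature u) \<and> u \<noteq> 1) (nhds (of_real \<tau>))"
    by (rule eventually_conj)
  then obtain d where d: "0 < d" and S: "\<And>u. dist u (of_real \<tau>) < d \<Longrightarrow> 0 < Re (curvature u) \<and> u \<noteq> 1"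
    unfolding eventually_nhds_metric by blast
  let ?S = "ball (of_real \<tau> :: complex) d"
  have S': "0 < Re (curvature u)" "u \<noteq> 1" if "u \<in> ?S" for u
    using S[of u] that by (simp_all add: dist_commute)
  have holc: "curvature holomorphic_on ?S"
    unfolding curvature_def[abs_def] using S' by (intro holomorphic_intros) auto
  have hols: "(\<lambda>u. csqrt (curvature u)) holomorphic_on ?S"
  proof (intro holomorphic_on_csqrt' holc)
    fix u assume "u \<in> ?S"
    then show "curvature u \<notin> \<real>\<^sub>\<le>\<^sub>0" using S'(1)[of u] by (auto simp: complex_nonpos_Reals_iff)
  qed
  have holh: "h holomorphic_on ?S"
    unfolding h_def[abs_def] by (intro holomorphic_intros hols)
  have t: "of_real \<tau> \<in> ?S" using d by simp
  obtain D where D: "((\<lambda>u. csqrt (curvature u)) has_field_derivative D) (at (of_real \<tau>))"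
    using hols t by (meson field_differentiable_def holomorphic_on_imp_differentiable_at open_ball)
  have "((\<lambda>u. u - of_real \<tau>) has_field_derivative 1) (at (of_real \<tau>))"
    by (auto intro!: derivative_eq_intros)
  from DERIV_mult[OF this D] have "(h has_field_derivative of_real (sqrt \<gamma>)) (at (of_real \<tau>))"
    using gamma_pos by (simp add: h_def[abs_def] curvature_tau csqrt_of_real_nonneg)
  then have dh: "deriv h (of_real \<tau>) = of_real (sqrt \<gamma>)" by (rule DERIV_imp_deriv)
  then have "deriv h (of_real \<tau>) \<noteq> 0" using gamma_pos by simp
  then obtain \<delta> where \<delta>: "0 < \<delta>" "ball (of_real \<tau>) \<delta> \<subseteq> ?S" "inj_on h (ball (of_real \<tau>) \<delta>)"
    using has_complex_derivative_locally_injective[OF holh t open_ball] by blast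
  let ?U = "ball (of_real \<tau> :: complex) \<delta>"
  have holU: "h holomorphic_on ?U" by (rule holomorphic_on_subset[OF holh \<delta>(2)])
  obtain H where H: "H holomorphic_on (h ` ?U)" "\<And>z. z \<in> ?U \<Longrightarrow> deriv h z * deriv H (h z) = 1"
      "\<And>z. z \<in> ?U \<Longrightarrow> H (h z) = z"
    using holomorphic_has_inverse[OF holU open_ball \<delta>(3)] by blast
  have tU: "of_real \<tau> \<in> ?U" using \<delta> by simp
  have h0: "h (of_real \<tau>) = 0" by (simp add: h_def)
  have "open (h ` ?U)" by (rule open_mapping_thm3[OF holU open_ball \<delta>(3)])
  moreover have "0 \<in> h ` ?U" using tU h0 by (metis imageI)
  ultimately obtain \<epsilon> where \<epsilon>: "0 < \<epsilon>" "ball 0 \<epsilon> \<subseteq> h ` ?U"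
    by (meson open_contains_ball)
  show ?thesis
  proof (rule that[OF \<delta>(1) \<epsilon>(1)])
    show "H holomorphic_on ball 0 \<epsilon>" by (rule holomorphic_on_subset[OF H(1) \<epsilon>(2)])
    show "H 0 = of_real \<tau>" using H(3)[OF tU] h0 by simp
    have "of_real (sqrt \<gamma>) * deriv H 0 = 1" using H(2)[OF tU] h0 dh by simp
    moreover have "(of_real (sqrt \<gamma>) :: complex) \<noteq> 0" using gamma_pos by simp
    ultimately show "deriv H 0 = of_real (1 / sqrt \<gamma>)"
      by (metis nonzero_eq_divide_eq mult.commute of_real_1 of_real_divide)
    show "continuous_on ?U h" by (rule holomorphic_on_imp_continuous_on[OF holU])
  qed (rule H(3))
qed

text \<open>Along \<open>[0, \<rho>]\<close> the values of \<open>F\<close> are real and at most \<open>\<tau>\<close>, its value at \<open>\<rho>\<close>. This decides later which of the two square roots of \<open>\<rho> - z\<close> belongs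
to \<open>F\<close>.\<close>

lemma h_F_real_nonpos:
  assumes "0 \<le> x" "x \<le> \<rho>"
  shows "\<exists>y\<le>0. h (F (of_real x)) = of_real y"
proof -
  define g where "g = G x"
  have g: "0 \<le> g" "g \<le> \<tau>" using G_nonneg[OF assms] G_mono[OF assms] G_rho by (simp_all add: g_def)
  define k where "k = (g ^ 2 + 2 * \<tau> * g + (2 + 3 * \<tau> ^ 2)) / (1 - g)"
  have k: "0 \<le> k" using g tau_in by (auto simp: k_def)
  have "curvature (of_real g) = of_real k" by (simp add: curvature_def k_def)
  then have "h (of_real g) = of_real ((g - \<tau>) * sqrt k)"
    using k by (simp add: h_def csqrt_of_real_nonneg)
  moreover have "(g - \<tau>) * sqrt k \<le> 0" using g k by (intro mult_nonpos_nonneg) auto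
  ultimately show ?thesis using F_of_real[OF assms] by (auto simp: g_def)
qed

text \<open>On the disc, \<open>h (F z)\<close> is a square root of \<open>\<rho> - z\<close>. Its quotient by \<open>- csqrt (\<rho> - z)\<close> is continuous with values in
\<open>{1, -1}\<close> on the convex set where the disc meets a small ball around \<open>\<rho>\<close>, hence constant, and it is 1 at a real point.
So there \<open>F z = H (- csqrt (\<rho> - z))\<close> with the local inverse \<open>H\<close> of \<open>h\<close>, and the right-hand side is holomorphic on
the slit ball. The expansion is the linear Taylor approximation of \<open>H\<close> at 0; its quadratic remainder is of order
\<open>|csqrt (\<rho> - z)|\<^sup>2 = |\<rho> - z|\<close>.\<close>

lemma square_root_expansion:
  "\<exists>r>0. \<exists>Pc. Pc holomorphic_on slit_domain \<rho> r \<and> (\<forall>z\<in>ball 0 \<rho>. Pc z = eval_fps P z) \<and>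
    (\<lambda>z. Pc z - (of_real \<tau> - of_real (sqrt (\<rho> / \<gamma>)) * csqrt (1 - z / of_real \<rho>)))
      \<in> O[at (of_real \<rho>) within slit_domain \<rho> r](\<lambda>z. 1 - z / of_real \<rho>)"
proof -
  obtain \<delta> H \<epsilon> where \<delta>: "0 < \<delta>" and \<epsilon>: "0 < \<epsilon>" and holH: "H holomorphic_on ball 0 \<epsilon>"
    and H0: "H 0 = of_real \<tau>" and dH: "deriv H 0 = of_real (1 / sqrt \<gamma>)"
    and Hh: "\<And>u. u \<in> ball (of_real \<tau>) \<delta> \<Longrightarrow> H (h u) = u"
    and conth: "continuous_on (ball (of_real \<tau>) \<delta>) h"
    by (rule ex_local_inverse) blast
  obtain B where B: "\<And>w. norm w \<le> \<epsilon> / 2 \<Longrightarrow> norm (H w - H 0 - deriv H 0 * w) \<le> B * norm w ^ 2"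
    using holomorphic_quadratic_remainder[OF holH \<epsilon>] by blast
  have "of_real \<rho> \<in> cball (0::complex) \<rho>" using rho_pos by simp
  then obtain d where d: "0 < d" and Fd: "\<And>z. z \<in> cball 0 \<rho> \<Longrightarrow> dist z (of_real \<rho>) < d \<Longrightarrow> dist (F z) (F (of_real \<rho>)) < \<delta>"
    using continuous_on_F \<delta> unfolding continuous_on_iff by metis
  define r where "r = min d ((\<epsilon> / 2) ^ 2)"
  have r: "0 < r" "r \<le> d" "r \<le> (\<epsilon> / 2) ^ 2" using d \<epsilon> by (simp_all add: r_def)
  define w where "w z = - csqrt (of_real \<rho> - z)" for z
  have w2: "norm (w z) ^ 2 = norm (of_real \<rho> - z)" for z by (simp add: w_def norm_csqrt_power2)
  have wsmall: "norm (w z) < \<epsilon> / 2" if "z \<in> ball (of_real \<rho>) r" for z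
  proof (rule power2_less_imp_less)
    show "norm (w z) ^ 2 < (\<epsilon> / 2) ^ 2" using that r(3) by (simp add: w2 dist_norm)
  qed (use \<epsilon> in simp)
  let ?N = "ball (of_real \<rho>) r - of_real ` {\<rho>..} :: complex set"
  have slit: "of_real \<rho> - z \<notin> \<real>\<^sub>\<le>\<^sub>0" if "z \<in> ?N" for z
  proof
    assume "of_real \<rho> - z \<in> \<real>\<^sub>\<le>\<^sub>0"
    then obtain y where y: "of_real \<rho> - z = of_real y" "y \<le> 0" by (auto elim: nonpos_Reals_cases)
    then have "z = of_real (\<rho> - y)" by (simp add: algebra_simps)
    moreover have "\<rho> - y \<in> {\<rho>..}" using y by simp
    ultimately have "z \<in> of_real ` {\<rho>..}" by blast
    then show False using that by blast
  qed
  have holw: "w holomorphic_on ?N"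
    unfolding w_def[abs_def] by (intro holomorphic_intros) (use slit in auto)
  have holHw: "(\<lambda>z. H (w z)) holomorphic_on ?N"
  proof -
    have "w ` ?N \<subseteq> ball 0 \<epsilon>" using wsmall \<epsilon> by fastforce
    then have "(H \<circ> w) holomorphic_on ?N" by (rule holomorphic_on_compose_gen[OF holw holH])
    then show ?thesis by (simp add: o_def)
  qed
  have openN: "open ?N"
  proof (rule open_Diff)
    have "of_real ` {\<rho>..} = {z :: complex. \<rho> \<le> Re z} \<inter> {z. Im z = 0}"
      by (auto simp: image_iff complex_eq_iff)
    moreover have "closed \<dots>"
      by (intro closed_Int closed_Collect_le closed_Collect_eq continuous_intros)
    ultimately show "closed (of_real ` {\<rho>..} :: complex set)" by simp
  qed simp
  have D_in: "z \<in> ?N" if "z \<in> ball 0 \<rho>" "z \<in> ball (of_real \<rho>) r" for z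
    using that by auto
  let ?D = "ball 0 \<rho> \<inter> ball (of_real \<rho>) r :: complex set"
  have FU: "F z \<in> ball (of_real \<tau>) \<delta>" if "z \<in> ?D" for z
    using Fd[of z] that r(2) F_rho by (auto simp: dist_commute)
  have agree: "F z = H (w z)" if z: "z \<in> ?D" for z
  proof -
    define s where "s z = h (F z) / w z" for z
    have wnz: "w z \<noteq> 0" if "z \<in> ?D" for z using slit[OF D_in, of z] that by (auto simp: w_def)
    have s2: "s z ^ 2 = 1" if "z \<in> ?D" for z
    proof -
      have "h (F z) ^ 2 = of_real \<rho> - z" using rho_minus_z[of z] that by (simp add: h_power2)
      also have "\<dots> = w z ^ 2" by (simp add: w_def)
      finally show ?thesis using wnz[OF that] by (simp add: s_def power_divide)
    qed
    have "continuous_on ?D s"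
    proof -
      have "continuous_on ?D F" by (rule continuous_on_subset[OF continuous_on_F]) auto
      then have "continuous_on ?D (h \<circ> F)"
        by (rule continuous_on_compose) (rule continuous_on_subset[OF conth], use FU in blast)
      moreover have "continuous_on ?D w"
        by (rule continuous_on_subset[OF holomorphic_on_imp_continuous_on[OF holw]]) (use D_in in blast)
      ultimately show ?thesis unfolding s_def[abs_def] using wnz by (auto simp: o_def intro!: continuous_intros)
    qed
    moreover have "connected ?D" by (intro convex_connected convex_Int convex_ball)
    moreover have "finite (s ` ?D)"
    proof (rule finite_subset)
      show "s ` ?D \<subseteq> {1, -1}"
      proof (rule image_subsetI)
        fix z assume "z \<in> ?D"
        then show "s z \<in> {1, -1}" using s2[of z] by (simp add: power2_eq_1_iff)
      qed
    qed simp
    ultimately have const: "s constant_on ?D" by (intro continuous_finite_range_constant)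
    \<comment> \<open>A real point below \<open>\<rho>\<close> at which the sign of the square root is visible.\<close>
    define x where "x = \<rho> - min r \<rho> / 2"
    have x: "0 \<le> x" "x < \<rho>" "\<rho> - x < r" using r rho_pos by (auto simp: x_def min_def)
    have xD: "of_real x \<in> ?D" using x by (auto simp: dist_norm simp flip: of_real_diff)
    have "s (of_real x) = 1"
    proof -
      obtain y where y: "y \<le> 0" "h (F (of_real x)) = of_real y" using h_F_real_nonpos[of x] x by auto
      have "w (of_real x) = of_real (- sqrt (\<rho> - x))"
        using x csqrt_of_real_nonneg[of "\<rho> - x"] by (simp add: w_def)
      then have "s (of_real x) = of_real (y / - sqrt (\<rho> - x))" using y by (simp add: s_def)
      then have "Re (s (of_real x)) = y / - sqrt (\<rho> - x)" by (simp only: Re_complex_of_real)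
      also have "0 \<le> y / - sqrt (\<rho> - x)" by (rule divide_nonpos_neg) (use y x in simp_all)
      finally have "s (of_real x) \<noteq> - 1" by auto
      then show ?thesis using s2[OF xD] by (simp add: power2_eq_1_iff)
    qed
    then have "s z = 1" using const xD z unfolding constant_on_def by auto
    then have "h (F z) = w z" using wnz[OF z] by (simp add: s_def)
    then show ?thesis using Hh[OF FU[OF z]] by simp
  qed
  define Pc where "Pc z = (if z \<in> ball 0 \<rho> then F z else H (w z))" for z
  have holF: "F holomorphic_on ball 0 \<rho>"
    unfolding F_def[abs_def] by (intro holomorphic_on_eval_fps) (simp add: conv_radius)
  have "Pc holomorphic_on (ball 0 \<rho> \<union> ?N)"
    unfolding Pc_def[abs_def]
    by (rule holomorphic_on_If_Un[OF holF holHw open_ball openN]) (use agree in auto)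
  then have holP: "Pc holomorphic_on slit_domain \<rho> r" by (simp add: slit_domain_def)
  have Pc_eq: "Pc z = H (w z)" if "z \<in> ball (of_real \<rho>) r" for z
    using agree[of z] that by (auto simp: Pc_def)
  have scale: "0 < Re (of_real c * v) \<or> Re (of_real c * v) = 0 \<and> 0 \<le> Im (of_real c * v)"
    if "0 < c" "0 < Re v \<or> Re v = 0 \<and> 0 \<le> Im v" for c v
    using that by auto
  have w_eq: "w z = - (of_real (sqrt \<rho>) * csqrt (1 - z / of_real \<rho>))" for z
  proof -
    have "csqrt (of_real \<rho> - z) = of_real (sqrt \<rho>) * csqrt (1 - z / of_real \<rho>)"
    proof (rule csqrt_unique)
      have "(of_real (sqrt \<rho>) :: complex) ^ 2 = of_real \<rho>" using rho_pos by (simp flip: of_real_power)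
      then show "(of_real (sqrt \<rho>) * csqrt (1 - z / of_real \<rho>)) ^ 2 = of_real \<rho> - z"
        using rho_pos by (simp add: power_mult_distrib right_diff_distrib)
      show "0 < Re (of_real (sqrt \<rho>) * csqrt (1 - z / of_real \<rho>)) \<or>
          Re (of_real (sqrt \<rho>) * csqrt (1 - z / of_real \<rho>)) = 0 \<and>
          0 \<le> Im (of_real (sqrt \<rho>) * csqrt (1 - z / of_real \<rho>))"
        by (rule scale[OF _ csqrt_principal]) (use rho_pos in simp)
    qed
    then show ?thesis by (simp add: w_def)
  qed
  have main: "deriv H 0 * w z = - (of_real (sqrt (\<rho> / \<gamma>)) * csqrt (1 - z / of_real \<rho>))" for z
    by (simp add: dH w_eq real_sqrt_divide)
  have "(\<lambda>z. Pc z - (of_real \<tau> - of_real (sqrt (\<rho> / \<gamma>)) * csqrt (1 - z / of_real \<rho>)))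
      \<in> O[at (of_real \<rho>) within slit_domain \<rho> r](\<lambda>z. 1 - z / of_real \<rho>)"
  proof (rule bigoI[where c = "B * \<rho>"])
    have "eventually (\<lambda>z. z \<in> ball (of_real \<rho>) r) (at (of_real \<rho>) within slit_domain \<rho> r)"
      unfolding eventually_at using r(1) by (auto intro!: exI[of _ r] simp: dist_commute)
    then show "eventually (\<lambda>z. norm (Pc z - (of_real \<tau> - of_real (sqrt (\<rho> / \<gamma>)) * csqrt (1 - z / of_real \<rho>)))
        \<le> B * \<rho> * norm (1 - z / of_real \<rho>)) (at (of_real \<rho>) within slit_domain \<rho> r)"
    proof eventually_elim
      case (elim z)
      have "Pc z - (of_real \<tau> - of_real (sqrt (\<rho> / \<gamma>)) * csqrt (1 - z / of_real \<rho>))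
          = H (w z) - H 0 - deriv H 0 * w z"
        using Pc_eq[OF elim] H0 main[of z] by simp
      then have "norm (Pc z - (of_real \<tau> - of_real (sqrt (\<rho> / \<gamma>)) * csqrt (1 - z / of_real \<rho>)))
          \<le> B * norm (w z) ^ 2"
        using B[of "w z"] wsmall[OF elim] by simp
      also have "norm (w z) ^ 2 = \<rho> * norm (1 - z / of_real \<rho>)"
      proof -
        have "of_real \<rho> - z = of_real \<rho> * (1 - z / of_real \<rho>)" using rho_pos by (simp add: right_diff_distrib)
        then have "norm (of_real \<rho> - z) = norm (of_real \<rho> * (1 - z / of_real \<rho>))" by (simp only:)
        then show ?thesis using rho_pos by (simp add: w2 norm_mult)
      qed
      finally show ?case by (simp add: mult.assoc)
    qed
  qed
  then show ?thesis using r(1) holP by (intro exI[of _ r] conjI exI[of _ Pc]) (auto simp: Pc_def F_def)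
qed

end

section \<open>Asymptotics of the number of interval posets\<close>

theorem theorem20:
  shows "(\<exists>!u. u \<in> {0<..<1} \<and> deriv \<Lambda> u = 1) \<and>
    (\<forall>\<tau> \<rho>. \<tau> \<in> {0<..<1} \<and> deriv \<Lambda> \<tau> = 1 \<and> \<rho> = \<tau> - \<Lambda> \<tau> \<longrightarrow>
      fps_conv_radius interval_poset_gf = ereal \<rho> \<and>
      (\<exists>r>0. \<exists>P. P holomorphic_on slit_domain \<rho> r \<and>
        (\<forall>z\<in>ball 0 \<rho>. P z = eval_fps interval_poset_gf z) \<and>
        (\<lambda>z. P z - (of_real \<tau> - of_real (sqrt (2 * \<rho> / (deriv ^^ 2) \<Lambda> \<tau>)) * csqrt (1 - z / of_real \<rho>)))
          \<in> O[at (of_real \<rho>) within slit_domain \<rho> r](\<lambda>z. 1 - z / of_real \<rho>)) \<and>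
      \<bar>\<tau> - 0.2708\<bar> \<le> 0.00005 \<and>
      \<bar>\<rho> - 0.1629\<bar> \<le> 0.00005 \<and>
      \<bar>sqrt (2 * \<rho> / (deriv ^^ 2) \<Lambda> \<tau>) - 0.2206\<bar> \<le> 0.00005 \<and>
      asymp_equiv (\<lambda>n. real (num_interval_posets n)) sequentially
        (\<lambda>n. sqrt (\<rho> / (2 * pi * (deriv ^^ 2) \<Lambda> \<tau>)) * (\<rho> powi (- int n) / real n powr (3/2))) \<and>
      \<bar>sqrt (\<rho> / (2 * pi * (deriv ^^ 2) \<Lambda> \<tau>)) - 0.0622\<bar> \<le> 0.00005 \<and>
      \<bar>inverse \<rho> - 6.1403\<bar> \<le> 0.00005)"
proof (intro conjI allI impI)
  show "\<exists>!u. u \<in> {0<..<1} \<and> deriv \<Lambda> u = 1" by (rule ex1_critical_point)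
next
  fix \<tau> \<rho> :: real
  assume hyp: "\<tau> \<in> {0<..<1} \<and> deriv \<Lambda> \<tau> = 1 \<and> \<rho> = \<tau> - \<Lambda> \<tau>"
  \<comment> \<open>The empty permutation is counted in \<open>num_interval_posets 0\<close> but not in the series.\<close>
  define p where "p n = (if n \<ge> 1 then real (num_interval_posets n) else 0)" for n
  interpret interval_poset_series \<tau> \<rho> interval_poset_gf p
  proof
    show "\<tau> \<in> {0<..<1}" "\<rho> = \<tau> - \<Lambda> \<tau>" using hyp by blast+
    then show "critical_poly \<tau> = 0" using hyp deriv_Lambda_eq_1_iff by blast
    show "(1 - interval_poset_gf) * (interval_poset_gf - fps_X) = interval_poset_gf ^ 2 + interval_poset_gf ^ 4"
      by (rule interval_poset_gf_equation)
  qed (auto simp: p_def interval_poset_gf_def)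
  show "fps_conv_radius interval_poset_gf = ereal \<rho>" by (rule conv_radius)
  have amplitude: "2 * \<rho> / (deriv ^^ 2) \<Lambda> \<tau> = \<rho> / \<gamma>" by (simp add: Lambda''_eq)
  show "\<exists>r>0. \<exists>P. P holomorphic_on slit_domain \<rho> r \<and>
        (\<forall>z\<in>ball 0 \<rho>. P z = eval_fps interval_poset_gf z) \<and>
        (\<lambda>z. P z - (of_real \<tau> - of_real (sqrt (2 * \<rho> / (deriv ^^ 2) \<Lambda> \<tau>)) * csqrt (1 - z / of_real \<rho>)))
          \<in> O[at (of_real \<rho>) within slit_domain \<rho> r](\<lambda>z. 1 - z / of_real \<rho>)"
    unfolding amplitude by (rule square_root_expansion)
  have K_eq: "sqrt (\<rho> / (2 * pi * (deriv ^^ 2) \<Lambda> \<tau>)) = K" by (simp add: Lambda''_eq K_def mult_ac)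
  have "(\<lambda>n. real (num_interval_posets n)) \<sim>[sequentially] p"
    by (rule asymp_equiv_refl_ev) (use eventually_ge_at_top[of 1] in \<open>eventually_elim, simp add: p_def\<close>)
  from asymp_equiv_trans[OF this p_asymp]
  show "(\<lambda>n. real (num_interval_posets n)) \<sim>[sequentially]
      (\<lambda>n. sqrt (\<rho> / (2 * pi * (deriv ^^ 2) \<Lambda> \<tau>)) * (\<rho> powi (- int n) / real n powr (3/2)))"
    unfolding K_eq .
  show "\<bar>\<tau> - 0.2708\<bar> \<le> 0.00005" "\<bar>\<rho> - 0.1629\<bar> \<le> 0.00005"
    "\<bar>sqrt (2 * \<rho> / (deriv ^^ 2) \<Lambda> \<tau>) - 0.2206\<bar> \<le> 0.00005"
    "\<bar>sqrt (\<rho> / (2 * pi * (deriv ^^ 2) \<Lambda> \<tau>)) - 0.0622\<bar> \<le> 0.00005"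
    "\<bar>inverse \<rho> - 6.1403\<bar> \<le> 0.00005"
    unfolding Lambda''_eq by (rule numerics)+
qed

end
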